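(* Let $(\lambda_1,\lambda_2)$ be in the unstable regime and let $c>0$ be arbitrary. Then $V(c)$ is a natural constraint: each critical point of $E|_{V(c)}$ is a critical point of $E|_{S(c)}$.
   Context: $H=H^1(\mathbb{R}^3,\mathbb{C})$, regarded as a real Hilbert space. $f\mapsto K\star f$ is the Fourier multiplier with symbol $\hat K(\xi)=\frac43\pi\,\frac{2\xi_3^2-\xi_1^2-\xi_2^2}{|\xi|^2}$ (convolution with the dipolar kernel $K(x)=\frac{1-3\cos^2\theta}{|x|^3}$, $\theta$ the angle between $x$ and $(0,0,1)$). The pair $(\lambda_1,\lambda_2)\in\mathbb{R}^2$ with $\lambda_2\ne0$ is in the unstable regime if $\lambda_1-\frac43\pi\lambda_2<0$ when $\lambda_2>0$, and $\lambda_1+\frac83\pi\lambda_2<0$ when $\lambda_2<0$. For $u\in H$: $A(u)=\|\nabla u\|_2^2$, $B(u)=\lambda_1\|u\|_4^4+\lambda_2\int_{\mathbb{R}^3}(K\star|u|^2)|u|^2dx$, $E(u)=\frac12A(u)+\frac12B(u)$, $Q(u)=A(u)+\frac32B(u)$. $S(c)=\{u\in H:\|u\|_2^2=c\}$ and $V(c)=\{u\in S(c): Q(u)=0\}$. $u\in V(c)$ is a critical point of $E|_{V(c)}$ if $E'(u)h=0$ for all $h\in H$ with $\mathrm{Re}\int u\bar h\,dx=0$ and $Q'(u)h=0$; $u\in S(c)$ is a critical point of $E|_{S(c)}$ if $E'(u)h=0$ for all $h\in H$ with $\mathrm{Re}\int u\bar h\,dx=0$. *)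

theory Defs
  imports "HOL-Analysis.Analysis"
begin

section \<open>The Sobolev space $H^1(\mathbb{R}^3,\mathbb{C})$\<close>

text \<open>
  Elements of Lebesgue and Sobolev spaces are represented by Borel functions on the whole space.
  Functions that agree almost everywhere are not identified, but every notion below is
  insensitive to changing a function on a null set.
\<close>

definition L2 :: "(real^3 \<Rightarrow> 'a::euclidean_space) set" where
  "L2 = {f. f \<in> borel_measurable lborel \<and> integrable lborel (\<lambda>x. (norm (f x))\<^sup>2)}"

definition partial :: "3 \<Rightarrow> (real^3 \<Rightarrow> real) \<Rightarrow> real^3 \<Rightarrow> real" where
  "partial j f x = frechet_derivative f (at x) (axis j 1)"

primrec Ck :: "nat \<Rightarrow> (real^3 \<Rightarrow> real) \<Rightarrow> bool" where
  "Ck 0 f \<longleftrightarrow> continuous_on UNIV f"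
| "Ck (Suc k) f \<longleftrightarrow> (\<forall>x. f differentiable (at x)) \<and> (\<forall>j. Ck k (partial j f))"

definition test_functions :: "(real^3 \<Rightarrow> real) set" where
  "test_functions = {\<phi>. (\<forall>k. Ck k \<phi>) \<and> compact (closure {x. \<phi> x \<noteq> 0})}"

definition has_weak_gradient :: "(real^3 \<Rightarrow> complex) \<Rightarrow> (real^3 \<Rightarrow> complex^3) \<Rightarrow> bool" where
  "has_weak_gradient u G \<longleftrightarrow>
     (\<forall>\<phi>\<in>test_functions. \<forall>j.
        (\<integral>x. u x * of_real (partial j \<phi> x) \<partial>lborel) = - (\<integral>x. G x $ j * of_real (\<phi> x) \<partial>lborel))"

definition H1 :: "(real^3 \<Rightarrow> complex) set" where
  "H1 = {u \<in> L2. \<exists>G\<in>L2. has_weak_gradient u G}"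

definition weak_gradient :: "(real^3 \<Rightarrow> complex) \<Rightarrow> real^3 \<Rightarrow> complex^3" where
  "weak_gradient u = (SOME G. G \<in> L2 \<and> has_weak_gradient u G)"

definition mass :: "(real^3 \<Rightarrow> complex) \<Rightarrow> real" where
  "mass u = (\<integral>x. (norm (u x))\<^sup>2 \<partial>lborel)"

definition A_fun :: "(real^3 \<Rightarrow> complex) \<Rightarrow> real" where
  "A_fun u = (\<integral>x. (norm (weak_gradient u x))\<^sup>2 \<partial>lborel)"

definition H1_norm :: "(real^3 \<Rightarrow> complex) \<Rightarrow> real" where
  "H1_norm u = sqrt (mass u + A_fun u)"

text \<open>
  Frechet differentiability on $H^1$ as a real Hilbert space: \<open>L\<close> is real-linear and bounded, and
  the remainder is $o(\|h\|_{H^1})$.  Only the values of \<open>L\<close> on \<open>H1\<close> are relevant; they are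
  determined by \<open>F\<close> and \<open>u\<close>.
\<close>

definition has_H1_derivative ::
  "((real^3 \<Rightarrow> complex) \<Rightarrow> real) \<Rightarrow> ((real^3 \<Rightarrow> complex) \<Rightarrow> real) \<Rightarrow> (real^3 \<Rightarrow> complex) \<Rightarrow> bool" where
  "has_H1_derivative F L u \<longleftrightarrow>
     (\<forall>h\<in>H1. \<forall>k\<in>H1. L (\<lambda>x. h x + k x) = L h + L k) \<and>
     (\<forall>h\<in>H1. \<forall>r::real. L (\<lambda>x. r *\<^sub>R h x) = r * L h) \<and>
     (\<exists>C. \<forall>h\<in>H1. \<bar>L h\<bar> \<le> C * H1_norm h) \<and>
     (\<forall>e>0. \<exists>d>0. \<forall>h\<in>H1. H1_norm h < d \<longrightarrow>
        \<bar>F (\<lambda>x. u x + h x) - F u - L h\<bar> \<le> e * H1_norm h)"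

definition H1_derivative ::
  "((real^3 \<Rightarrow> complex) \<Rightarrow> real) \<Rightarrow> (real^3 \<Rightarrow> complex) \<Rightarrow> (real^3 \<Rightarrow> complex) \<Rightarrow> real" where
  "H1_derivative F u = (SOME L. has_H1_derivative F L u)"


section \<open>The dipolar convolution\<close>

definition fourier :: "(real^3 \<Rightarrow> complex) \<Rightarrow> real^3 \<Rightarrow> complex" where
  "fourier f \<xi> = (\<integral>x. cis (- (x \<bullet> \<xi>)) * f x \<partial>lborel)"

text \<open>
  The Fourier--Plancherel transform of $f \in L^2$ is the $L^2$-limit of the transforms of its
  truncations to balls.  The extended nonnegative integral is used since the Bochner integral of a
  non-integrable function is 0.
\<close>

definition has_L2_fourier :: "(real^3 \<Rightarrow> complex) \<Rightarrow> (real^3 \<Rightarrow> complex) \<Rightarrow> bool" where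
  "has_L2_fourier f F \<longleftrightarrow> f \<in> L2 \<and> F \<in> L2 \<and>
     ((\<lambda>n. \<integral>\<^sup>+\<xi>. ennreal ((norm (fourier (\<lambda>x. indicator (cball 0 (real n)) x * f x) \<xi> - F \<xi>))\<^sup>2) \<partial>lborel)
        \<longlonglongrightarrow> 0)"

definition dipolar_symbol :: "real^3 \<Rightarrow> real" where
  "dipolar_symbol \<xi> = 4 / 3 * pi * ((2 * (\<xi> $ 3)\<^sup>2 - (\<xi> $ 1)\<^sup>2 - (\<xi> $ 2)\<^sup>2) / (norm \<xi>)\<^sup>2)"

text \<open>
  The symbol is homogeneous of degree 0, so the operator does not depend on the normalisation
  of the Fourier transform.
\<close>

definition dipolar_conv :: "(real^3 \<Rightarrow> complex) \<Rightarrow> real^3 \<Rightarrow> complex" where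
  "dipolar_conv f =
     (SOME g. \<exists>F. has_L2_fourier f F \<and> has_L2_fourier g (\<lambda>\<xi>. of_real (dipolar_symbol \<xi>) * F \<xi>))"


section \<open>Functionals, constraints and critical points\<close>

definition unstable_regime :: "real \<Rightarrow> real \<Rightarrow> bool" where
  "unstable_regime l1 l2 \<longleftrightarrow> l2 \<noteq> 0 \<and>
     (l2 > 0 \<longrightarrow> l1 - 4 / 3 * pi * l2 < 0) \<and> (l2 < 0 \<longrightarrow> l1 + 8 / 3 * pi * l2 < 0)"

definition density :: "(real^3 \<Rightarrow> complex) \<Rightarrow> real^3 \<Rightarrow> complex" where
  "density u x = of_real ((norm (u x))\<^sup>2)"

text \<open>
  The dipolar integral is a real number because the symbol is real and even and the density is
  real; \<open>Re\<close> only adjusts the type.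
\<close>

definition B_fun :: "real \<Rightarrow> real \<Rightarrow> (real^3 \<Rightarrow> complex) \<Rightarrow> real" where
  "B_fun l1 l2 u =
     l1 * (\<integral>x. (norm (u x))^4 \<partial>lborel)
     + l2 * Re (\<integral>x. dipolar_conv (density u) x * density u x \<partial>lborel)"

definition E_fun :: "real \<Rightarrow> real \<Rightarrow> (real^3 \<Rightarrow> complex) \<Rightarrow> real" where
  "E_fun l1 l2 u = 1 / 2 * A_fun u + 1 / 2 * B_fun l1 l2 u"

definition Q_fun :: "real \<Rightarrow> real \<Rightarrow> (real^3 \<Rightarrow> complex) \<Rightarrow> real" where
  "Q_fun l1 l2 u = A_fun u + 3 / 2 * B_fun l1 l2 u"

definition S_set :: "real \<Rightarrow> (real^3 \<Rightarrow> complex) set" where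
  "S_set c = {u \<in> H1. mass u = c}"

definition V_set :: "real \<Rightarrow> real \<Rightarrow> real \<Rightarrow> (real^3 \<Rightarrow> complex) set" where
  "V_set l1 l2 c = {u \<in> S_set c. Q_fun l1 l2 u = 0}"

definition L2_orthogonal :: "(real^3 \<Rightarrow> complex) \<Rightarrow> (real^3 \<Rightarrow> complex) \<Rightarrow> bool" where
  "L2_orthogonal u h \<longleftrightarrow> Re (\<integral>x. u x * cnj (h x) \<partial>lborel) = 0"

definition critical_point_on_S :: "real \<Rightarrow> real \<Rightarrow> real \<Rightarrow> (real^3 \<Rightarrow> complex) \<Rightarrow> bool" where
  "critical_point_on_S l1 l2 c u \<longleftrightarrow> u \<in> S_set c \<and>
     (\<forall>h\<in>H1. L2_orthogonal u h \<longrightarrow> H1_derivative (E_fun l1 l2) u h = 0)"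

definition critical_point_on_V :: "real \<Rightarrow> real \<Rightarrow> real \<Rightarrow> (real^3 \<Rightarrow> complex) \<Rightarrow> bool" where
  "critical_point_on_V l1 l2 c u \<longleftrightarrow> u \<in> V_set l1 l2 c \<and>
     (\<forall>h\<in>H1. L2_orthogonal u h \<and> H1_derivative (Q_fun l1 l2) u h = 0
        \<longrightarrow> H1_derivative (E_fun l1 l2) u h = 0)"

end

theory Submission
  imports Defs "HOL-Probability.Probability" "HOL-Computational_Algebra.Polynomial"
begin

text \<open>A critical point of $E$ on $V(c)$ satisfies $E'(u)=\mu Q'(u)$ on the $L^2$-orthogonal complement of $u$.
  Testing with the generator $x\cdot\nabla+\frac32$ of the mass-preserving dilations gives the Pohozaev identity
  $(1-2\mu)A(u)+\frac32(1-3\mu)B(u)=0$, which together with $Q(u)=0$ and $A(u)>0$ forces $\mu=0$.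

  The generator does not map $u$ into $H^1$. It is therefore replaced by the antisymmetrised product of a translation by
  $s$ in direction $x_j$ and the multiplication by $\sin(\varepsilon x_j)/\varepsilon$. By Plancherel, the Dirichlet energy
  and the interaction energy are quadratic forms with the weights $m(\xi)=|\xi|^2$ and
  $m(\xi)=\lambda_1+\lambda_2\hat K(\xi)$, and in the limit $s\to0$, $\varepsilon\to0$ the test function produces the weight
  $\xi_j\partial_jm(\xi)$. Summed over $j$ this is $2|\xi|^2$ and $0$. The nonlinear remainder is controlled by the Sobolev
  embedding into $L^6$.\<close>

text \<open>The obstacle is that u lies only in \<open>H1\<close>: neither decay nor a second
  derivative is at hand for integrating by parts against x . grad u. The discrete operator has the
  form T minus its adjoint. Pairing u with its image under a form of weight W therefore leaves only
  W(xi) - W(xi - e e_j), so the difference quotient falls on the weight and never on u; for W = 1 it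
  vanishes, which makes the image an admissible direction. In the quartic term, after pairing with
  |u|^2, Re(conj u times the image of u) is half the image of |u|^2 plus half the divergence of the
  field times |u|^2, up to an error. The divergence of x_j e_j is 1, so each direction contributes
  B/2, whence the coefficient 3/2. The limit in s precedes the one in e because multiplication by
  sin(e x_j)/e has a norm of order 1/e. Weak gradients, the dipolar convolution and derivatives are
  defined by \<open>SOME\<close>, so their values must be shown independent of the choice; for the
  first two this rests on Plancherel theory for the truncations in
  \<open>has_L2_fourier\<close>.\<close>

section \<open>Integrals of products, translates and dilates\<close>

text \<open>Used for the Gaussian: it and the character factor over the basis, so that its transform
  reduces to dimension one.\<close>

lemma lborel_integral_prod:
  fixes f :: "'a::euclidean_space \<Rightarrow> real \<Rightarrow> complex"
  assumes int: "\<And>b. b \<in> Basis \<Longrightarrow> integrable lborel (f b)"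
  shows "integrable lborel (\<lambda>x::'a. \<Prod>b\<in>Basis. f b (x \<bullet> b))"
    and "(\<integral>x. (\<Prod>b\<in>Basis. f b (x \<bullet> b)) \<partial>lborel) = (\<Prod>b\<in>Basis. \<integral>t. f b t \<partial>lborel)"
proof -
  interpret product_sigma_finite "\<lambda>_::'a. lborel :: real measure" by standard
  have [measurable]: "\<And>b. b \<in> Basis \<Longrightarrow> f b \<in> borel_measurable borel"
    using int by (simp add: integrable_iff_bounded)
  have eq: "(\<Prod>b\<in>Basis. f b ((\<Sum>c\<in>Basis. y c *\<^sub>R c) \<bullet> b)) = (\<Prod>b\<in>Basis. f b (y b))" for y :: "'a \<Rightarrow> real"
    by (intro prod.cong refl) simp
  have i: "integrable (Pi\<^sub>M Basis (\<lambda>_. lborel)) (\<lambda>y. \<Prod>b\<in>Basis. f b (y b))"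
    by (intro product_integrable_prod int) auto
  show "integrable lborel (\<lambda>x::'a. \<Prod>b\<in>Basis. f b (x \<bullet> b))"
    by (subst lborel_eq, subst integrable_distr_eq) (auto simp: eq i)
  show "(\<integral>x. (\<Prod>b\<in>Basis. f b (x \<bullet> b)) \<partial>lborel) = (\<Prod>b\<in>Basis. \<integral>t. f b t \<partial>lborel)"
    by (subst lborel_eq, subst integral_distr) (auto simp: eq product_integral_prod int)
qed

lemma integral_translate:
  fixes f :: "'a::euclidean_space \<Rightarrow> 'b::{banach, second_countable_topology}"
  assumes [measurable]: "f \<in> borel_measurable borel"
  shows "(\<integral>x. f (x + a) \<partial>lborel) = (\<integral>x. f x \<partial>lborel)"
    and "integrable lborel (\<lambda>x. f (x + a)) \<longleftrightarrow> integrable lborel f"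
proof -
  have "(\<integral>x. f x \<partial>distr lborel borel ((+) a)) = (\<integral>x. f (x + a) \<partial>lborel)"
    by (subst integral_distr) (auto simp: add.commute)
  then show "(\<integral>x. f (x + a) \<partial>lborel) = (\<integral>x. f x \<partial>lborel)"
    by (simp add: lborel_distr_plus)
  have "integrable (distr lborel borel ((+) a)) f = integrable lborel (\<lambda>x. f (x + a))"
    by (subst integrable_distr_eq) (auto simp: add.commute)
  then show "integrable lborel (\<lambda>x. f (x + a)) \<longleftrightarrow> integrable lborel f"
    by (simp add: lborel_distr_plus)
qed

lemma integral_scale:
  fixes f :: "'a::euclidean_space \<Rightarrow> 'b::{banach, second_countable_topology}"
  assumes [measurable]: "f \<in> borel_measurable borel" and c: "c \<noteq> 0"
  shows "(\<integral>x. f x \<partial>lborel) = \<bar>c\<bar> ^ DIM('a) *\<^sub>R (\<integral>x. f (c *\<^sub>R x) \<partial>lborel)"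
    and "integrable lborel (\<lambda>x. f (c *\<^sub>R x)) \<longleftrightarrow> integrable lborel f"
proof -
  have "(\<integral>x. f x \<partial>lborel) = (\<integral>x. f x \<partial>Nonnegative_Lebesgue_Integration.density (distr lborel borel (\<lambda>x. 0 + c *\<^sub>R x)) (\<lambda>_. \<bar>c\<bar>^DIM('a)))"
    using lborel_affine[OF c, of "0::'a"] by simp
  also have "\<dots> = \<bar>c\<bar> ^ DIM('a) *\<^sub>R (\<integral>x. f (c *\<^sub>R x) \<partial>lborel)"
    by (simp add: integral_density integral_distr)
  finally show "(\<integral>x. f x \<partial>lborel) = \<bar>c\<bar> ^ DIM('a) *\<^sub>R (\<integral>x. f (c *\<^sub>R x) \<partial>lborel)" .
  have "integrable lborel f = integrable (Nonnegative_Lebesgue_Integration.density (distr lborel borel (\<lambda>x. 0 + c *\<^sub>R x)) (\<lambda>_. \<bar>c\<bar>^DIM('a))) f"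
    using lborel_affine[OF c, of "0::'a"] by simp
  also have "\<dots> = integrable lborel (\<lambda>x. f (c *\<^sub>R x))"
  proof -
    have "integrable lborel (\<lambda>x. f (c *\<^sub>R x))"
      if "integrable lborel (\<lambda>x. \<bar>c\<bar> ^ DIM('a) *\<^sub>R f (c *\<^sub>R x))"
      using integrable_scaleR_right[OF that, of "inverse (\<bar>c\<bar> ^ DIM('a))"] c by simp
    then show ?thesis
      using c by (auto simp: integrable_density integrable_distr_eq)
  qed
  finally show "integrable lborel (\<lambda>x. f (c *\<^sub>R x)) \<longleftrightarrow> integrable lborel f" by simp
qed

lemma integral_reflect:
  fixes f :: "'a::euclidean_space \<Rightarrow> 'b::{banach, second_countable_topology}"
  assumes "f \<in> borel_measurable borel"
  shows "(\<integral>x. f (- x) \<partial>lborel) = (\<integral>x. f x \<partial>lborel)"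
    and "integrable lborel (\<lambda>x. f (- x)) \<longleftrightarrow> integrable lborel f"
  using integral_scale[OF assms, of "-1"] by simp_all

subsection \<open>Square-integrable functions\<close>

lemma L2_measurable: "f \<in> L2 \<Longrightarrow> f \<in> borel_measurable borel"
  by (simp add: L2_def)

lemma L2_iff:
  "f \<in> L2 \<longleftrightarrow> f \<in> borel_measurable borel \<and> integrable lborel (\<lambda>x. (norm (f x))\<^sup>2)"
  by (simp add: L2_def)

lemma L2_bound:
  assumes "integrable lborel g" "f \<in> borel_measurable borel" "AE x in lborel. (norm (f x))\<^sup>2 \<le> g x"
  shows "f \<in> L2"
  unfolding L2_iff using assms
  by (auto intro!: Bochner_Integration.integrable_bound[OF assms(1)] elim!: eventually_mono)

lemma norm_add_sq_le: "(norm (a + b))\<^sup>2 \<le> 2 * (norm a)\<^sup>2 + 2 * (norm (b::'a::real_normed_vector))\<^sup>2"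
proof -
  have "(norm (a + b))\<^sup>2 \<le> (norm a + norm b)\<^sup>2"
    by (intro power_mono norm_triangle_ineq) auto
  also have "\<dots> \<le> 2 * (norm a)\<^sup>2 + 2 * (norm b)\<^sup>2"
    using sum_squares_bound[of "norm a" "norm b"] by (simp add: power2_sum)
  finally show ?thesis .
qed

lemma integral_CS:
  fixes f g :: "'a \<Rightarrow> real"
  assumes [measurable]: "f \<in> borel_measurable M" "g \<in> borel_measurable M"
    and f: "integrable M (\<lambda>x. (f x)\<^sup>2)" and g: "integrable M (\<lambda>x. (g x)\<^sup>2)"
  shows "integrable M (\<lambda>x. f x * g x)"
    and "(\<integral>x. \<bar>f x * g x\<bar> \<partial>M) \<le> sqrt (\<integral>x. (f x)\<^sup>2 \<partial>M) * sqrt (\<integral>x. (g x)\<^sup>2 \<partial>M)"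
proof -
  \<comment> \<open>This crude bound only serves integrability; the sharp inequality is then
    transferred from the extended integral.\<close>
  have "\<bar>f x * g x\<bar> \<le> (f x)\<^sup>2 + (g x)\<^sup>2" for x
    using sum_squares_bound[of "\<bar>f x\<bar>" "\<bar>g x\<bar>"] mult_nonneg_nonneg[of "\<bar>f x\<bar>" "\<bar>g x\<bar>"]
    unfolding abs_mult power2_abs by linarith
  then show int: "integrable M (\<lambda>x. f x * g x)"
    by (intro Bochner_Integration.integrable_bound[OF Bochner_Integration.integrable_add[OF f g]]) auto
  let ?I = "\<integral>x. \<bar>f x * g x\<bar> \<partial>M" and ?F = "\<integral>x. (f x)\<^sup>2 \<partial>M" and ?G = "\<integral>x. (g x)\<^sup>2 \<partial>M"
  have "(\<integral>\<^sup>+x. ennreal \<bar>f x\<bar> * ennreal \<bar>g x\<bar> \<partial>M) = ennreal ?I"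
    using integrable_abs[OF int] by (subst nn_integral_eq_integral[symmetric]) (auto simp: abs_mult ennreal_mult)
  moreover have "(\<integral>\<^sup>+x. (ennreal \<bar>f x\<bar>)^2 \<partial>M) = ennreal ?F"
    using f by (subst nn_integral_eq_integral[symmetric]) (auto simp: ennreal_power)
  moreover have "(\<integral>\<^sup>+x. (ennreal \<bar>g x\<bar>)^2 \<partial>M) = ennreal ?G"
    using g by (subst nn_integral_eq_integral[symmetric]) (auto simp: ennreal_power)
  ultimately have "(ennreal ?I)\<^sup>2 \<le> ennreal ?F * ennreal ?G"
    using Cauchy_Schwarz_nn_integral[of "\<lambda>x. ennreal \<bar>f x\<bar>" M "\<lambda>x. ennreal \<bar>g x\<bar>"] by simp
  then have "?I\<^sup>2 \<le> ?F * ?G"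
    by (simp add: ennreal_power ennreal_mult[symmetric])
  then have "sqrt (?I\<^sup>2) \<le> sqrt (?F * ?G)" by (intro real_sqrt_le_mono)
  then show "?I \<le> sqrt ?F * sqrt ?G" by (simp add: real_sqrt_mult)
qed

definition L2_inner :: "(real^3 \<Rightarrow> complex) \<Rightarrow> (real^3 \<Rightarrow> complex) \<Rightarrow> complex" where
  "L2_inner f g = (\<integral>x. f x * cnj (g x) \<partial>lborel)"

definition L2_norm :: "(real^3 \<Rightarrow> complex) \<Rightarrow> real" where
  "L2_norm f = sqrt (mass f)"

lemma mass_nonneg [simp]: "0 \<le> mass f"
  by (simp add: mass_def)

lemma L2_norm_nonneg [simp]: "0 \<le> L2_norm f"
  by (simp add: L2_norm_def)

lemma L2_norm_sq: "(L2_norm f)\<^sup>2 = mass f"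
  by (simp add: L2_norm_def)

lemma cnj_borel [measurable (raw)]:
  "f \<in> borel_measurable M \<Longrightarrow> (\<lambda>x. cnj (f x)) \<in> borel_measurable M"
  by (rule borel_measurable_continuous_onI[THEN measurable_compose_rev, of cnj])
     (auto intro: continuous_intros)

lemma cis_borel [measurable (raw)]:
  "f \<in> borel_measurable M \<Longrightarrow> (\<lambda>x. cis (f x)) \<in> borel_measurable M"
  by (rule borel_measurable_continuous_onI[THEN measurable_compose_rev, of cis])
     (auto intro: continuous_intros)

lemma L2_bounded_mult:
  fixes f :: "real^3 \<Rightarrow> complex"
  assumes [measurable]: "g \<in> borel_measurable borel" and b: "\<And>x. norm (g x) \<le> C" and f: "f \<in> L2"
  shows "(\<lambda>x. g x * f x) \<in> L2" and "mass (\<lambda>x. g x * f x) \<le> C\<^sup>2 * mass f"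
proof -
  note [measurable] = L2_measurable[OF f]
  have le: "(norm (g x * f x))\<^sup>2 \<le> C\<^sup>2 * (norm (f x))\<^sup>2" for x
    unfolding norm_mult power_mult_distrib by (intro mult_right_mono power_mono b) auto
  have int: "integrable lborel (\<lambda>x. C\<^sup>2 * (norm (f x))\<^sup>2)" using f by (simp add: L2_def)
  show L: "(\<lambda>x. g x * f x) \<in> L2"
    by (rule L2_bound[OF int]) (use le in auto)
  have "mass (\<lambda>x. g x * f x) \<le> (\<integral>x. C\<^sup>2 * (norm (f x))\<^sup>2 \<partial>lborel)"
    unfolding mass_def using L int le by (intro integral_mono) (auto simp: L2_def)
  then show "mass (\<lambda>x. g x * f x) \<le> C\<^sup>2 * mass f" by (simp add: mass_def)
qed

lemma L2_cmult: "f \<in> L2 \<Longrightarrow> (\<lambda>x. (c::complex) * f x) \<in> L2"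
  using L2_bounded_mult(1)[of "\<lambda>_. c" "norm c"] by auto

lemma mass_cmult: "mass (\<lambda>x. c * f x) = (norm c)\<^sup>2 * mass f"
  by (simp add: mass_def norm_mult power_mult_distrib)

lemma L2_norm_cmult: "L2_norm (\<lambda>x. c * f x) = norm c * L2_norm f"
  by (simp add: L2_norm_def mass_cmult real_sqrt_mult)

lemma L2_add:
  fixes f g :: "real^3 \<Rightarrow> complex"
  assumes f: "f \<in> L2" and g: "g \<in> L2" shows "(\<lambda>x. f x + g x) \<in> L2"
proof -
  note [measurable] = L2_measurable[OF f] L2_measurable[OF g]
  have int: "integrable lborel (\<lambda>x. 2 * (norm (f x))\<^sup>2 + 2 * (norm (g x))\<^sup>2)"
    using f g by (auto simp: L2_def)
  show ?thesis
    by (rule L2_bound[OF int]) (use norm_add_sq_le in auto)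
qed

lemma L2_uminus: "f \<in> L2 \<Longrightarrow> (\<lambda>x. - f x :: complex) \<in> L2"
  using L2_cmult[of f "-1"] by simp

lemma L2_diff: "f \<in> L2 \<Longrightarrow> g \<in> L2 \<Longrightarrow> (\<lambda>x. f x - g x :: complex) \<in> L2"
  using L2_add[of f "\<lambda>x. - g x"] L2_uminus[of g] by simp

lemma L2_cnj: "f \<in> L2 \<Longrightarrow> (\<lambda>x. cnj (f x)) \<in> L2"
  by (auto simp: L2_def)

lemma mass_cnj [simp]: "mass (\<lambda>x. cnj (f x)) = mass f"
  by (simp add: mass_def)

lemma L2_translate: 
  assumes f: "f \<in> L2" shows "(\<lambda>x. f (x + a) :: complex) \<in> L2"
  using f integral_translate(2)[of "\<lambda>x. (norm (f x))\<^sup>2" a] by (auto simp: L2_def)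

lemma mass_translate: 
  "f \<in> L2 \<Longrightarrow> mass (\<lambda>x. f (x + a)) = mass f"
  using integral_translate(1)[of "\<lambda>x. (norm (f x))\<^sup>2" a] by (auto simp: L2_def mass_def)

lemma L2_reflect: 
  assumes f: "f \<in> L2" shows "(\<lambda>x. f (- x) :: complex) \<in> L2"
  using f integral_reflect(2)[of "\<lambda>x. (norm (f x))\<^sup>2"] by (auto simp: L2_def)

lemma mass_reflect: 
  "f \<in> L2 \<Longrightarrow> mass (\<lambda>x. f (- x)) = mass f"
  using integral_reflect(1)[of "\<lambda>x. (norm (f x))\<^sup>2"] by (auto simp: L2_def mass_def)

lemma L2_AE_cong:
  fixes f g :: "real^3 \<Rightarrow> complex"
  assumes "f \<in> L2" "g \<in> borel_measurable borel" "AE x in lborel. f x = g x"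
  shows "g \<in> L2"
  using assms by (auto simp: L2_def intro: integrable_cong_AE_imp elim!: eventually_mono)

lemma mass_AE_cong:
  "f \<in> borel_measurable borel \<Longrightarrow> g \<in> borel_measurable borel \<Longrightarrow> AE x in lborel. f x = g x \<Longrightarrow> mass f = mass g"
  unfolding mass_def by (intro integral_cong_AE) (auto elim!: eventually_mono)

lemma L2_prod_integrable:
  fixes f g :: "real^3 \<Rightarrow> complex"
  assumes f: "f \<in> L2" and g: "g \<in> L2"
  shows "integrable lborel (\<lambda>x. f x * g x)" "integrable lborel (\<lambda>x. f x * cnj (g x))"
    and "integrable lborel (\<lambda>x. norm (f x) * norm (g x))"
    and "(\<integral>x. norm (f x) * norm (g x) \<partial>lborel) \<le> L2_norm f * L2_norm g"
proof -
  note [measurable] = L2_measurable[OF f] L2_measurable[OF g]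
  have f': "integrable lborel (\<lambda>x. (norm (f x))\<^sup>2)" and g': "integrable lborel (\<lambda>x. (norm (g x))\<^sup>2)"
    using f g by (auto simp: L2_def)
  show i: "integrable lborel (\<lambda>x. norm (f x) * norm (g x))"
    by (rule integral_CS(1)) (use f' g' in auto)
  show "integrable lborel (\<lambda>x. f x * g x)" "integrable lborel (\<lambda>x. f x * cnj (g x))"
    by (rule Bochner_Integration.integrable_bound[OF i]; simp add: norm_mult)+
  show "(\<integral>x. norm (f x) * norm (g x) \<partial>lborel) \<le> L2_norm f * L2_norm g"
    using integral_CS(2)[OF _ _ f' g'] by (simp add: L2_norm_def mass_def abs_mult)
qed

lemma L2_inner_CS: "f \<in> L2 \<Longrightarrow> g \<in> L2 \<Longrightarrow> norm (L2_inner f g) \<le> L2_norm f * L2_norm g"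
  unfolding L2_inner_def
  by (rule order_trans[OF integral_norm_bound]) (use L2_prod_integrable(4)[of f g] in \<open>simp add: norm_mult\<close>)

lemma L2_inner_add_left: "f \<in> L2 \<Longrightarrow> g \<in> L2 \<Longrightarrow> h \<in> L2 \<Longrightarrow> L2_inner (\<lambda>x. f x + g x) h = L2_inner f h + L2_inner g h"
  unfolding L2_inner_def by (simp add: distrib_right L2_prod_integrable)

lemma L2_inner_diff_left: "f \<in> L2 \<Longrightarrow> g \<in> L2 \<Longrightarrow> h \<in> L2 \<Longrightarrow> L2_inner (\<lambda>x. f x - g x) h = L2_inner f h - L2_inner g h"
  unfolding L2_inner_def by (simp add: left_diff_distrib L2_prod_integrable)

lemma L2_inner_cmult_left: "L2_inner (\<lambda>x. c * f x) h = c * L2_inner f h"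
  unfolding L2_inner_def by (simp add: mult.assoc)

lemma L2_inner_commute: "L2_inner f g = cnj (L2_inner g f)"
  unfolding L2_inner_def by (simp add: Bochner_Integration.integral_cnj[symmetric] mult.commute del: Bochner_Integration.integral_cnj)

lemma L2_inner_add_right: "f \<in> L2 \<Longrightarrow> g \<in> L2 \<Longrightarrow> h \<in> L2 \<Longrightarrow> L2_inner h (\<lambda>x. f x + g x) = L2_inner h f + L2_inner h g"
  unfolding L2_inner_def by (simp add: distrib_left L2_prod_integrable)

lemma L2_inner_diff_right: "f \<in> L2 \<Longrightarrow> g \<in> L2 \<Longrightarrow> h \<in> L2 \<Longrightarrow> L2_inner h (\<lambda>x. f x - g x) = L2_inner h f - L2_inner h g"
  unfolding L2_inner_def by (simp add: right_diff_distrib L2_prod_integrable)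

lemma L2_inner_cmult_right: "L2_inner f (\<lambda>x. c * g x) = cnj c * L2_inner f g"
  unfolding L2_inner_def by (simp add: mult.left_commute)

lemma L2_inner_self: "L2_inner f f = of_real (mass f)"
  unfolding L2_inner_def mass_def by (simp add: complex_norm_square[symmetric] flip: integral_complex_of_real)

lemma mass_add: 
  assumes "f \<in> L2" "g \<in> L2" 
  shows "mass (\<lambda>x. f x + g x) = mass f + mass g + 2 * Re (L2_inner f g)"
proof -
  have "L2_inner (\<lambda>x. f x + g x) (\<lambda>x. f x + g x) = of_real (mass f) + of_real (mass g) + (L2_inner f g + L2_inner g f)"
    using assms by (simp add: L2_inner_add_left L2_inner_add_right L2_add flip: L2_inner_self)
  also have "L2_inner f g + L2_inner g f = of_real (2 * Re (L2_inner f g))"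
    by (subst (2) L2_inner_commute) (simp add: complex_add_cnj)
  finally show ?thesis
    unfolding L2_inner_self of_real_add[symmetric] of_real_eq_iff .
qed

lemma L2_norm_triangle: 
  assumes "f \<in> L2" "g \<in> L2" 
  shows "L2_norm (\<lambda>x. f x + g x) \<le> L2_norm f + L2_norm g"
proof -
  have "mass (\<lambda>x. f x + g x) \<le> (L2_norm f + L2_norm g)\<^sup>2"
    using mass_add[OF assms] complex_Re_le_cmod[of "L2_inner f g"] L2_inner_CS[OF assms]
    by (simp add: power2_sum L2_norm_sq)
  then show ?thesis unfolding L2_norm_def[of "\<lambda>x. f x + g x"]
    by (intro real_le_lsqrt) auto
qed

lemma L2_norm_diff_commute: "L2_norm (\<lambda>x. f x - g x) = L2_norm (\<lambda>x. g x - f x)"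
  by (simp add: L2_norm_def mass_def norm_minus_commute)

lemma L2_norm_diff_triangle: 
  assumes "f \<in> L2" "g \<in> L2" "h \<in> L2"
  shows "L2_norm (\<lambda>x. f x - h x) \<le> L2_norm (\<lambda>x. f x - g x) + L2_norm (\<lambda>x. g x - h x)"
  using L2_norm_triangle[OF L2_diff[OF assms(1,2)] L2_diff[OF assms(2,3)]] by simp

lemma L2_norm_reverse_triangle: 
  assumes "f \<in> L2" "g \<in> L2"
  shows "\<bar>L2_norm f - L2_norm g\<bar> \<le> L2_norm (\<lambda>x. f x - g x)"
  using L2_norm_triangle[OF L2_diff[OF assms] assms(2)] L2_norm_triangle[OF L2_diff[OF assms(2,1)] assms(1)] 
    L2_norm_diff_commute[of f g] by simp

lemma L2_norm_tendsto:
  assumes "\<And>n. f n \<in> L2" "g \<in> L2" "((\<lambda>n. L2_norm (\<lambda>x. f n x - g x)) \<longlongrightarrow> 0) F"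
  shows "((\<lambda>n. L2_norm (f n)) \<longlongrightarrow> L2_norm g) F" "((\<lambda>n. mass (f n)) \<longlongrightarrow> mass g) F"
proof -
  show *: "((\<lambda>n. L2_norm (f n)) \<longlongrightarrow> L2_norm g) F"
    using L2_norm_reverse_triangle[OF assms(1,2)]
    by (intro Lim_transform_bound[OF _ assms(3), THEN LIM_zero_cancel]) auto
  show "((\<lambda>n. mass (f n)) \<longlongrightarrow> mass g) F"
    using tendsto_power[OF *, of 2] by (simp add: L2_norm_sq)
qed

lemma L2_inner_tendsto:
  assumes f: "\<And>n. f n \<in> L2" "f' \<in> L2" "((\<lambda>n. L2_norm (\<lambda>x. f n x - f' x)) \<longlongrightarrow> 0) F"
    and g: "\<And>n. g n \<in> L2" "g' \<in> L2" "((\<lambda>n. L2_norm (\<lambda>x. g n x - g' x)) \<longlongrightarrow> 0) F"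
  shows "((\<lambda>n. L2_inner (f n) (g n)) \<longlongrightarrow> L2_inner f' g') F"
proof -
  have b: "norm (L2_inner (f n) (g n) - L2_inner f' g') \<le> L2_norm (\<lambda>x. f n x - f' x) * L2_norm (g n) + L2_norm f' * L2_norm (\<lambda>x. g n x - g' x)" for n
  proof -
    have "L2_inner (f n) (g n) - L2_inner f' g' = L2_inner (\<lambda>x. f n x - f' x) (g n) + L2_inner f' (\<lambda>x. g n x - g' x)"
      using f g by (simp add: L2_inner_diff_left L2_inner_diff_right)
    then show ?thesis
      using norm_triangle_mono[OF L2_inner_CS[OF L2_diff[OF f(1) f(2)] g(1)] L2_inner_CS[OF f(2) L2_diff[OF g(1) g(2)]]] by metis
  qed
  have "((\<lambda>n. L2_norm (\<lambda>x. f n x - f' x) * L2_norm (g n) + L2_norm f' * L2_norm (\<lambda>x. g n x - g' x)) \<longlongrightarrow> 0 * L2_norm g' + L2_norm f' * 0) F"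
    by (intro tendsto_intros f g L2_norm_tendsto(1)[OF g])
  then have "((\<lambda>n. L2_inner (f n) (g n) - L2_inner f' g') \<longlongrightarrow> 0) F"
    by (intro Lim_null_comparison[OF always_eventually[OF allI[OF b]]]) simp
  then show ?thesis by (rule LIM_zero_cancel)
qed

lemma mass_eq_0_iff: 
  assumes "f \<in> L2" shows "mass f = 0 \<longleftrightarrow> (AE x in lborel. f x = 0)"
  using assms unfolding mass_def L2_def by (subst integral_nonneg_eq_0_iff_AE) auto

subsection \<open>Completeness and continuity of translations\<close>

text \<open>The shape of a density argument: the null sequence \<open>b\<close> may depend on
  \<open>e\<close>, so it can come from an approximating set or function.\<close>

lemma tendsto_0_approx:
  fixes a :: "nat \<Rightarrow> real"
  assumes "\<And>n. 0 \<le> a n" and "\<And>e. e > 0 \<Longrightarrow> \<exists>b. b \<longlonglongrightarrow> 0 \<and> (\<forall>n. a n \<le> b n + e)"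
  shows "a \<longlonglongrightarrow> 0"
proof (rule LIMSEQ_I)
  fix r :: real assume "r > 0"
  then obtain b where b: "b \<longlonglongrightarrow> 0" "\<And>n. a n \<le> b n + r / 2"
    using assms(2)[of "r / 2"] by auto
  from LIMSEQ_D[OF b(1), of "r / 2"] \<open>r > 0\<close> obtain N where "\<And>n. n \<ge> N \<Longrightarrow> norm (b n - 0) < r / 2"
    by auto
  then have "\<And>n. n \<ge> N \<Longrightarrow> norm (a n - 0) < r"
    using b(2) assms(1) by (smt (verit) field_sum_of_halves real_norm_def)
  then show "\<exists>N. \<forall>n\<ge>N. norm (a n - 0) < r" by auto
qed

text \<open>Membership and bound come together. The bound is assumed only eventually because it is
  usually read off from a limit or along a subsequence.\<close>

lemma L2_Fatou:
  fixes f :: "nat \<Rightarrow> real^3 \<Rightarrow> complex"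
  assumes f: "\<And>i. f i \<in> L2" and le: "\<forall>\<^sub>F i in sequentially. mass (f i) \<le> C"
    and F[measurable]: "F \<in> borel_measurable borel"
    and lim: "AE x in lborel. (\<lambda>i. f i x) \<longlonglongrightarrow> F x"
  shows "F \<in> L2" "mass F \<le> C"
proof -
  have C: "0 \<le> C"
    using eventually_happens'[OF _ le] mass_nonneg order_trans by (metis sequentially_bot)
  note [measurable] = f[THEN L2_measurable]
  have eq: "(\<integral>\<^sup>+x. ennreal ((norm (f i x))\<^sup>2) \<partial>lborel) = ennreal (mass (f i))" for i
    unfolding mass_def by (rule nn_integral_eq_integral) (use f in \<open>auto simp: L2_def\<close>)
  have "(\<integral>\<^sup>+x. ennreal ((norm (F x))\<^sup>2) \<partial>lborel) = (\<integral>\<^sup>+x. liminf (\<lambda>i. ennreal ((norm (f i x))\<^sup>2)) \<partial>lborel)"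
  proof (rule nn_integral_cong_AE)
    show "AE x in lborel. ennreal ((norm (F x))\<^sup>2) = liminf (\<lambda>i. ennreal ((norm (f i x))\<^sup>2))"
      using lim
    proof eventually_elim
      case (elim x)
      have "(\<lambda>i. ennreal ((norm (f i x))\<^sup>2)) \<longlonglongrightarrow> ennreal ((norm (F x))\<^sup>2)"
        by (intro tendsto_ennrealI tendsto_power tendsto_norm elim)
      from lim_imp_Liminf[OF _ this] show ?case by simp
    qed
  qed
  also have "\<dots> \<le> liminf (\<lambda>i. \<integral>\<^sup>+x. ennreal ((norm (f i x))\<^sup>2) \<partial>lborel)"
    by (rule nn_integral_liminf) measurable
  also have "\<dots> \<le> ennreal C"
    unfolding eq
    by (rule order_trans[OF Liminf_le_Limsup Limsup_bounded]) (use le in \<open>auto elim!: eventually_mono intro: ennreal_leI\<close>)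
  finally have nn: "(\<integral>\<^sup>+x. ennreal ((norm (F x))\<^sup>2) \<partial>lborel) \<le> ennreal C" .
  have "integrable lborel (\<lambda>x. (norm (F x))\<^sup>2)"
    using nn by (intro integrableI_bounded) (auto simp: top_unique less_top[symmetric] intro: le_less_trans)
  then show "F \<in> L2" by (simp add: L2_def)
  from nn_integral_eq_integral[OF \<open>integrable lborel (\<lambda>x. (norm (F x))\<^sup>2)\<close>] nn
  show "mass F \<le> C" using C by (simp add: mass_def)
qed

text \<open>The map $a\mapsto|a|a$ reduces completeness of $L^2$ and continuity of translations in $L^2$
  to the corresponding facts for $L^1$.\<close>

lemma mazur_lower:
  fixes a b :: "'a::real_inner"
  shows "(norm (a - b))\<^sup>2 \<le> 2 * norm (norm a *\<^sub>R a - norm b *\<^sub>R b)"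
proof (cases "a = b")
  case False
  let ?m = "norm a *\<^sub>R a - norm b *\<^sub>R b" and ?d = "norm (a - b)"
  have d2: "?d\<^sup>2 = (norm a)\<^sup>2 + (norm b)\<^sup>2 - 2 * (a \<bullet> b)"
    by (simp add: power2_norm_eq_inner inner_simps inner_commute)
  have "?m \<bullet> (a - b) = norm a * (norm a)\<^sup>2 + norm b * (norm b)\<^sup>2 - (norm a + norm b) * (a \<bullet> b)"
    by (simp add: power2_norm_eq_inner inner_simps inner_commute algebra_simps)
  \<comment> \<open>Quantitative monotonicity of the map a -> |a| a, the gradient of |a|^3 / 3. The
    second summand is nonnegative, and |a| + |b| is at least |a - b|.\<close>
  also have "\<dots> = (norm a + norm b) * ?d\<^sup>2 / 2 + (norm a - norm b)\<^sup>2 * (norm a + norm b) / 2"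
    unfolding d2 by (simp add: field_simps power2_eq_square)
  also have "\<dots> \<ge> ?d * ?d\<^sup>2 / 2"
    using mult_right_mono[OF norm_triangle_ineq4[of a b] zero_le_power2[of ?d]]
      mult_nonneg_nonneg[OF zero_le_power2[of "norm a - norm b"] add_nonneg_nonneg[OF norm_ge_zero[of a] norm_ge_zero[of b]]]
    by linarith
  finally have "?d * ?d\<^sup>2 / 2 \<le> norm ?m * ?d"
    using norm_cauchy_schwarz[of ?m "a - b"] by linarith
  then have "?d * (?d\<^sup>2) \<le> ?d * (2 * norm ?m)" by (simp add: mult.commute)
  then show ?thesis using False by simp
qed simp

lemma mazur_upper:
  fixes a b :: "'a::real_normed_vector"
  shows "norm (norm a *\<^sub>R a - norm b *\<^sub>R b) \<le> norm (a - b) * (norm a + norm b)"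
proof -
  have "norm a *\<^sub>R a - norm b *\<^sub>R b = norm a *\<^sub>R (a - b) + (norm a - norm b) *\<^sub>R b"
    by (simp add: algebra_simps)
  then have "norm (norm a *\<^sub>R a - norm b *\<^sub>R b) \<le> norm a * norm (a - b) + \<bar>norm a - norm b\<bar> * norm b"
    using norm_triangle_ineq[of "norm a *\<^sub>R (a - b)" "(norm a - norm b) *\<^sub>R b"] by simp
  also have "\<dots> \<le> norm a * norm (a - b) + norm (a - b) * norm b"
    using norm_triangle_ineq3[of a b] by (intro add_left_mono mult_right_mono) auto
  finally show ?thesis by (simp add: algebra_simps)
qed

lemma L2_mazur_integrable:
  fixes f :: "real^3 \<Rightarrow> complex"
  shows "f \<in> L2 \<Longrightarrow> integrable lborel (\<lambda>x. norm (f x) *\<^sub>R f x)"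
  by (rule Bochner_Integration.integrable_bound[of _ "\<lambda>x. (norm (f x))\<^sup>2"])
     (auto simp: L2_def power2_eq_square)

lemma L2_complete:
  fixes f :: "nat \<Rightarrow> real^3 \<Rightarrow> complex"
  assumes f: "\<And>n. f n \<in> L2"
    and cauchy: "\<And>e. e > 0 \<Longrightarrow> \<exists>N. \<forall>m\<ge>N. \<forall>n\<ge>N. L2_norm (\<lambda>x. f m x - f n x) < e"
  obtains F where "F \<in> L2" "(\<lambda>n. L2_norm (\<lambda>x. f n x - F x)) \<longlonglongrightarrow> 0"
proof -
  note [measurable] = f[THEN L2_measurable]
  obtain N0 where N0: "\<And>n. n \<ge> N0 \<Longrightarrow> L2_norm (\<lambda>x. f n x - f N0 x) < 1"
    using cauchy[of 1] by auto
  define B where "B = L2_norm (f N0) + 1"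
  have B: "L2_norm (f n) \<le> B" if "n \<ge> N0" for n
    using N0[OF that] L2_norm_triangle[OF L2_diff[OF f f] f, of n N0 N0] by (simp add: B_def)
  have "B > 0" using L2_norm_nonneg[of "f N0"] unfolding B_def by linarith
  let ?g = "\<lambda>n x. norm (f n x) *\<^sub>R f n x"
  \<comment> \<open>\<open>mazur_upper\<close> and Cauchy-Schwarz: an L^2-Cauchy sequence with
    bounded norms is mapped to an L^1-Cauchy sequence.\<close>
  have g_le: "(\<integral>x. norm (?g m x - ?g n x) \<partial>lborel) \<le> L2_norm (\<lambda>x. f m x - f n x) * (L2_norm (f m) + L2_norm (f n))" for m n
  proof -
    have "(\<integral>x. norm (?g m x - ?g n x) \<partial>lborel)
        \<le> (\<integral>x. norm (f m x - f n x) * norm (f m x) + norm (f m x - f n x) * norm (f n x) \<partial>lborel)"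
      using mazur_upper
      by (intro integral_mono Bochner_Integration.integrable_norm Bochner_Integration.integrable_diff
          L2_mazur_integrable Bochner_Integration.integrable_add L2_prod_integrable(3) L2_diff f)
        (simp add: distrib_left[symmetric])
    also have "\<dots> \<le> L2_norm (\<lambda>x. f m x - f n x) * L2_norm (f m) + L2_norm (\<lambda>x. f m x - f n x) * L2_norm (f n)"
      using L2_prod_integrable(3,4)[OF L2_diff[OF f f] f, of m n m] L2_prod_integrable(3,4)[OF L2_diff[OF f f] f, of m n n]
      by (subst Bochner_Integration.integral_add) (auto intro: add_mono)
    finally show ?thesis by (simp add: distrib_left)
  qed
  have "\<exists>N. \<forall>i\<ge>N. \<forall>j\<ge>N. (\<integral>x. norm (?g i x - ?g j x) \<partial>lborel) < e" if "e > 0" for e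
  proof -
    from cauchy[of "e / (2 * B)"] \<open>B > 0\<close> that obtain N where N: "\<And>m n. m \<ge> N \<Longrightarrow> n \<ge> N \<Longrightarrow> L2_norm (\<lambda>x. f m x - f n x) < e / (2 * B)"
      by auto
    show ?thesis
    proof (intro exI[of _ "max N N0"] allI impI)
      fix i j assume ij: "i \<ge> max N N0" "j \<ge> max N N0"
      have "(\<integral>x. norm (?g i x - ?g j x) \<partial>lborel) \<le> L2_norm (\<lambda>x. f i x - f j x) * (B + B)"
        by (rule order_trans[OF g_le mult_left_mono[OF add_mono]]) (use B ij in auto)
      also have "\<dots> < e / (2 * B) * (B + B)"
        using N[of i j] ij \<open>B > 0\<close> by (intro mult_strict_right_mono) auto
      finally show "(\<integral>x. norm (?g i x - ?g j x) \<partial>lborel) < e" using \<open>B > 0\<close> by simp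
    qed
  qed
  \<comment> \<open>The L^1 theory supplies a subsequence that is Cauchy almost everywhere after the
    map; \<open>mazur_lower\<close> pulls this back pointwise to \<open>f\<close>.\<close>
  from cauchy_L1_AE_cauchy_subseq[OF L2_mazur_integrable[OF f] this]
  obtain r where r: "strict_mono r" "AE x in lborel. Cauchy (\<lambda>i. ?g (r i) x)" by auto
  define F where "F x = lim (\<lambda>i. f (r i) x)" for x
  have F[measurable]: "F \<in> borel_measurable borel" unfolding F_def[abs_def] by measurable
  have lim: "AE x in lborel. (\<lambda>i. f (r i) x) \<longlonglongrightarrow> F x"
    using r(2)
  proof eventually_elim
    case (elim x)
    have "Cauchy (\<lambda>i. f (r i) x)"
    proof (rule metric_CauchyI)
      fix e :: real assume "e > 0"
      then obtain M where M: "\<And>m n. m \<ge> M \<Longrightarrow> n \<ge> M \<Longrightarrow> norm (?g (r m) x - ?g (r n) x) < e\<^sup>2 / 2"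
        using metric_CauchyD[OF elim, of "e\<^sup>2 / 2"] by (auto simp: dist_norm)
      have "dist (f (r m) x) (f (r n) x) < e" if "m \<ge> M" "n \<ge> M" for m n
      proof -
        have "(norm (f (r m) x - f (r n) x))\<^sup>2 < e\<^sup>2"
          using mazur_lower[of "f (r m) x" "f (r n) x"] M[OF that] by linarith
        then show ?thesis using \<open>e > 0\<close> by (simp add: dist_norm power_less_imp_less_base)
      qed
      then show "\<exists>M. \<forall>m\<ge>M. \<forall>n\<ge>M. dist (f (r m) x) (f (r n) x) < e" by blast
    qed
    then show ?case unfolding F_def by (simp add: Cauchy_convergent_iff convergent_LIMSEQ_iff)
  qed
  \<comment> \<open>Fatou in the second index along the subsequence, with the first index
    fixed.\<close>
  have key: "(\<lambda>x. f n x - F x) \<in> L2 \<and> mass (\<lambda>x. f n x - F x) \<le> e\<^sup>2"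
    if N: "\<And>m n. m \<ge> N \<Longrightarrow> n \<ge> N \<Longrightarrow> L2_norm (\<lambda>x. f m x - f n x) < e" and n: "n \<ge> N" and e: "e > 0" for n N e
  proof -
    have "\<forall>\<^sub>F i in sequentially. mass (\<lambda>x. f n x - f (r i) x) \<le> e\<^sup>2"
      using eventually_ge_at_top[of N]
    proof eventually_elim
      case (elim i)
      then have "r i \<ge> N" using seq_suble[OF r(1), of i] by simp
      then have "L2_norm (\<lambda>x. f n x - f (r i) x) < e" using N n by auto
      then have "(L2_norm (\<lambda>x. f n x - f (r i) x))\<^sup>2 \<le> e\<^sup>2"
        by (intro power_mono) auto
      then show ?case by (simp add: L2_norm_sq)
    qed
    moreover have "AE x in lborel. (\<lambda>i. f n x - f (r i) x) \<longlonglongrightarrow> f n x - F x"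
      using lim by eventually_elim (intro tendsto_intros)
    ultimately show ?thesis
      using L2_Fatou[of "\<lambda>i x. f n x - f (r i) x" "e\<^sup>2" "\<lambda>x. f n x - F x"] f L2_diff by auto
  qed
  obtain N1 where N1: "\<And>m n. m \<ge> N1 \<Longrightarrow> n \<ge> N1 \<Longrightarrow> L2_norm (\<lambda>x. f m x - f n x) < 1"
    using cauchy[of 1] by auto
  have "F \<in> L2"
  proof -
    have "(\<lambda>x. f N1 x - F x) \<in> L2" using key[of N1 1 N1] N1 by auto
    from L2_diff[OF f[of N1] this] show ?thesis by simp
  qed
  moreover have "(\<lambda>n. L2_norm (\<lambda>x. f n x - F x)) \<longlonglongrightarrow> 0"
  proof (rule LIMSEQ_I)
    fix e :: real assume e: "e > 0"
    obtain N where N: "\<And>m n. m \<ge> N \<Longrightarrow> n \<ge> N \<Longrightarrow> L2_norm (\<lambda>x. f m x - f n x) < e / 2"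
      using cauchy[of "e / 2"] e by auto
    have "L2_norm (\<lambda>x. f n x - F x) \<le> e / 2" if "n \<ge> N" for n
      unfolding L2_norm_def using conjunct2[OF key[OF N that]] e by (intro real_le_lsqrt) auto
    then show "\<exists>N. \<forall>n\<ge>N. norm (L2_norm (\<lambda>x. f n x - F x) - 0) < e"
      using e by (intro exI[of _ N]) fastforce
  qed
  ultimately show ?thesis using that by blast
qed

text \<open>Passes continuity of translations from an approximant \<open>g\<close> to
  \<open>f\<close>. The approximation error counts twice, since its translate has the same
  integral.\<close>

lemma integral_norm_translate_diff_le:
  fixes f g :: "'a::euclidean_space \<Rightarrow> 'b::{banach, second_countable_topology}"
  assumes f: "integrable lborel f" and g: "integrable lborel g"
  shows "(\<integral>x. norm (f (x + z) - f x) \<partial>lborel)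
    \<le> (\<integral>x. norm (g (x + z) - g x) \<partial>lborel) + 2 * (\<integral>x. norm (f x - g x) \<partial>lborel)"
proof -
  note [measurable] = borel_measurable_integrable[OF f, simplified] borel_measurable_integrable[OF g, simplified]
  have i: "integrable lborel (\<lambda>x. f (x + z))" "integrable lborel (\<lambda>x. g (x + z))"
    using f g by (auto simp: integral_translate(2))
  have "(\<integral>x. norm (f (x + z) - f x) \<partial>lborel)
    \<le> (\<integral>x. norm (g (x + z) - g x) + (norm (f (x + z) - g (x + z)) + norm (f x - g x)) \<partial>lborel)"
  proof (intro integral_mono)
    fix x
    have "f (x + z) - f x = (g (x + z) - g x) + ((f (x + z) - g (x + z)) - (f x - g x))" by simp
    then show "norm (f (x + z) - f x) \<le> norm (g (x + z) - g x) + (norm (f (x + z) - g (x + z)) + norm (f x - g x))"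
      by (metis norm_triangle_le norm_triangle_ineq4 add_left_mono)
  qed (use f g i in auto)
  also have "\<dots> = (\<integral>x. norm (g (x + z) - g x) \<partial>lborel) + 
      ((\<integral>x. norm (f (x + z) - g (x + z)) \<partial>lborel) + (\<integral>x. norm (f x - g x) \<partial>lborel))"
    using f g i by (subst Bochner_Integration.integral_add; (subst Bochner_Integration.integral_add)?) auto
  also have "(\<integral>x. norm (f (x + z) - g (x + z)) \<partial>lborel) = (\<integral>x. norm (f x - g x) \<partial>lborel)"
    by (rule integral_translate(1)) measurable
  finally show ?thesis by simp
qed

text \<open>For open \<open>U\<close> the one-sided difference max(1_U(x) - 1_U(x + z), 0) tends to
  0 at every point, while the full difference need not do so on the boundary. Because
  \<open>U\<close> and its translate have equal measure, the two one-sided parts have equal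
  integrals, hence the factor 2.\<close>

lemma L1_translate_open:
  fixes U :: "'a::euclidean_space set"
  assumes U: "open U" "emeasure lborel U < \<infinity>" and z: "z \<longlonglongrightarrow> 0"
  shows "(\<lambda>n. \<integral>x. norm (indicator U (x + z n) - indicator U x :: real) \<partial>lborel) \<longlonglongrightarrow> 0"
proof -
  have [measurable]: "U \<in> sets borel" using U by auto
  have i: "integrable lborel (\<lambda>x. indicator U x :: real)" "integrable lborel (\<lambda>x. indicator U (x + z n) :: real)" for n
    using U by (auto simp: integral_translate(2)[of "\<lambda>x. indicator U x :: real"])
  have "(\<lambda>n. \<integral>x. max (indicator U x - indicator U (x + z n)) (0::real) \<partial>lborel) \<longlonglongrightarrow> (\<integral>x. 0 \<partial>(lborel :: 'a measure))"
  proof (rule integral_dominated_convergence[where w="\<lambda>x. indicator U x"])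
    show "AE x in lborel. (\<lambda>n. max (indicator U x - indicator U (x + z n)) (0 :: real)) \<longlonglongrightarrow> 0"
    proof (rule AE_I2)
      fix x
      show "(\<lambda>n. max (indicator U x - indicator U (x + z n)) (0 :: real)) \<longlonglongrightarrow> 0"
      proof (cases "x \<in> U")
        case True
        have "(\<lambda>n. x + z n) \<longlonglongrightarrow> x + 0" by (intro tendsto_intros z)
        then have "\<forall>\<^sub>F n in sequentially. x + z n \<in> U" using U(1) True by (auto dest: topological_tendstoD)
        then show ?thesis using True by (intro tendsto_eventually) (auto elim!: eventually_mono)
      qed (auto simp: indicator_def)
    qed
  qed (use i in \<open>auto simp: indicator_def\<close>)
  then have *: "(\<lambda>n. 2 * (\<integral>x. max (indicator U x - indicator U (x + z n)) (0::real) \<partial>lborel)) \<longlonglongrightarrow> 2 * 0"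
    by (intro tendsto_mult tendsto_const) simp
  have "(\<integral>x. norm (indicator U (x + z n) - indicator U x :: real) \<partial>lborel) = 2 * (\<integral>x. max (indicator U x - indicator U (x + z n)) 0 \<partial>lborel)" for n
  proof -
    have "(\<integral>x. norm (indicator U (x + z n) - indicator U x :: real) \<partial>lborel) = 
      (\<integral>x. 2 * max (indicator U x - indicator U (x + z n)) 0 - (indicator U x - indicator U (x + z n)) \<partial>lborel)"
      by (intro Bochner_Integration.integral_cong) (auto simp: indicator_def)
    also have "\<dots> = 2 * (\<integral>x. max (indicator U x - indicator U (x + z n)) 0 \<partial>lborel)"
      using i integral_translate(1)[of "\<lambda>x. indicator U x :: real" "z n"] by simp
    finally show ?thesis .
  qed
  with * show ?thesis by simp
qed

text \<open>Induction over integrable functions: for a set of finite measure, outer regularity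
  provides an open superset of almost the same measure, and sums and limits follow by
  approximation.\<close>

lemma L1_translate:
  fixes f :: "'a::euclidean_space \<Rightarrow> 'b::{banach, second_countable_topology}"
  assumes f: "integrable lborel f" and z: "z \<longlonglongrightarrow> 0"
  shows "(\<lambda>n. \<integral>x. norm (f (x + z n) - f x) \<partial>lborel) \<longlonglongrightarrow> 0"
  using f
proof (induction rule: integrable_induct)
  case (base A c)
  have [measurable]: "A \<in> sets borel" using base by simp
  have Ai: "integrable lborel (\<lambda>x. indicator A x :: real)" using base by simp
  have "(\<lambda>n. \<integral>x. norm (indicator A (x + z n) - indicator A x :: real) \<partial>lborel) \<longlonglongrightarrow> 0"
  proof (rule tendsto_0_approx)
    fix e :: real assume "e > 0"
    then obtain U where U: "open U" "A \<subseteq> U" "emeasure lborel (U - A) < ennreal (e / 2)"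
      using outer_regular_lborel[of A "e / 2"] by auto
    have [measurable]: "U \<in> sets borel" using U by auto
    have "emeasure lborel U = emeasure lborel A + emeasure lborel (U - A)"
      using U(2) by (subst plus_emeasure) (auto simp: Un_absorb1)
    also have "\<dots> < \<infinity>" using base U(3) by (auto simp: less_top[symmetric] dest: order.strict_trans)
    finally have fin: "emeasure lborel U < \<infinity>" .
    then have Ui: "integrable lborel (\<lambda>x. indicator U x :: real)" by simp
    have "(\<integral>x. norm (indicator A x - indicator U x :: real) \<partial>lborel) = (\<integral>x. indicator (U - A) x \<partial>lborel)"
      using U(2) by (intro Bochner_Integration.integral_cong) (auto simp: indicator_def)
    also have "\<dots> \<le> e / 2"
      using U(3) \<open>e > 0\<close> using enn2real_leI[of "e / 2" "emeasure lborel (U - A)"] by (simp add: measure_def)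
    finally have d: "(\<integral>x. norm (indicator A x - indicator U x :: real) \<partial>lborel) \<le> e / 2" .
    show "\<exists>b. b \<longlonglongrightarrow> 0 \<and> (\<forall>n. (\<integral>x. norm (indicator A (x + z n) - indicator A x :: real) \<partial>lborel) \<le> b n + e)"
    proof (intro exI conjI allI)
      show "(\<lambda>n. \<integral>x. norm (indicator U (x + z n) - indicator U x :: real) \<partial>lborel) \<longlonglongrightarrow> 0"
        by (rule L1_translate_open[OF U(1) fin z])
      show "(\<integral>x. norm (indicator A (x + z n) - indicator A x :: real) \<partial>lborel)
        \<le> (\<integral>x. norm (indicator U (x + z n) - indicator U x :: real) \<partial>lborel) + e" for n
        using integral_norm_translate_diff_le[OF Ai Ui, of "z n"] d by linarith
    qed
  qed simp
  then have "(\<lambda>n. (\<integral>x. norm (indicator A (x + z n) - indicator A x :: real) \<partial>lborel) * norm c) \<longlonglongrightarrow> 0"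
    by (rule tendsto_mult_left_zero)
  then show ?case by (simp flip: scaleR_diff_left)
next
  case (add f g)
  have [measurable]: "f \<in> borel_measurable borel" "g \<in> borel_measurable borel" using add by auto
  have i: "integrable lborel (\<lambda>x. norm (f (x + z n) - f x))" "integrable lborel (\<lambda>x. norm (g (x + z n) - g x))" for n
    using add by (auto simp: integral_translate(2))
  have s: "(\<lambda>n. (\<integral>x. norm (f (x + z n) - f x) \<partial>lborel) + (\<integral>x. norm (g (x + z n) - g x) \<partial>lborel)) \<longlonglongrightarrow> 0 + 0"
    by (intro tendsto_add add)
  show ?case
  proof (rule Lim_null_comparison[OF always_eventually, OF allI])
    fix n
    have "(\<integral>x. norm (f (x + z n) + g (x + z n) - (f x + g x)) \<partial>lborel) \<le>
        (\<integral>x. norm (f (x + z n) - f x) + norm (g (x + z n) - g x) \<partial>lborel)"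
      using add i by (intro integral_mono norm_diff_triangle_ineq) (auto simp: integral_translate(2)[of "\<lambda>x. f x"] integral_translate(2)[of "\<lambda>x. g x"])
    then show "norm (\<integral>x. norm (f (x + z n) + g (x + z n) - (f x + g x)) \<partial>lborel) \<le>
      (\<integral>x. norm (f (x + z n) - f x) \<partial>lborel) + (\<integral>x. norm (g (x + z n) - g x) \<partial>lborel)"
      using i by simp
  qed (use s in simp)
next
  case (lim f s)
  have [measurable]: "f \<in> borel_measurable borel" "\<And>i. s i \<in> borel_measurable borel" using lim by auto
  have c: "(\<lambda>i. \<integral>x. norm (f x - s i x) \<partial>lborel) \<longlonglongrightarrow> (\<integral>x. 0 \<partial>(lborel :: 'a measure))"
  proof (rule integral_dominated_convergence[where w="\<lambda>x. 3 * norm (f x)"])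
    show "AE x in lborel. (\<lambda>i. norm (f x - s i x)) \<longlonglongrightarrow> 0"
    proof (rule AE_I2)
      fix x :: 'a
      have "(\<lambda>i. f x - s i x) \<longlonglongrightarrow> f x - f x"
        using lim(2)[of x] by (intro tendsto_diff tendsto_const) simp_all
      then show "(\<lambda>i. norm (f x - s i x)) \<longlonglongrightarrow> 0" by (intro tendsto_norm_zero) simp
    qed
    fix i show "AE x in lborel. norm (norm (f x - s i x)) \<le> 3 * norm (f x)"
      using lim(3) by (intro AE_I2) (smt (verit) norm_ge_zero norm_triangle_ineq4 real_norm_def space_lborel UNIV_I)
  qed (use lim in auto)
  show ?case
  proof (rule tendsto_0_approx)
    fix e :: real assume "e > 0"
    then obtain i where i: "(\<integral>x. norm (f x - s i x) \<partial>lborel) < e / 2"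
      using LIMSEQ_D[OF c, of "e / 2"] by auto
    show "\<exists>b. b \<longlonglongrightarrow> 0 \<and> (\<forall>n. (\<integral>x. norm (f (x + z n) - f x) \<partial>lborel) \<le> b n + e)"
    proof (intro exI conjI allI)
      show "(\<lambda>n. \<integral>x. norm (s i (x + z n) - s i x) \<partial>lborel) \<longlonglongrightarrow> 0" by (rule lim(5))
      show "(\<integral>x. norm (f (x + z n) - f x) \<partial>lborel) \<le> (\<integral>x. norm (s i (x + z n) - s i x) \<partial>lborel) + e" for n
        using integral_norm_translate_diff_le[OF lim(4) lim(1)[of i], of "z n"] i by linarith
    qed
  qed simp
qed

lemma L2_translate_tendsto:
  assumes f: "f \<in> L2" and z: "z \<longlonglongrightarrow> 0"
  shows "(\<lambda>n. L2_norm (\<lambda>x. f (x + z n) - f x)) \<longlonglongrightarrow> 0"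
proof -
  let ?g = "\<lambda>x. norm (f x) *\<^sub>R f x"
  note [measurable] = L2_measurable[OF f]
  have g: "integrable lborel ?g" by (rule L2_mazur_integrable[OF f])
  have *: "(\<lambda>n. 2 * (\<integral>x. norm (?g (x + z n) - ?g x) \<partial>lborel)) \<longlonglongrightarrow> 2 * 0"
    by (intro tendsto_mult tendsto_const L1_translate[OF g z])
  have "mass (\<lambda>x. f (x + z n) - f x) \<le> 2 * (\<integral>x. norm (?g (x + z n) - ?g x) \<partial>lborel)" for n
  proof -
    have "mass (\<lambda>x. f (x + z n) - f x) \<le> (\<integral>x. 2 * norm (?g (x + z n) - ?g x) \<partial>lborel)"
      unfolding mass_def
      using mazur_lower L2_diff[OF L2_translate[OF f] f] g integral_translate(2)[of ?g "z n"]
      by (intro integral_mono) (auto simp: L2_def)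
    then show ?thesis by simp
  qed
  then have "(\<lambda>n. mass (\<lambda>x. f (x + z n) - f x)) \<longlonglongrightarrow> 0"
    by (intro Lim_null_comparison[OF always_eventually *[unfolded mult_zero_right]] allI) simp
  then show ?thesis
    unfolding L2_norm_def using tendsto_real_sqrt by fastforce
qed

subsection \<open>The Plancherel theorem\<close>

definition gaussian :: "real^3 \<Rightarrow> real" where
  "gaussian x = exp (- (norm x)\<^sup>2 / 2)"

lemma gaussian_borel [measurable]: "gaussian \<in> borel_measurable borel"
  unfolding gaussian_def[abs_def] by measurable

lemma gaussian_bounds: "0 < gaussian x" "gaussian x \<le> 1"
  by (auto simp: gaussian_def)

text \<open>Read off from the characteristic function of the standard normal distribution, taken at
  -y because of the sign in the exponent.\<close>

lemma gaussian_fourier_1d: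
  "integrable lborel (\<lambda>t::real. cis (- (t * y)) * of_real (exp (- t\<^sup>2 / 2)))"
  "(\<integral>t. cis (- (t * y)) * of_real (exp (- t\<^sup>2 / 2)) \<partial>lborel) = of_real (sqrt (2 * pi) * exp (- y\<^sup>2 / 2))"
proof -
  have e: "of_real (exp (- t\<^sup>2 / 2)) = (of_real (sqrt (2 * pi)) * of_real (std_normal_density t) :: complex)" for t
    by (simp add: std_normal_density_def)
  have i0: "integrable lborel (\<lambda>t. std_normal_density t *\<^sub>R cis (- (t * y)))"
    by (rule Bochner_Integration.integrable_bound[OF integrable_normal_density[where \<mu>=0 and \<sigma>=1]]) auto
  have i1: "(\<lambda>t::real. cis (- (t * y)) * of_real (exp (- t\<^sup>2 / 2))) =
     (\<lambda>t. of_real (sqrt (2 * pi)) * (std_normal_density t *\<^sub>R cis (- (t * y))))"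
    unfolding e by (simp add: scaleR_conv_of_real mult_ac)
  show "integrable lborel (\<lambda>t::real. cis (- (t * y)) * of_real (exp (- t\<^sup>2 / 2)))"
    unfolding i1 by (intro integrable_mult_right i0)
  have "(\<integral>t. std_normal_density t *\<^sub>R cis (- (t * y)) \<partial>lborel) = char std_normal_distribution (- y)"
    unfolding char_def
    by (subst integral_density) (auto simp: cis_conv_exp mult_ac)
  then have "(\<integral>t. std_normal_density t *\<^sub>R cis (- (t * y)) \<partial>lborel) = of_real (exp (- y\<^sup>2 / 2))"
    by (simp add: char_std_normal_distribution)
  then show "(\<integral>t. cis (- (t * y)) * of_real (exp (- t\<^sup>2 / 2)) \<partial>lborel) = of_real (sqrt (2 * pi) * exp (- y\<^sup>2 / 2))"
    by (simp only: i1 integral_mult_right_zero of_real_mult)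
qed

lemma norm_sq_sum_Basis: "(norm (x::'a::euclidean_space))\<^sup>2 = (\<Sum>b\<in>Basis. (x \<bullet> b)\<^sup>2)"
  unfolding power2_norm_eq_inner by (subst euclidean_inner) (simp add: power2_eq_square)

text \<open>The factor (2 pi)^(3/2) by which the unnormalised transform multiplies L^2
  norms.\<close>

definition fourier_const :: real where "fourier_const = sqrt (2 * pi) ^ 3"

lemma fourier_const_pos: "fourier_const > 0" by (simp add: fourier_const_def)
lemma fourier_const_sq: "fourier_const\<^sup>2 = (2 * pi) ^ 3"
proof -
  have "fourier_const\<^sup>2 = (sqrt (2 * pi))\<^sup>2 ^ 3" unfolding fourier_const_def by (simp only: power_mult[symmetric] mult.commute)
  then show ?thesis by simp
qed

lemma gaussian_fourier:
  "integrable lborel (\<lambda>x. cis (- (x \<bullet> y)) * of_real (gaussian x))"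
  "fourier (\<lambda>x. of_real (gaussian x)) y = of_real (fourier_const * gaussian y)"
proof -
  let ?f = "\<lambda>(b::real^3) t. cis (- (t * (y \<bullet> b))) * of_real (exp (- t\<^sup>2 / 2))"
  have eq: "cis (- (x \<bullet> y)) * of_real (gaussian x) = (\<Prod>b\<in>Basis. ?f b (x \<bullet> b))" for x
  proof -
    have "cis (- (x \<bullet> y)) = (\<Prod>b\<in>Basis. cis (- (x \<bullet> b * (y \<bullet> b))))"
      by (subst euclidean_inner) (simp add: cis_conv_exp sum_negf sum_distrib_left flip: exp_sum)
    moreover have "of_real (gaussian x) = (\<Prod>b\<in>Basis. of_real (exp (- (x \<bullet> b)\<^sup>2 / 2)) :: complex)"
      unfolding gaussian_def norm_sq_sum_Basis by (simp add: exp_sum sum_divide_distrib flip: sum_negf of_real_prod)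
    ultimately show ?thesis by (simp add: prod.distrib)
  qed
  show "integrable lborel (\<lambda>x. cis (- (x \<bullet> y)) * of_real (gaussian x))"
    unfolding eq by (intro lborel_integral_prod gaussian_fourier_1d)
  have "fourier (\<lambda>x. of_real (gaussian x)) y = (\<Prod>b\<in>Basis. \<integral>t. ?f (b::real^3) t \<partial>lborel)"
    unfolding fourier_def eq by (intro lborel_integral_prod gaussian_fourier_1d)
  also have "\<dots> = (\<Prod>b\<in>(Basis::(real^3) set). of_real (sqrt (2 * pi) * exp (- (y \<bullet> b)\<^sup>2 / 2)))"
    by (intro prod.cong refl gaussian_fourier_1d(2))
  also have "\<dots> = of_real (fourier_const * (\<Prod>b\<in>(Basis::(real^3) set). exp (- (y \<bullet> b)\<^sup>2 / 2)))"
    by (simp add: prod.distrib fourier_const_def)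
  also have "(\<Prod>b\<in>(Basis::(real^3) set). exp (- (y \<bullet> b)\<^sup>2 / 2)) = gaussian y"
    unfolding gaussian_def norm_sq_sum_Basis by (simp add: exp_sum sum_divide_distrib flip: sum_negf)
  finally show "fourier (\<lambda>x. of_real (gaussian x)) y = of_real (fourier_const * gaussian y)" .
qed

lemma gaussian_integral: "integrable lborel gaussian" "(\<integral>x. gaussian x \<partial>lborel) = fourier_const"
proof -
  show i: "integrable lborel gaussian"
    using gaussian_fourier(1)[of 0] by (simp add: complex_of_real_integrable_eq)
  have "fourier (\<lambda>x. of_real (gaussian x)) 0 = of_real fourier_const" unfolding gaussian_fourier(2) by (simp add: gaussian_def)
  then have "complex_of_real (\<integral>x. gaussian x \<partial>lborel) = of_real fourier_const" by (simp add: fourier_def)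
  then show "(\<integral>x. gaussian x \<partial>lborel) = fourier_const" by (simp only: of_real_eq_iff)
qed

lemma fourier_integrable:
  fixes f :: "real^3 \<Rightarrow> complex"
  assumes "integrable lborel f" shows "integrable lborel (\<lambda>x. cis (- (x \<bullet> \<xi>)) * f x)"
  by (rule Bochner_Integration.integrable_bound[OF integrable_norm[OF assms]])
     (use borel_measurable_integrable[OF assms] in \<open>auto simp: norm_mult\<close>)

lemma fourier_borel [measurable]:
  assumes [measurable]: "f \<in> borel_measurable borel"
  shows "fourier f \<in> borel_measurable borel"
  unfolding fourier_def[abs_def]
  by (rule lborel.borel_measurable_lebesgue_integral) measurable

lemma fourier_norm_le: "integrable lborel f \<Longrightarrow> norm (fourier f \<xi>) \<le> (\<integral>x. norm (f x) \<partial>lborel)"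
  unfolding fourier_def by (rule order_trans[OF integral_norm_bound]) (simp add: norm_mult)

lemma fourier_multiplication:
  assumes f: "integrable lborel f" and h: "integrable lborel h"
  shows "(\<integral>\<xi>. fourier f \<xi> * h \<xi> \<partial>lborel) = (\<integral>x. f x * fourier h x \<partial>lborel)"
proof -
  note [measurable] = borel_measurable_integrable[OF f, simplified] borel_measurable_integrable[OF h, simplified]
  have "integrable (lborel \<Otimes>\<^sub>M lborel) (\<lambda>(x, \<xi>). f x * cis (- (x \<bullet> \<xi>)) * h \<xi>)"
  proof (rule lborel_pair.Fubini_integrable)
    show "AE x in lborel. integrable lborel (\<lambda>y. case (x, y) of (x, \<xi>) \<Rightarrow> f x * cis (- (x \<bullet> \<xi>)) * h \<xi>)"
      using fourier_integrable[OF h] by (intro AE_I2) (simp add: inner_commute mult.assoc)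
    show "integrable lborel (\<lambda>x. \<integral>y. norm (case (x, y) of (x, \<xi>) \<Rightarrow> f x * cis (- (x \<bullet> \<xi>)) * h \<xi>) \<partial>lborel)"
      using f by (simp add: norm_mult)
  qed measurable
  from lborel_pair.Fubini_integral[OF this]
  have "(\<integral>\<xi>. (\<integral>x. f x * cis (- (x \<bullet> \<xi>)) * h \<xi> \<partial>lborel) \<partial>lborel) = (\<integral>x. (\<integral>\<xi>. f x * cis (- (x \<bullet> \<xi>)) * h \<xi> \<partial>lborel) \<partial>lborel)" .
  moreover have "(\<integral>x. f x * cis (- (x \<bullet> \<xi>)) * h \<xi> \<partial>lborel) = fourier f \<xi> * h \<xi>" for \<xi>
    unfolding fourier_def by (simp add: mult.commute)
  moreover have "(\<integral>\<xi>. f x * cis (- (x \<bullet> \<xi>)) * h \<xi> \<partial>lborel) = f x * fourier h x" for x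
    unfolding fourier_def by (simp add: mult.assoc inner_commute[of x])
  ultimately show ?thesis by (simp only:)
qed

lemma fourier_modulated:
  "fourier (\<lambda>x. cis (- (x \<bullet> a)) * f x) \<xi> = fourier f (\<xi> + a)"
  unfolding fourier_def by (simp add: inner_add_right cis_mult[symmetric] mult.assoc)
     (simp add: cis_mult mult.assoc[symmetric] inner_add_right)

lemma fourier_scale:
  assumes [measurable]: "f \<in> borel_measurable borel" and c: "c > 0"
  shows "fourier (\<lambda>x. f (c *\<^sub>R x)) \<xi> = (1 / c ^ 3) *\<^sub>R fourier f ((1 / c) *\<^sub>R \<xi>)"
proof -
  have "fourier f ((1 / c) *\<^sub>R \<xi>) = c ^ 3 *\<^sub>R (\<integral>x. cis (- ((c *\<^sub>R x) \<bullet> ((1 / c) *\<^sub>R \<xi>))) * f (c *\<^sub>R x) \<partial>lborel)"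
    unfolding fourier_def using c by (subst integral_scale(1)[of _ c]) auto
  also have "(\<integral>x. cis (- ((c *\<^sub>R x) \<bullet> ((1 / c) *\<^sub>R \<xi>))) * f (c *\<^sub>R x) \<partial>lborel) = fourier (\<lambda>x. f (c *\<^sub>R x)) \<xi>"
    unfolding fourier_def using c by simp
  finally show ?thesis using c by simp
qed

text \<open>The Gaussian factor makes Fubini applicable. Reading |Ff|^2 G as Ff times (conj(Ff) G),
  the multiplication formula moves the transform onto the second factor, where it becomes a Gaussian
  average of translates of conj f; exchanging the integrals leaves the autocorrelation of f at d
  w.\<close>

lemma plancherel_regularized:
  assumes f: "f \<in> L2" "integrable lborel f" and d: "d > 0"
  shows "(\<integral>\<xi>. (norm (fourier f \<xi>))\<^sup>2 * gaussian (d *\<^sub>R \<xi>) \<partial>lborel) = fourier_const * Re (\<integral>w. gaussian w * L2_inner f (\<lambda>x. f (x - d *\<^sub>R w)) \<partial>lborel)"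
    and "integrable lborel (\<lambda>\<xi>. (norm (fourier f \<xi>))\<^sup>2 * gaussian (d *\<^sub>R \<xi>))"
proof -
  note fm[measurable] = L2_measurable[OF f(1)]
  define Gd where "Gd = (\<lambda>x. complex_of_real (gaussian (d *\<^sub>R x)))"
  have gd: "integrable lborel (\<lambda>\<xi>. gaussian (d *\<^sub>R \<xi>))"
    using gaussian_integral(1) d integral_scale(2)[of gaussian d] by simp
  have Gd: "integrable lborel Gd" unfolding Gd_def using gd by simp
  have [measurable]: "Gd \<in> borel_measurable borel" unfolding Gd_def by measurable
  have FGd: "fourier Gd y = of_real (fourier_const / d ^ 3 * gaussian ((1 / d) *\<^sub>R y))" for y
    unfolding Gd_def using fourier_scale[of "\<lambda>x. of_real (gaussian x)" d y] d gaussian_fourier(2) 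
    by (simp add: scaleR_conv_of_real)
  define h where "h \<xi> = cnj (fourier f \<xi>) * Gd \<xi>" for \<xi>
  let ?M = "\<integral>x. norm (f x) \<partial>lborel"
  have hi: "integrable lborel h" unfolding h_def
    by (rule Bochner_Integration.integrable_bound[of _ "\<lambda>\<xi>. ?M * norm (Gd \<xi>)"])
       (use Gd fourier_norm_le[OF f(2)] in \<open>auto simp: norm_mult intro!: mult_right_mono\<close>)
  have sqi: "integrable lborel (\<lambda>\<xi>. (norm (fourier f \<xi>))\<^sup>2 * gaussian (d *\<^sub>R \<xi>))"
    by (rule Bochner_Integration.integrable_bound[of _ "\<lambda>\<xi>. ?M\<^sup>2 * gaussian (d *\<^sub>R \<xi>)"])
       (use gd fourier_norm_le[OF f(2)] gaussian_bounds(1)[THEN less_imp_le] in \<open>auto simp: abs_mult intro!: mult_right_mono power_mono\<close>)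
  then show "integrable lborel (\<lambda>\<xi>. (norm (fourier f \<xi>))\<^sup>2 * gaussian (d *\<^sub>R \<xi>))" .
  define fr where "fr x = cnj (f (- x))" for x
  have fri: "integrable lborel fr"
    unfolding fr_def using integral_reflect(2)[OF fm] f(2) by simp
  have cf: "cnj (fourier f \<xi>) = fourier fr \<xi>" for \<xi>
  proof -
    have "fourier fr \<xi> = (\<integral>x. cis (- (- x \<bullet> \<xi>)) * cnj (f x) \<partial>lborel)"
      unfolding fourier_def fr_def by (subst integral_reflect(1)[symmetric]) auto
    then show ?thesis by (simp add: fourier_def cis_cnj flip: Bochner_Integration.integral_cnj)
  qed
  have fh: "fourier h x = of_real fourier_const * (\<integral>w. gaussian w * cnj (f (x - d *\<^sub>R w)) \<partial>lborel)" for x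
  proof -
    have "fourier h x = (\<integral>\<xi>. fourier fr \<xi> * (cis (- (\<xi> \<bullet> x)) * Gd \<xi>) \<partial>lborel)"
      unfolding fourier_def[of h] h_def cf by (simp add: mult_ac)
    also have "\<dots> = (\<integral>y. fr y * fourier (\<lambda>\<xi>. cis (- (\<xi> \<bullet> x)) * Gd \<xi>) y \<partial>lborel)"
      by (rule fourier_multiplication[OF fri fourier_integrable[OF Gd]])
    also have "\<dots> = (\<integral>y. fr y * fourier Gd (y + x) \<partial>lborel)"
      by (simp add: fourier_modulated)
    also have "\<dots> = (\<integral>y. fr (y - x) * fourier Gd y \<partial>lborel)"
      by (subst integral_translate(1)[where a=x, symmetric]) (auto simp: fr_def)
    \<comment> \<open>The Jacobian d^3 cancels the factor 1 / d^3 in the transform of the dilated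
      Gaussian, so the kernel no longer depends on d.\<close>
    also have "\<dots> = d ^ 3 *\<^sub>R (\<integral>w. fr (d *\<^sub>R w - x) * fourier Gd (d *\<^sub>R w) \<partial>lborel)"
      using d by (subst integral_scale(1)[where c=d]) (auto simp: fr_def)
    also have "\<dots> = (\<integral>w. of_real fourier_const * (gaussian w * cnj (f (x - d *\<^sub>R w))) \<partial>lborel)"
  proof -
    have "fr (d *\<^sub>R w - x) * fourier Gd (d *\<^sub>R w) = (1 / d ^ 3) *\<^sub>R (of_real fourier_const * (gaussian w * cnj (f (x - d *\<^sub>R w))))" for w
      unfolding FGd fr_def using d by (simp add: scaleR_conv_of_real[where 'a=complex])
    then show ?thesis using d by simp
  qed
    finally show ?thesis by simp
  qed
  have pair: "integrable (lborel \<Otimes>\<^sub>M lborel) (\<lambda>(w, x). gaussian w * (f x * cnj (f (x - d *\<^sub>R w))))"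
  proof (rule lborel_pair.Fubini_integrable)
    show "AE w in lborel. integrable lborel (\<lambda>x. case (w, x) of (w, x) \<Rightarrow> gaussian w * (f x * cnj (f (x - d *\<^sub>R w))))"
      using L2_prod_integrable(2)[OF f(1) L2_translate[OF f(1)]] 
      by (intro AE_I2) (simp add: diff_conv_add_uminus del: add_uminus_conv_diff)
    show "integrable lborel (\<lambda>w. \<integral>x. norm (case (w, x) of (w, x) \<Rightarrow> gaussian w * (f x * cnj (f (x - d *\<^sub>R w)))) \<partial>lborel)"
    proof (rule Bochner_Integration.integrable_bound[of _ "\<lambda>w. gaussian w * mass f"])
      show "AE w in lborel. norm (\<integral>x. norm (case (w, x) of (w, x) \<Rightarrow> gaussian w * (f x * cnj (f (x - d *\<^sub>R w)))) \<partial>lborel) \<le> norm (gaussian w * mass f)"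
      proof (rule AE_I2)
        fix w
        have "(\<integral>x. norm (f x) * norm (f (x - d *\<^sub>R w)) \<partial>lborel) \<le> L2_norm f * L2_norm f"
          using L2_prod_integrable(4)[OF f(1) L2_translate[OF f(1)], of "- d *\<^sub>R w"] mass_translate[OF f(1), of "- d *\<^sub>R w"]
          by (simp add: L2_norm_def)
        then show "norm (\<integral>x. norm (case (w, x) of (w, x) \<Rightarrow> gaussian w * (f x * cnj (f (x - d *\<^sub>R w)))) \<partial>lborel) \<le> norm (gaussian w * mass f)"
          using gaussian_bounds(1)[of w] by (simp add: norm_mult L2_norm_def abs_mult)
      qed
    qed (use gaussian_integral(1) in auto)
  qed measurable
  have "complex_of_real (\<integral>\<xi>. (norm (fourier f \<xi>))\<^sup>2 * gaussian (d *\<^sub>R \<xi>) \<partial>lborel) = (\<integral>\<xi>. fourier f \<xi> * h \<xi> \<partial>lborel)"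
    unfolding integral_complex_of_real[symmetric] 
    by (intro Bochner_Integration.integral_cong) (simp_all only: h_def Gd_def complex_norm_square of_real_mult mult.assoc)
  also have "\<dots> = (\<integral>x. f x * fourier h x \<partial>lborel)"
    by (rule fourier_multiplication[OF f(2) hi])
  also have "\<dots> = of_real fourier_const * (\<integral>x. (\<integral>w. gaussian w * (f x * cnj (f (x - d *\<^sub>R w))) \<partial>lborel) \<partial>lborel)"
    by (simp add: fh mult_ac flip: integral_mult_right_zero)
  also have "(\<integral>x. (\<integral>w. gaussian w * (f x * cnj (f (x - d *\<^sub>R w))) \<partial>lborel) \<partial>lborel) = 
      (\<integral>w. (\<integral>x. gaussian w * (f x * cnj (f (x - d *\<^sub>R w))) \<partial>lborel) \<partial>lborel)"
    by (rule lborel_pair.Fubini_integral[OF pair])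
  also have "\<dots> = (\<integral>w. gaussian w * L2_inner f (\<lambda>x. f (x - d *\<^sub>R w)) \<partial>lborel)"
    by (simp add: L2_inner_def)
  finally have "Re (complex_of_real (\<integral>\<xi>. (norm (fourier f \<xi>))\<^sup>2 * gaussian (d *\<^sub>R \<xi>) \<partial>lborel)) = Re (of_real fourier_const * (\<integral>w. gaussian w * L2_inner f (\<lambda>x. f (x - d *\<^sub>R w)) \<partial>lborel))"
    by simp
  then show "(\<integral>\<xi>. (norm (fourier f \<xi>))\<^sup>2 * gaussian (d *\<^sub>R \<xi>) \<partial>lborel) = fourier_const * Re (\<integral>w. gaussian w * L2_inner f (\<lambda>x. f (x - d *\<^sub>R w)) \<partial>lborel)"
    by simp
qed

text \<open>Let d tend to 0 in the regularised identity. The right side converges by continuity of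
  translations. On the left, Fatou first gives square integrability of the transform, which is then
  the dominating function that yields equality.\<close>

lemma plancherel_L1:
  assumes f: "f \<in> L2" "integrable lborel f"
  shows "fourier f \<in> L2" "mass (fourier f) = (2 * pi) ^ 3 * mass f"
proof -
  note [measurable] = L2_measurable[OF f(1)]
  define d where "d n = inverse (real (Suc n))" for n
  have d: "d n > 0" for n by (simp add: d_def)
  have d0: "d \<longlonglongrightarrow> 0" unfolding d_def by (rule LIMSEQ_inverse_real_of_nat)
  have ipt: "(\<lambda>n. L2_inner f (\<lambda>x. f (x - d n *\<^sub>R w))) \<longlonglongrightarrow> L2_inner f f" for w
  proof (rule L2_inner_tendsto)
    have "(\<lambda>n. - (d n *\<^sub>R w)) \<longlonglongrightarrow> - (0 *\<^sub>R w)" by (intro tendsto_intros d0)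
    from L2_translate_tendsto[OF f(1) this[simplified]]
    show "(\<lambda>n. L2_norm (\<lambda>x. f (x - d n *\<^sub>R w) - f x)) \<longlonglongrightarrow> 0" by simp
  qed (use f L2_translate[OF f(1), of "- _"] in \<open>auto simp: L2_norm_def mass_def\<close>)
  have "(\<lambda>n. \<integral>w. gaussian w * L2_inner f (\<lambda>x. f (x - d n *\<^sub>R w)) \<partial>lborel) \<longlonglongrightarrow> (\<integral>w. gaussian w * L2_inner f f \<partial>lborel)"
  proof (rule integral_dominated_convergence[where w="\<lambda>w. gaussian w * mass f"])
    show "AE w in lborel. (\<lambda>n. gaussian w * L2_inner f (\<lambda>x. f (x - d n *\<^sub>R w))) \<longlonglongrightarrow> gaussian w * L2_inner f f"
      by (intro AE_I2 tendsto_intros ipt)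
    fix n show "AE w in lborel. norm (gaussian w * L2_inner f (\<lambda>x. f (x - d n *\<^sub>R w))) \<le> gaussian w * mass f"
    proof (rule AE_I2)
      fix w
      have "norm (L2_inner f (\<lambda>x. f (x - d n *\<^sub>R w))) \<le> L2_norm f * L2_norm f"
        using L2_inner_CS[OF f(1) L2_translate[OF f(1)], of "- (d n *\<^sub>R w)"] mass_translate[OF f(1), of "- (d n *\<^sub>R w)"]
        by (simp add: L2_norm_def)
      then show "norm (gaussian w * L2_inner f (\<lambda>x. f (x - d n *\<^sub>R w))) \<le> gaussian w * mass f"
        using gaussian_bounds(1)[of w] by (simp add: norm_mult L2_norm_def)
    qed
    show "(\<lambda>w. gaussian w * L2_inner f (\<lambda>x. f (x - d n *\<^sub>R w))) \<in> borel_measurable lborel"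
      unfolding L2_inner_def by measurable
  qed (use gaussian_integral(1) in auto)
  then have "(\<lambda>n. fourier_const * Re (\<integral>w. gaussian w * L2_inner f (\<lambda>x. f (x - d n *\<^sub>R w)) \<partial>lborel)) \<longlonglongrightarrow> fourier_const * Re (\<integral>w. gaussian w * L2_inner f f \<partial>lborel)"
    by (intro tendsto_intros)
  also have "fourier_const * Re (\<integral>w. gaussian w * L2_inner f f \<partial>lborel) = (2 * pi) ^ 3 * mass f"
    unfolding fourier_const_sq[symmetric] using gaussian_integral(2) by (simp add: L2_inner_self power2_eq_square)
  finally have lim: "(\<lambda>n. \<integral>\<xi>. (norm (fourier f \<xi>))\<^sup>2 * gaussian (d n *\<^sub>R \<xi>) \<partial>lborel) \<longlonglongrightarrow> (2 * pi) ^ 3 * mass f"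
    by (simp add: plancherel_regularized(1)[OF f d])
  have gs1: "(\<lambda>n. gaussian (d n *\<^sub>R \<xi>)) \<longlonglongrightarrow> 1" for \<xi>
  proof -
    have "(\<lambda>n. gaussian (d n *\<^sub>R \<xi>)) \<longlonglongrightarrow> exp (- (norm (0 *\<^sub>R \<xi>))\<^sup>2 / 2)"
      unfolding gaussian_def by (intro tendsto_intros d0) auto
    then show ?thesis by simp
  qed
  \<comment> \<open>The square root of the Gaussian makes \<open>mass (F n)\<close> the regularised
    integral, so that \<open>L2_Fatou\<close> applies.\<close>
  define F where "F n \<xi> = fourier f \<xi> * of_real (sqrt (gaussian (d n *\<^sub>R \<xi>)))" for n \<xi>
  have Fsq: "(norm (F n \<xi>))\<^sup>2 = (norm (fourier f \<xi>))\<^sup>2 * gaussian (d n *\<^sub>R \<xi>)" for n \<xi>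
    using gaussian_bounds(1)[of "d n *\<^sub>R \<xi>"] by (simp add: F_def norm_mult power_mult_distrib)
  have [measurable]: "F n \<in> borel_measurable borel" for n unfolding F_def[abs_def] by measurable
  have FL: "F n \<in> L2" for n
    using plancherel_regularized(2)[OF f d] by (simp add: L2_def Fsq)
  have mF: "mass (F n) = (\<integral>\<xi>. (norm (fourier f \<xi>))\<^sup>2 * gaussian (d n *\<^sub>R \<xi>) \<partial>lborel)" for n
    by (simp add: mass_def Fsq)
  have bound: "\<forall>\<^sub>F n in sequentially. mass (F n) \<le> (2 * pi) ^ 3 * mass f + 1"
    using order_tendstoD(2)[OF lim, of "(2 * pi) ^ 3 * mass f + 1"] by (auto simp: mF elim: eventually_mono)
  have "AE \<xi> in lborel. (\<lambda>n. F n \<xi>) \<longlonglongrightarrow> fourier f \<xi>"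
  proof (rule AE_I2)
    fix \<xi>
    have "(\<lambda>n. F n \<xi>) \<longlonglongrightarrow> fourier f \<xi> * of_real (sqrt 1)"
      unfolding F_def by (intro tendsto_intros gs1)
    then show "(\<lambda>n. F n \<xi>) \<longlonglongrightarrow> fourier f \<xi>" by simp
  qed
  from L2_Fatou(1)[OF FL bound _ this] show L: "fourier f \<in> L2" by simp
  have "(\<lambda>n. \<integral>\<xi>. (norm (fourier f \<xi>))\<^sup>2 * gaussian (d n *\<^sub>R \<xi>) \<partial>lborel) \<longlonglongrightarrow> (\<integral>\<xi>. (norm (fourier f \<xi>))\<^sup>2 * 1 \<partial>lborel)"
  proof (rule integral_dominated_convergence[where w="\<lambda>\<xi>. (norm (fourier f \<xi>))\<^sup>2"])
    show "AE \<xi> in lborel. (\<lambda>n. (norm (fourier f \<xi>))\<^sup>2 * gaussian (d n *\<^sub>R \<xi>)) \<longlonglongrightarrow> (norm (fourier f \<xi>))\<^sup>2 * 1"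
      by (intro AE_I2 tendsto_intros gs1)
    fix n show "AE \<xi> in lborel. norm ((norm (fourier f \<xi>))\<^sup>2 * gaussian (d n *\<^sub>R \<xi>)) \<le> (norm (fourier f \<xi>))\<^sup>2"
      using gaussian_bounds by (intro AE_I2) (simp add: abs_mult mult_left_le less_imp_le)
  qed (use L in \<open>auto simp: L2_def\<close>)
  then show "mass (fourier f) = (2 * pi) ^ 3 * mass f"
    using LIMSEQ_unique[OF lim] by (simp add: mass_def)
qed

subsection \<open>The Fourier transform on $L^2$\<close>

definition trunc :: "(real^3 \<Rightarrow> complex) \<Rightarrow> nat \<Rightarrow> real^3 \<Rightarrow> complex" where
  "trunc f n x = indicator (cball 0 (real n)) x * f x"

lemma tendsto_0_le:
  fixes a b :: "nat \<Rightarrow> real"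
  assumes "\<And>n. 0 \<le> a n" "\<And>n. a n \<le> b n" "b \<longlonglongrightarrow> 0"
  shows "a \<longlonglongrightarrow> 0"
  by (rule tendsto_sandwich[OF _ _ tendsto_const assms(3)]) (simp_all add: assms)

lemma fourier_const_neq0 [simp]: "fourier_const \<noteq> 0" using fourier_const_pos by simp

lemma L2_norm_ofmass: "mass f = c\<^sup>2 * mass g \<Longrightarrow> 0 \<le> c \<Longrightarrow> L2_norm f = c * L2_norm g"
  by (simp add: L2_norm_def real_sqrt_mult)

lemma fourier_L2:
  assumes "f \<in> L2" "integrable lborel f" 
  shows "fourier f \<in> L2" "L2_norm (fourier f) = fourier_const * L2_norm f"
  using plancherel_L1[OF assms] fourier_const_pos by (auto intro!: L2_norm_ofmass simp: fourier_const_sq)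

lemma fourier_diff:
  assumes "integrable lborel f" "integrable lborel g"
  shows "fourier (\<lambda>x. f x - g x) \<xi> = fourier f \<xi> - fourier g \<xi>"
  using fourier_integrable[OF assms(1)] fourier_integrable[OF assms(2)]
  by (simp add: fourier_def right_diff_distrib)

lemma fourier_add:
  assumes "integrable lborel f" "integrable lborel g"
  shows "fourier (\<lambda>x. f x + g x) \<xi> = fourier f \<xi> + fourier g \<xi>"
  using fourier_integrable[OF assms(1)] fourier_integrable[OF assms(2)]
  by (simp add: fourier_def distrib_left)

lemma fourier_cmult: "fourier (\<lambda>x. c * f x) \<xi> = c * fourier f \<xi>"
  by (simp add: fourier_def mult.left_commute)

lemma L2_norm_fourier_diff:
  assumes "f \<in> L2" "integrable lborel f" "g \<in> L2" "integrable lborel g"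
  shows "L2_norm (\<lambda>\<xi>. fourier f \<xi> - fourier g \<xi>) = fourier_const * L2_norm (\<lambda>x. f x - g x)"
proof -
  have "fourier (\<lambda>x. f x - g x) = (\<lambda>\<xi>. fourier f \<xi> - fourier g \<xi>)"
    by (rule ext) (rule fourier_diff[OF assms(2,4)])
  then show ?thesis
    using fourier_L2(2)[OF L2_diff[OF assms(1,3)]] assms by simp
qed

lemma trunc_props:
  assumes f: "f \<in> L2"
  shows "trunc f n \<in> L2" "integrable lborel (trunc f n)"
    and "(\<lambda>n. L2_norm (\<lambda>x. trunc f n x - f x)) \<longlonglongrightarrow> 0"
proof -
  note [measurable] = L2_measurable[OF f]
  have ind: "(\<lambda>x. indicator (cball 0 (real n)) x :: complex) \<in> L2"
  proof -
    have "integrable lborel (\<lambda>x. indicator (cball 0 (real n)) x :: real)"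
      by (intro integrable_real_indicator) (use emeasure_lborel_cball_finite[of 0 "real n"] in auto)
    moreover have "(norm (indicator (cball 0 (real n)) x :: complex))\<^sup>2 = indicator (cball 0 (real n)) x" for x :: "real^3"
      by (simp add: indicator_def)
    ultimately show ?thesis by (auto simp: L2_iff intro!: borel_measurable_indicator)
  qed
  show tL: "trunc f n \<in> L2" for n
    unfolding trunc_def[abs_def] by (rule L2_bounded_mult(1)[where C=1, OF _ _ f]) (auto simp: indicator_def)
  show "integrable lborel (trunc f n)"
    unfolding trunc_def[abs_def] by (rule L2_prod_integrable(1)[OF ind f])
  have "(\<lambda>n. mass (\<lambda>x. trunc f n x - f x)) \<longlonglongrightarrow> (\<integral>x. 0 \<partial>(lborel :: (real^3) measure))"
    unfolding mass_def
  proof (rule integral_dominated_convergence[where w="\<lambda>x. (norm (f x))\<^sup>2"])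
    show "AE x in lborel. (\<lambda>n. (norm (trunc f n x - f x))\<^sup>2) \<longlonglongrightarrow> 0"
    proof (rule AE_I2, rule tendsto_eventually)
      fix x :: "real^3"
      obtain N where "norm x \<le> real N" using real_arch_simple by blast
      then have *: "trunc f n x = f x" if "n \<ge> N" for n
        using that order_trans[of "norm x" "real N" "real n"] by (simp add: trunc_def indicator_def)
      show "\<forall>\<^sub>F n in sequentially. (norm (trunc f n x - f x))\<^sup>2 = 0"
        using eventually_ge_at_top[of N] by (rule eventually_mono) (simp add: *)
    qed
    show "AE x in lborel. norm ((norm (trunc f n x - f x))\<^sup>2) \<le> (norm (f x))\<^sup>2" for n
      by (rule AE_I2) (simp add: trunc_def indicator_def)
    note [measurable] = L2_measurable[OF tL]
    show "(\<lambda>x. (norm (trunc f n x - f x))\<^sup>2) \<in> borel_measurable lborel" for n by measurable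
  qed (use f in \<open>auto simp: L2_def\<close>)
  then show "(\<lambda>n. L2_norm (\<lambda>x. trunc f n x - f x)) \<longlonglongrightarrow> 0"
    unfolding L2_norm_def using tendsto_real_sqrt by fastforce
qed

text \<open>For \<open>f\<close> and \<open>F\<close> in \<open>L2\<close> the extended integral is
  finite and equals the Bochner integral behind \<open>L2_norm\<close>; from here on only norms are
  handled.\<close>

lemma has_L2_fourier_iff:
  "has_L2_fourier f F \<longleftrightarrow> f \<in> L2 \<and> F \<in> L2 \<and> (\<lambda>n. L2_norm (\<lambda>\<xi>. fourier (trunc f n) \<xi> - F \<xi>)) \<longlonglongrightarrow> 0"
proof -
  have "((\<lambda>n. \<integral>\<^sup>+\<xi>. ennreal ((norm (fourier (\<lambda>x. indicator (cball 0 (real n)) x * f x) \<xi> - F \<xi>))\<^sup>2) \<partial>lborel) \<longlonglongrightarrow> 0)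
     \<longleftrightarrow> (\<lambda>n. L2_norm (\<lambda>\<xi>. fourier (trunc f n) \<xi> - F \<xi>)) \<longlonglongrightarrow> 0" if f: "f \<in> L2" and F: "F \<in> L2"
  proof -
    have "(\<integral>\<^sup>+\<xi>. ennreal ((norm (fourier (\<lambda>x. indicator (cball 0 (real n)) x * f x) \<xi> - F \<xi>))\<^sup>2) \<partial>lborel)
      = ennreal (mass (\<lambda>\<xi>. fourier (trunc f n) \<xi> - F \<xi>))" for n
      using L2_diff[OF fourier_L2(1)[OF trunc_props(1,2)[OF f]] F, of n]
      unfolding mass_def trunc_def[abs_def] by (intro nn_integral_eq_integral) (auto simp: L2_def)
    then have "((\<lambda>n. \<integral>\<^sup>+\<xi>. ennreal ((norm (fourier (\<lambda>x. indicator (cball 0 (real n)) x * f x) \<xi> - F \<xi>))\<^sup>2) \<partial>lborel) \<longlonglongrightarrow> 0)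
      \<longleftrightarrow> (\<lambda>n. mass (\<lambda>\<xi>. fourier (trunc f n) \<xi> - F \<xi>)) \<longlonglongrightarrow> 0"
      using tendsto_ennreal_iff[where f="\<lambda>n. mass (\<lambda>\<xi>. fourier (trunc f n) \<xi> - F \<xi>)" and x=0 and F=sequentially] by simp
    also have "\<dots> \<longleftrightarrow> (\<lambda>n. L2_norm (\<lambda>\<xi>. fourier (trunc f n) \<xi> - F \<xi>)) \<longlonglongrightarrow> 0"
    proof
      assume "(\<lambda>n. mass (\<lambda>\<xi>. fourier (trunc f n) \<xi> - F \<xi>)) \<longlonglongrightarrow> 0"
      from tendsto_real_sqrt[OF this] show "(\<lambda>n. L2_norm (\<lambda>\<xi>. fourier (trunc f n) \<xi> - F \<xi>)) \<longlonglongrightarrow> 0"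
        by (simp add: L2_norm_def)
    next
      assume "(\<lambda>n. L2_norm (\<lambda>\<xi>. fourier (trunc f n) \<xi> - F \<xi>)) \<longlonglongrightarrow> 0"
      from tendsto_power[OF this, of 2] show "(\<lambda>n. mass (\<lambda>\<xi>. fourier (trunc f n) \<xi> - F \<xi>)) \<longlonglongrightarrow> 0"
        by (simp add: L2_norm_sq)
    qed
    finally show ?thesis .
  qed
  then show ?thesis unfolding has_L2_fourier_def by blast
qed

lemma has_L2_fourierD: 
  assumes "has_L2_fourier f F" 
  shows "f \<in> L2" "F \<in> L2" "f \<in> borel_measurable borel" "F \<in> borel_measurable borel"
  using assms by (auto simp: has_L2_fourier_def L2_measurable)

text \<open>The isometry on integrable functions makes the limit independent of the approximating
  sequence. Sequences adapted to sums, multiples and translates may thus replace the truncations of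
  the definition.\<close>

lemma fourier_approx_indep:
  assumes g: "\<And>n. g n \<in> L2" "\<And>n. integrable lborel (g n)" and h: "\<And>n. h n \<in> L2" "\<And>n. integrable lborel (h n)"
    and f: "f \<in> L2" and F: "F \<in> L2"
    and gf: "(\<lambda>n. L2_norm (\<lambda>x. g n x - f x)) \<longlonglongrightarrow> 0" and hf: "(\<lambda>n. L2_norm (\<lambda>x. h n x - f x)) \<longlonglongrightarrow> 0"
    and gF: "(\<lambda>n. L2_norm (\<lambda>\<xi>. fourier (g n) \<xi> - F \<xi>)) \<longlonglongrightarrow> 0"
  shows "(\<lambda>n. L2_norm (\<lambda>\<xi>. fourier (h n) \<xi> - F \<xi>)) \<longlonglongrightarrow> 0"
proof -
  have "L2_norm (\<lambda>\<xi>. fourier (h n) \<xi> - F \<xi>) \<le> fourier_const * (L2_norm (\<lambda>x. h n x - f x) + L2_norm (\<lambda>x. g n x - f x)) + L2_norm (\<lambda>\<xi>. fourier (g n) \<xi> - F \<xi>)" for n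
  proof -
    have "L2_norm (\<lambda>\<xi>. fourier (h n) \<xi> - F \<xi>) \<le> L2_norm (\<lambda>\<xi>. fourier (h n) \<xi> - fourier (g n) \<xi>) + L2_norm (\<lambda>\<xi>. fourier (g n) \<xi> - F \<xi>)"
      by (intro L2_norm_diff_triangle fourier_L2 g h F)
    also have "L2_norm (\<lambda>\<xi>. fourier (h n) \<xi> - fourier (g n) \<xi>) = fourier_const * L2_norm (\<lambda>x. h n x - g n x)"
      by (intro L2_norm_fourier_diff g h)
    also have "L2_norm (\<lambda>x. h n x - g n x) \<le> L2_norm (\<lambda>x. h n x - f x) + L2_norm (\<lambda>x. g n x - f x)"
      using L2_norm_diff_triangle[OF h(1) f g(1), of n n] L2_norm_diff_commute[of f "g n"] by simp
    finally show ?thesis using fourier_const_pos by (simp add: mult_left_mono)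
  qed
  moreover have "(\<lambda>n. fourier_const * (L2_norm (\<lambda>x. h n x - f x) + L2_norm (\<lambda>x. g n x - f x)) + L2_norm (\<lambda>\<xi>. fourier (g n) \<xi> - F \<xi>)) \<longlonglongrightarrow> fourier_const * (0 + 0) + 0"
    by (intro tendsto_intros gf hf gF)
  ultimately show ?thesis
    by (intro tendsto_0_le[OF L2_norm_nonneg]) simp_all
qed

lemma has_L2_fourierI:
  assumes g: "\<And>n. g n \<in> L2" "\<And>n. integrable lborel (g n)" and f: "f \<in> L2" and F: "F \<in> L2"
    and gf: "(\<lambda>n. L2_norm (\<lambda>x. g n x - f x)) \<longlonglongrightarrow> 0" and gF: "(\<lambda>n. L2_norm (\<lambda>\<xi>. fourier (g n) \<xi> - F \<xi>)) \<longlonglongrightarrow> 0"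
  shows "has_L2_fourier f F"
  unfolding has_L2_fourier_iff
  using fourier_approx_indep[OF g trunc_props(1,2)[OF f] f F gf trunc_props(3)[OF f] gF] f F by auto

lemma has_L2_fourier_integrable:
  assumes "f \<in> L2" "integrable lborel f" shows "has_L2_fourier f (fourier f)"
  by (rule has_L2_fourierI[of "\<lambda>_. f"]) (use assms fourier_L2(1)[OF assms] in \<open>auto simp: L2_norm_def mass_def\<close>)

lemma has_L2_fourier_exists:
  assumes f: "f \<in> L2" obtains F where "has_L2_fourier f F"
proof -
  note t = trunc_props[OF f]
  have "\<exists>N. \<forall>m\<ge>N. \<forall>n\<ge>N. L2_norm (\<lambda>\<xi>. fourier (trunc f m) \<xi> - fourier (trunc f n) \<xi>) < e" if "e > 0" for e
  proof -
    have "e / (2 * fourier_const) > 0" using that fourier_const_pos by simp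
    from LIMSEQ_D[OF t(3) this] obtain N where N: "\<And>n. n \<ge> N \<Longrightarrow> L2_norm (\<lambda>x. trunc f n x - f x) < e / (2 * fourier_const)"
      by auto
    show ?thesis
    proof (intro exI allI impI)
      fix m n assume "m \<ge> N" "n \<ge> N"
      have "L2_norm (\<lambda>x. trunc f m x - trunc f n x) \<le> L2_norm (\<lambda>x. trunc f m x - f x) + L2_norm (\<lambda>x. trunc f n x - f x)"
        using L2_norm_diff_triangle[OF t(1) f t(1), of m n] L2_norm_diff_commute[of f "trunc f n"] by simp
      also have "\<dots> < e / (2 * fourier_const) + e / (2 * fourier_const)" using N \<open>m \<ge> N\<close> \<open>n \<ge> N\<close> by (intro add_strict_mono) auto
      finally have "fourier_const * L2_norm (\<lambda>x. trunc f m x - trunc f n x) < e"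
        using fourier_const_pos by (simp add: field_simps)
      then show "L2_norm (\<lambda>\<xi>. fourier (trunc f m) \<xi> - fourier (trunc f n) \<xi>) < e"
        by (simp add: L2_norm_fourier_diff t)
    qed
  qed
  from L2_complete[OF fourier_L2(1)[OF t(1,2)] this]
  obtain F where "F \<in> L2" "(\<lambda>n. L2_norm (\<lambda>\<xi>. fourier (trunc f n) \<xi> - F \<xi>)) \<longlonglongrightarrow> 0" by blast
  with f that show ?thesis by (auto simp: has_L2_fourier_iff)
qed

lemma has_L2_fourier_add:
  assumes f: "has_L2_fourier f F" and g: "has_L2_fourier g G"
  shows "has_L2_fourier (\<lambda>x. f x + g x) (\<lambda>\<xi>. F \<xi> + G \<xi>)"
proof -
  note L = has_L2_fourierD(1,2)[OF f] has_L2_fourierD(1,2)[OF g]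
  note t = trunc_props[OF L(1)] trunc_props[OF L(3)]
  have z: "(\<lambda>n. a n) \<longlonglongrightarrow> 0" if "\<And>n. 0 \<le> a n" "\<And>n. a n \<le> b n + c n" "b \<longlonglongrightarrow> 0" "c \<longlonglongrightarrow> 0" for a b c :: "nat \<Rightarrow> real"
    using tendsto_0_le[OF that(1,2)] tendsto_add[OF that(3,4)] by simp
  have d: "L2_norm (\<lambda>x. a x + b x - (a' x + b' x)) \<le> L2_norm (\<lambda>x. a x - a' x) + L2_norm (\<lambda>x. b x - b' x)" 
    if "a \<in> L2" "b \<in> L2" "a' \<in> L2" "b' \<in> L2" for a b a' b'
    using L2_norm_triangle[OF L2_diff[OF that(1,3)] L2_diff[OF that(2,4)]] by (simp add: algebra_simps)
  show ?thesis
  proof (rule has_L2_fourierI[of "\<lambda>n x. trunc f n x + trunc g n x"])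
    show "(\<lambda>n. L2_norm (\<lambda>x. trunc f n x + trunc g n x - (f x + g x))) \<longlonglongrightarrow> 0"
      by (rule z[OF _ d t(3) t(6)]) (use L t in auto)
    show "(\<lambda>n. L2_norm (\<lambda>\<xi>. fourier (\<lambda>x. trunc f n x + trunc g n x) \<xi> - (F \<xi> + G \<xi>))) \<longlonglongrightarrow> 0"
      unfolding fourier_add[OF t(2) t(5)]
      by (rule z[OF _ d]) (use L t f g fourier_L2 in \<open>auto simp: has_L2_fourier_iff\<close>)
  qed (use L t L2_add in auto)
qed

lemma has_L2_fourier_cmult:
  assumes f: "has_L2_fourier f F"
  shows "has_L2_fourier (\<lambda>x. c * f x) (\<lambda>\<xi>. c * F \<xi>)"
proof -
  note L = has_L2_fourierD(1,2)[OF f] and t = trunc_props[OF has_L2_fourierD(1)[OF f]]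
  show ?thesis
  proof (rule has_L2_fourierI[of "\<lambda>n x. c * trunc f n x"])
    show "(\<lambda>n. L2_norm (\<lambda>x. c * trunc f n x - c * f x)) \<longlonglongrightarrow> 0"
      unfolding right_diff_distrib[symmetric] L2_norm_cmult by (intro tendsto_mult_right_zero t)
    show "(\<lambda>n. L2_norm (\<lambda>\<xi>. fourier (\<lambda>x. c * trunc f n x) \<xi> - c * F \<xi>)) \<longlonglongrightarrow> 0"
      unfolding fourier_cmult right_diff_distrib[symmetric] L2_norm_cmult 
      using f by (intro tendsto_mult_right_zero) (auto simp: has_L2_fourier_iff)
  qed (use L t L2_cmult in auto)
qed

lemma has_L2_fourier_diff:
  assumes "has_L2_fourier f F" "has_L2_fourier g G"
  shows "has_L2_fourier (\<lambda>x. f x - g x) (\<lambda>\<xi>. F \<xi> - G \<xi>)"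
  using has_L2_fourier_add[OF assms(1) has_L2_fourier_cmult[OF assms(2), of "-1"]] by simp

lemma has_L2_fourier_translate:
  assumes f: "has_L2_fourier f F"
  shows "has_L2_fourier (\<lambda>x. f (x + a)) (\<lambda>\<xi>. cis (a \<bullet> \<xi>) * F \<xi>)"
proof -
  note L = has_L2_fourierD[OF f] and t = trunc_props[OF has_L2_fourierD(1)[OF f]]
  have tm: "trunc f n \<in> borel_measurable borel" for n by (rule L2_measurable[OF t(1)])
  have [measurable]: "F \<in> borel_measurable borel" by (rule L(4))
  have ft: "fourier (\<lambda>x. trunc f n (x + a)) \<xi> = cis (a \<bullet> \<xi>) * fourier (trunc f n) \<xi>" for n \<xi>
  proof -
    have "fourier (\<lambda>x. trunc f n (x + a)) \<xi> = (\<integral>x. cis (- ((x + a) \<bullet> \<xi>) + a \<bullet> \<xi>) * trunc f n (x + a) \<partial>lborel)"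
      unfolding fourier_def by (simp add: inner_add_left)
    also have "\<dots> = (\<integral>x. cis (- (x \<bullet> \<xi>) + a \<bullet> \<xi>) * trunc f n x \<partial>lborel)"
      by (rule integral_translate(1)) (use tm in measurable)
    finally show ?thesis unfolding fourier_def cis_mult[symmetric]
      by (simp add: mult_ac)
  qed
  have n2c: "L2_norm (\<lambda>\<xi>. cis (a \<bullet> \<xi>) * G \<xi> - cis (a \<bullet> \<xi>) * F \<xi>) = L2_norm (\<lambda>\<xi>. G \<xi> - F \<xi>)" for G
    by (simp add: L2_norm_def mass_def norm_mult flip: right_diff_distrib)
  show ?thesis
  proof (rule has_L2_fourierI[of "\<lambda>n x. trunc f n (x + a)"])
    have "L2_norm (\<lambda>x. trunc f n (x + a) - f (x + a)) = L2_norm (\<lambda>x. trunc f n x - f x)" for n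
      using mass_translate[OF L2_diff[OF t(1) L(1)]] by (simp add: L2_norm_def)
    then show "(\<lambda>n. L2_norm (\<lambda>x. trunc f n (x + a) - f (x + a))) \<longlonglongrightarrow> 0" using t(3) by simp
    show "(\<lambda>n. L2_norm (\<lambda>\<xi>. fourier (\<lambda>x. trunc f n (x + a)) \<xi> - cis (a \<bullet> \<xi>) * F \<xi>)) \<longlonglongrightarrow> 0"
      unfolding ft n2c using f by (simp add: has_L2_fourier_iff)
    show "(\<lambda>\<xi>. cis (a \<bullet> \<xi>) * F \<xi>) \<in> L2"
      by (rule L2_bounded_mult(1)[where C=1]) (use L in auto)
    show "(\<lambda>x. trunc f n (x + a)) \<in> L2" for n by (rule L2_translate[OF t(1)])
    show "integrable lborel (\<lambda>x. trunc f n (x + a))" for n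
      using integral_translate(2)[OF tm] t(2) by blast
    show "(\<lambda>x. f (x + a)) \<in> L2" by (rule L2_translate[OF L(1)])
  qed
qed

lemma has_L2_fourier_modulate:
  assumes f: "has_L2_fourier f F"
  shows "has_L2_fourier (\<lambda>x. cis (x \<bullet> a) * f x) (\<lambda>\<xi>. F (\<xi> - a))"
proof -
  note L = has_L2_fourierD[OF f] and t = trunc_props[OF has_L2_fourierD(1)[OF f]]
  have [measurable]: "f \<in> borel_measurable borel" by (rule L(3))
  have tr: "trunc (\<lambda>x. cis (x \<bullet> a) * f x) n = (\<lambda>x. cis (- (x \<bullet> - a)) * trunc f n x)" for n
    by (auto simp: trunc_def)
  have "L2_norm (\<lambda>\<xi>. fourier (trunc (\<lambda>x. cis (x \<bullet> a) * f x) n) \<xi> - F (\<xi> - a)) = L2_norm (\<lambda>\<xi>. fourier (trunc f n) \<xi> - F \<xi>)" for n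
    unfolding tr fourier_modulated
    using mass_translate[OF L2_diff[OF fourier_L2(1)[OF t(1,2)] L(2)], of n "- a"] by (simp add: L2_norm_def)
  moreover have "(\<lambda>x. cis (x \<bullet> a) * f x) \<in> L2"
    by (rule L2_bounded_mult(1)[where C=1]) (use L in auto)
  moreover have "(\<lambda>\<xi>. F (\<xi> - a)) \<in> L2" using L2_translate[OF L(2), of "- a"] by simp
  ultimately show ?thesis using f by (simp add: has_L2_fourier_iff)
qed

lemma has_L2_fourier_cnj_reflect:
  assumes f: "has_L2_fourier f F"
  shows "has_L2_fourier (\<lambda>x. cnj (f (- x))) (\<lambda>\<xi>. cnj (F \<xi>))"
proof -
  note L = has_L2_fourierD[OF f] and t = trunc_props[OF has_L2_fourierD(1)[OF f]]
  have [measurable]: "f \<in> borel_measurable borel" by (rule L(3))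
  have tm[measurable]: "trunc f n \<in> borel_measurable borel" for n by (rule L2_measurable[OF t(1)])
  have tr: "trunc (\<lambda>x. cnj (f (- x))) n = (\<lambda>x. cnj (trunc f n (- x)))" for n
    by (auto simp: trunc_def indicator_def)
  have ft: "fourier (\<lambda>x. cnj (trunc f n (- x))) \<xi> = cnj (fourier (trunc f n) \<xi>)" for n \<xi>
  proof -
    have "fourier (\<lambda>x. cnj (trunc f n (- x))) \<xi> = (\<integral>x. cis (- (- x \<bullet> \<xi>)) * cnj (trunc f n x) \<partial>lborel)"
      unfolding fourier_def by (subst integral_reflect(1)[symmetric]) auto
    then show ?thesis by (simp add: fourier_def cis_cnj flip: Bochner_Integration.integral_cnj)
  qed
  have "L2_norm (\<lambda>\<xi>. fourier (trunc (\<lambda>x. cnj (f (- x))) n) \<xi> - cnj (F \<xi>)) = L2_norm (\<lambda>\<xi>. fourier (trunc f n) \<xi> - F \<xi>)" for n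
    unfolding tr ft by (simp add: L2_norm_def flip: complex_cnj_diff)
  then show ?thesis using f L2_cnj[OF L2_reflect[OF L(1)]] L2_cnj[OF L(2)] by (simp add: has_L2_fourier_iff)
qed

lemma has_L2_fourier_mass:
  assumes f: "has_L2_fourier f F"
  shows "mass F = fourier_const\<^sup>2 * mass f" 
proof -
  note L = has_L2_fourierD[OF f] and t = trunc_props[OF has_L2_fourierD(1)[OF f]]
  have "(\<lambda>n. mass (fourier (trunc f n))) \<longlonglongrightarrow> mass F"
    using f by (intro L2_norm_tendsto(2) fourier_L2 t L) (simp add: has_L2_fourier_iff)
  moreover have "(\<lambda>n. fourier_const\<^sup>2 * mass (trunc f n)) \<longlonglongrightarrow> fourier_const\<^sup>2 * mass f"
    by (intro tendsto_mult tendsto_const L2_norm_tendsto(2) t L)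
  moreover have "mass (fourier (trunc f n)) = fourier_const\<^sup>2 * mass (trunc f n)" for n
    unfolding fourier_const_sq by (rule plancherel_L1(2)[OF t(1,2)])
  ultimately show ?thesis by (simp only:) (rule LIMSEQ_unique)
qed

lemma has_L2_fourier_L2_norm: "has_L2_fourier f F \<Longrightarrow> L2_norm F = fourier_const * L2_norm f"
  using has_L2_fourier_mass fourier_const_pos by (intro L2_norm_ofmass) auto

text \<open>Polarisation: the mass of f + g gives the real part, and replacing g by i g turns the
  imaginary part into a real one.\<close>

lemma has_L2_fourier_L2_inner:
  assumes f: "has_L2_fourier f F" and g: "has_L2_fourier g G"
  shows "L2_inner F G = fourier_const\<^sup>2 * L2_inner f g"
proof -
  have re: "Re (L2_inner F G) = fourier_const\<^sup>2 * Re (L2_inner f g)" if f: "has_L2_fourier f F" and g: "has_L2_fourier g G" for f F g G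
    using has_L2_fourier_mass[OF has_L2_fourier_add[OF f g]] has_L2_fourier_mass[OF f] has_L2_fourier_mass[OF g]
      mass_add[OF has_L2_fourierD(1)[OF f] has_L2_fourierD(1)[OF g]] mass_add[OF has_L2_fourierD(2)[OF f] has_L2_fourierD(2)[OF g]]
    by (simp add: algebra_simps)
  have "Im (L2_inner F G) = fourier_const\<^sup>2 * Im (L2_inner f g)"
    using re[OF f has_L2_fourier_cmult[OF g, of "\<i>"]] by (simp add: L2_inner_cmult_right)
  with re[OF f g] show ?thesis by (simp add: complex_eq_iff)
qed

lemma has_L2_fourier_unique:
  assumes "has_L2_fourier f F" "has_L2_fourier f G" shows "AE \<xi> in lborel. F \<xi> = G \<xi>"
proof -
  have h: "has_L2_fourier (\<lambda>x. f x - f x) (\<lambda>\<xi>. F \<xi> - G \<xi>)" by (rule has_L2_fourier_diff[OF assms])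
  have "mass (\<lambda>\<xi>. F \<xi> - G \<xi>) = 0" using has_L2_fourier_mass[OF h] by (simp add: mass_def)
  then have "AE \<xi> in lborel. F \<xi> - G \<xi> = 0"
    using mass_eq_0_iff has_L2_fourierD(2)[OF h] by blast
  then show ?thesis by simp
qed

lemma has_L2_fourier_AE_cong:
  assumes h: "has_L2_fourier f F" and f': "f' \<in> borel_measurable borel" "AE x in lborel. f x = f' x"
    and F': "F' \<in> borel_measurable borel" "AE x in lborel. F x = F' x"
  shows "has_L2_fourier f' F'"
proof -
  note L = has_L2_fourierD[OF h] and t = trunc_props[OF has_L2_fourierD(1)[OF h]]
  have L': "f' \<in> L2" "F' \<in> L2" using L2_AE_cong L f' F' by auto
  note [measurable] = L(3,4) f'(1) F'(1) L2_measurable[OF t(1)]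
  have [measurable]: "fourier (trunc f n) \<in> borel_measurable borel" for n by measurable
  have "(\<lambda>n. L2_norm (\<lambda>x. trunc f n x - f' x)) \<longlonglongrightarrow> 0"
  proof -
    have "L2_norm (\<lambda>x. trunc f n x - f' x) = L2_norm (\<lambda>x. trunc f n x - f x)" for n
      unfolding L2_norm_def using f' by (intro arg_cong[where f=sqrt] mass_AE_cong) (auto elim: eventually_mono)
    then show ?thesis using t(3) by simp
  qed
  moreover have "(\<lambda>n. L2_norm (\<lambda>x. fourier (trunc f n) x - F' x)) \<longlonglongrightarrow> 0"
  proof -
    have "L2_norm (\<lambda>x. fourier (trunc f n) x - F' x) = L2_norm (\<lambda>x. fourier (trunc f n) x - F x)" for n
      unfolding L2_norm_def using F' by (intro arg_cong[where f=sqrt] mass_AE_cong) (auto elim: eventually_mono)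
    then show ?thesis using h by (simp add: has_L2_fourier_iff)
  qed
  ultimately show ?thesis
    by (intro has_L2_fourierI[of "trunc f"] t L')
qed

lemma has_L2_fourier_multiplication:
  assumes f: "has_L2_fourier f F" and g: "has_L2_fourier g G"
  shows "(\<integral>\<xi>. F \<xi> * g \<xi> \<partial>lborel) = (\<integral>x. f x * G x \<partial>lborel)"
proof -
  note L = has_L2_fourierD(1,2)[OF f] has_L2_fourierD(1,2)[OF g]
  note t = trunc_props[OF L(1)] trunc_props[OF L(3)]
  have c: "L2_norm (\<lambda>x. cnj (a x) - cnj (b x)) = L2_norm (\<lambda>x. a x - b x)" for a b
    by (simp add: L2_norm_def flip: complex_cnj_diff)
  have "(\<lambda>n. L2_inner (fourier (trunc f n)) (\<lambda>x. cnj (trunc g n x))) \<longlonglongrightarrow> L2_inner F (\<lambda>x. cnj (g x))"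
    using f by (intro L2_inner_tendsto fourier_L2 L2_cnj t L) (auto simp: c t has_L2_fourier_iff)
  moreover have "(\<lambda>n. L2_inner (trunc f n) (\<lambda>x. cnj (fourier (trunc g n) x))) \<longlonglongrightarrow> L2_inner f (\<lambda>x. cnj (G x))"
    using g by (intro L2_inner_tendsto fourier_L2 L2_cnj t L) (auto simp: c t has_L2_fourier_iff)
  moreover have "L2_inner (fourier (trunc f n)) (\<lambda>x. cnj (trunc g n x)) = L2_inner (trunc f n) (\<lambda>x. cnj (fourier (trunc g n) x))" for n
    using fourier_multiplication[OF t(2) t(5)] by (simp add: L2_inner_def)
  ultimately have "L2_inner F (\<lambda>x. cnj (g x)) = L2_inner f (\<lambda>x. cnj (G x))" using LIMSEQ_unique by auto
  then show ?thesis by (simp add: L2_inner_def)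
qed

text \<open>Inversion without an inversion integral: expand the squared norm of the difference of
  the two sides. Plancherel gives both norms, the multiplication formula gives the cross term, and
  everything cancels.\<close>

lemma has_L2_fourier_twice:
  assumes F: "has_L2_fourier F G"
  shows "has_L2_fourier G (\<lambda>x. of_real (fourier_const\<^sup>2) * F (- x))"
proof -
  note L = has_L2_fourierD[OF F]
  obtain H where H: "has_L2_fourier G H" using has_L2_fourier_exists[OF L(2)] .
  note LH = has_L2_fourierD[OF H]
  have RF: "(\<lambda>x. F (- x)) \<in> L2" by (rule L2_reflect[OF L(1)])
  have mG: "mass G = fourier_const\<^sup>2 * mass F" by (rule has_L2_fourier_mass[OF F])
  have mH: "mass H = fourier_const\<^sup>2 * mass G" by (rule has_L2_fourier_mass[OF H])
  have "L2_inner H (\<lambda>x. F (- x)) = L2_inner G G"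
    using has_L2_fourier_multiplication[OF H has_L2_fourier_cnj_reflect[OF F]] by (simp add: L2_inner_def)
  then have ipH: "L2_inner H (\<lambda>x. F (- x)) = of_real (mass G)" by (simp add: L2_inner_self)
  have K: "(\<lambda>x. - of_real (fourier_const\<^sup>2) * F (- x)) \<in> L2" by (rule L2_cmult[OF RF])
  have "mass (\<lambda>x. H x + - of_real (fourier_const\<^sup>2) * F (- x)) = 0"
    using mass_add[OF LH(2) K] unfolding mass_cmult L2_inner_cmult_right mass_reflect[OF L(1)] ipH mH mG
    by (simp add: power2_eq_square norm_mult)
  then have "AE x in lborel. H x + - of_real (fourier_const\<^sup>2) * F (- x) = 0"
    using mass_eq_0_iff[OF L2_add[OF LH(2) K]] by simp
  then have ae: "AE x in lborel. H x = of_real (fourier_const\<^sup>2) * F (- x)" by (rule eventually_mono) simp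
  show ?thesis
    by (rule has_L2_fourier_AE_cong[OF H LH(3) _ _ ae]) (use L2_measurable[OF L2_cmult[OF RF]] in auto)
qed

lemma has_L2_fourier_surj:
  assumes F: "F \<in> L2" obtains g where "has_L2_fourier g F"
proof -
  have "(\<lambda>x. of_real (1 / fourier_const\<^sup>2) * F (- x)) \<in> L2" by (rule L2_cmult[OF L2_reflect[OF F]])
  from has_L2_fourier_exists[OF this] obtain G where "has_L2_fourier (\<lambda>x. of_real (1 / fourier_const\<^sup>2) * F (- x)) G" .
  from has_L2_fourier_twice[OF this] have "has_L2_fourier G F" by simp
  then show ?thesis by (rule that)
qed

subsection \<open>Test functions and weak gradients\<close>

text \<open>A family closed under differentiation and containing the standard bump
  (\<open>p = 1\<close>, \<open>k = 0\<close>), so smoothness needs the behaviour at the endpoints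
  only once.\<close>

definition bump :: "real poly \<Rightarrow> nat \<Rightarrow> real \<Rightarrow> real" where
  "bump p k t = (if \<bar>t\<bar> < 1 then poly p t / (1 - t\<^sup>2) ^ k * exp (- 1 / (1 - t\<^sup>2)) else 0)"

text \<open>Numerator of the derivative over the denominator (1 - t^2)^(k + 2); the coefficient list
  \<open>[:1, 0, -1:]\<close> is 1 - t^2.\<close>

definition dbump :: "real poly \<Rightarrow> nat \<Rightarrow> real poly" where
  "dbump p k = pderiv p * [:1, 0, -1:]\<^sup>2 + of_nat (2 * k) * ([:0, 1:] * p * [:1, 0, -1:]) - 2 * ([:0, 1:] * p)"

text \<open>Quadratic flatness off the open interval. With q = 1 - t^2, one term of the exponential
  series gives exp(-1/q) <= (k + 2)! q^(k + 2). This absorbs q^(-k) and leaves q^2, and q <= 2 |t -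
  t0| when |t0| >= 1.\<close>

lemma bump_bound: "\<exists>K\<ge>0. \<forall>t t0. 1 \<le> \<bar>t0\<bar> \<longrightarrow> \<bar>bump p k t\<bar> \<le> K * (t - t0)\<^sup>2"
proof -
  have "compact (poly p ` {-1..1})"
    by (intro compact_continuous_image continuous_intros) auto
  then obtain C where C: "\<And>t. t \<in> {-1..1} \<Longrightarrow> \<bar>poly p t\<bar> \<le> C"
    using compact_imp_bounded[of "poly p ` {-1..1}"] unfolding bounded_iff by (metis imageI real_norm_def)
  have C0: "0 \<le> C" using C[of 0] by auto
  define K where "K = C * fact (k + 2) * 4"
  have K0: "K \<ge> 0" using C0 by (simp add: K_def)
  have "\<bar>bump p k t\<bar> \<le> K * (t - t0)\<^sup>2" if t0: "1 \<le> \<bar>t0\<bar>" for t t0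
  proof (cases "\<bar>t\<bar> < 1")
    case True
    define q where "q = 1 - t\<^sup>2"
    have q: "q > 0" using True by (simp add: q_def abs_square_less_1)
    have "inverse (fact (k + 2)) *\<^sub>R (1 / q) ^ (k + 2) \<le> exp (1 / q)"
      unfolding exp_def using q
      using sum_le_suminf[OF summable_exp_generic[of "1 / q"], of "{k + 2}"] by simp
    then have "(1 / q) ^ (k + 2) / fact (k + 2) \<le> exp (1 / q)"
      by (simp add: field_simps)
    then have e: "exp (- 1 / q) \<le> fact (k + 2) * q ^ (k + 2)"
    proof -
      have "1 / exp (1 / q) \<le> fact (k + 2) * q ^ (k + 2)" if "(1 / q) ^ (k + 2) / m \<le> exp (1 / q)" "m = fact (k + 2)" for m
      proof -
        have "m > 0" using that by simp
        then have "1 \<le> m * q ^ (k + 2) * exp (1 / q)"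
          using that(1) q by (simp add: power_divide pos_divide_le_eq mult_ac del: fact_Suc power_Suc add_2_eq_Suc')
        then show ?thesis using that(2) by (simp add: pos_divide_le_eq del: fact_Suc power_Suc add_2_eq_Suc')
      qed
      then show ?thesis using \<open>(1 / q) ^ (k + 2) / fact (k + 2) \<le> exp (1 / q)\<close> by (simp add: exp_minus inverse_eq_divide del: fact_Suc power_Suc add_2_eq_Suc')
    qed
    have "\<bar>bump p k t\<bar> = \<bar>poly p t\<bar> * (exp (- 1 / q) / q ^ k)"
      using True q by (simp add: bump_def q_def abs_mult)
    also have "\<dots> \<le> C * (fact (k + 2) * q\<^sup>2)"
    proof (intro mult_mono)
      show "exp (- 1 / q) / q ^ k \<le> fact (k + 2) * q\<^sup>2"
        using e q by (simp add: field_simps power_add power2_eq_square)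
      show "\<bar>poly p t\<bar> \<le> C" using True by (intro C) auto
    qed (use q C0 in auto)
    also have "\<dots> \<le> C * (fact (k + 2) * (2 * \<bar>t - t0\<bar>)\<^sup>2)"
    proof (intro mult_left_mono power_mono)
      have "q = (1 - \<bar>t\<bar>) * (1 + \<bar>t\<bar>)" by (simp add: q_def algebra_simps power2_eq_square)
      also have "\<dots> \<le> \<bar>t - t0\<bar> * 2" using True t0 by (intro mult_mono) auto
      finally show "q \<le> 2 * \<bar>t - t0\<bar>" by simp
    qed (use q C0 in auto)
    also have "\<dots> = K * (t - t0)\<^sup>2" by (simp only: K_def power_mult_distrib power2_abs) simp
    finally show ?thesis .
  next
    case False
    then show ?thesis using K0 by (simp add: bump_def)
  qed
  then show ?thesis using K0 by blast
qed

lemma DERIV_0_if_quadratic: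
  fixes f :: "real \<Rightarrow> real"
  assumes "\<And>t. \<bar>f t\<bar> \<le> K * (t - t0)\<^sup>2"
  shows "(f has_real_derivative 0) (at t0)"
proof -
  have f0: "f t0 = 0" using assms[of t0] by simp
  have "((\<lambda>h. K * \<bar>h\<bar>) \<longlongrightarrow> K * \<bar>0\<bar>) (at 0)" by (intro tendsto_intros)
  then have "((\<lambda>h. K * \<bar>h\<bar>) \<longlongrightarrow> 0) (at 0)" by simp
  then have "((\<lambda>h. (f (t0 + h) - f t0) / h) \<longlongrightarrow> 0) (at 0)"
  proof (rule Lim_null_comparison[rotated])
    have "norm ((f (t0 + h) - f t0) / h) \<le> K * \<bar>h\<bar>" if "h \<noteq> 0" for h
    proof -
      have "\<bar>f (t0 + h)\<bar> \<le> K * \<bar>h\<bar> * \<bar>h\<bar>" using assms[of "t0 + h"] by (simp add: power2_eq_square mult.assoc)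
      then show ?thesis using that unfolding f0 by (simp add: divide_le_eq)
    qed
    then show "\<forall>\<^sub>F h in at 0. norm ((f (t0 + h) - f t0) / h) \<le> K * \<bar>h\<bar>"
      by (auto simp: eventually_at_filter)
  qed
  then show ?thesis by (simp add: DERIV_def)
qed

lemma bump_deriv: "(bump p k has_real_derivative bump (dbump p k) (k + 2) t) (at t)"
proof (cases "\<bar>t\<bar> < 1")
  case True
  let ?g = "\<lambda>t. poly p t / (1 - t\<^sup>2) ^ k * exp (- 1 / (1 - t\<^sup>2))"
  define q where "q = 1 - t\<^sup>2"
  have q: "q > 0" using True by (simp add: q_def abs_square_less_1)
  have pd: "((\<lambda>t. poly p t) has_real_derivative poly (pderiv p) t) (at t)" by (rule poly_DERIV)
  have qd: "((\<lambda>t. 1 - t\<^sup>2) has_real_derivative - 2 * t) (at t)" by (auto intro!: derivative_eq_intros)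
  have kd: "((\<lambda>t. (1 - t\<^sup>2) ^ k) has_real_derivative real k * ((- 2 * t) * q ^ (k - 1))) (at t)"
    using DERIV_power[OF qd, of k] by (simp add: q_def)
  have ed: "((\<lambda>t. exp (- 1 / (1 - t\<^sup>2))) has_real_derivative exp (- 1 / q) * (- 2 * t / q\<^sup>2)) (at t)"
    using q unfolding q_def by (auto intro!: derivative_eq_intros simp: power2_eq_square)
  have "(?g has_real_derivative (poly (pderiv p) t * q ^ k - poly p t * (real k * ((- 2 * t) * q ^ (k - 1)))) / (q ^ k * q ^ k) * exp (- 1 / q)
      + exp (- 1 / q) * (- 2 * t / q\<^sup>2) * (poly p t / q ^ k)) (at t)"
    using DERIV_mult[OF DERIV_divide[OF pd kd] ed] q by (simp add: q_def)
  also have "(poly (pderiv p) t * q ^ k - poly p t * (real k * ((- 2 * t) * q ^ (k - 1)))) / (q ^ k * q ^ k) * exp (- 1 / q)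
      + exp (- 1 / q) * (- 2 * t / q\<^sup>2) * (poly p t / q ^ k) = bump (dbump p k) (k + 2) t"
  proof -
    have b: "bump (dbump p k) (k + 2) t = (poly (pderiv p) t * q\<^sup>2 + 2 * real k * (t * poly p t * q) - 2 * (t * poly p t)) / q ^ (k + 2) * exp (- 1 / q)"
      using True by (simp add: bump_def dbump_def q_def power2_eq_square algebra_simps)
    have qk: "real k * q ^ (k - 1) = real k * q ^ k / q" using q by (cases k) auto
    have "poly p t * (real k * ((- 2 * t) * q ^ (k - 1))) = poly p t * (- 2 * t) * (real k * q ^ (k - 1))" by simp
    then show ?thesis unfolding b qk using q
      by (simp add: field_simps power_add power2_eq_square)
  qed
  finally have gd: "(?g has_real_derivative bump (dbump p k) (k + 2) t) (at t)" .
  have "\<forall>\<^sub>F s in nhds t. s \<in> {-1<..<1}" using True by (intro eventually_nhds_in_open) (auto simp: abs_less_iff)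
  then have "\<forall>\<^sub>F s in nhds t. bump p k s = ?g s"
    by eventually_elim (auto simp: bump_def abs_less_iff)
  from DERIV_cong_ev[OF refl this refl] gd show ?thesis by blast
next
  case False
  then have "1 \<le> \<bar>t\<bar>" by simp
  with bump_bound[of p k] obtain K where "\<And>s. \<bar>bump p k s\<bar> \<le> K * (s - t)\<^sup>2" by blast
  from DERIV_0_if_quadratic[OF this] show ?thesis using False by (simp add: bump_def[of "dbump p k"])
qed

definition bumps :: "(real \<Rightarrow> real) set" where
  "bumps = {g. \<exists>a b p k. g = (\<lambda>t. bump p k (a * t + b))}"

lemma bump_smult: "bump (smult c p) k t = c * bump p k t"
  by (simp add: bump_def)

lemma bumps_deriv:
  assumes "g \<in> bumps" obtains g' where "g' \<in> bumps" "\<And>t. (g has_real_derivative g' t) (at t)"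
proof -
  from assms obtain a b p k where g: "g = (\<lambda>t. bump p k (a * t + b))" by (auto simp: bumps_def)
  have "(g has_real_derivative bump (smult a (dbump p k)) (k + 2) (a * t + b)) (at t)" for t
  proof -
    have "((\<lambda>t. a * t + b) has_real_derivative a) (at t)" by (auto intro!: derivative_eq_intros)
    from DERIV_chain2[OF bump_deriv this] show ?thesis unfolding g bump_smult by (simp add: mult.commute)
  qed
  moreover have "(\<lambda>t. bump (smult a (dbump p k)) (k + 2) (a * t + b)) \<in> bumps" by (auto simp: bumps_def)
  ultimately show ?thesis using that by blast
qed

lemma prod3_has_derivative:
  fixes x :: "real^3"
  assumes g: "\<And>t. (g1 has_real_derivative g1' t) (at t)" "\<And>t. (g2 has_real_derivative g2' t) (at t)" "\<And>t. (g3 has_real_derivative g3' t) (at t)"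
  shows "((\<lambda>x. g1 (x$1) * g2 (x$2) * g3 (x$3)) has_derivative 
    (\<lambda>h. g1' (x$1) * h$1 * g2 (x$2) * g3 (x$3) + g1 (x$1) * (g2' (x$2) * h$2) * g3 (x$3) + g1 (x$1) * g2 (x$2) * (g3' (x$3) * h$3))) (at x)"
proof -
  have c: "((\<lambda>x. g (x$i)) has_derivative (\<lambda>h. g' (x$i) * h$i)) (at x)"
    if "\<And>t. (g has_real_derivative g' t) (at t)" for g g' and i :: 3
  proof -
    have "(g has_derivative (\<lambda>h. g' (x$i) * h)) (at (x$i))" using that[of "x$i"] by (simp add: has_field_derivative_def)
    moreover have "((\<lambda>x. x$i) has_derivative (\<lambda>h. h$i)) (at x)" 
      by (rule bounded_linear_imp_has_derivative) (rule bounded_linear_vec_nth)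
    ultimately show ?thesis using has_derivative_compose[of "\<lambda>x. x$i" "\<lambda>h. h$i" x UNIV g] by simp
  qed
  show ?thesis
    by (rule has_derivative_eq_rhs[OF has_derivative_mult[OF has_derivative_mult[OF c[OF g(1)] c[OF g(2)]] c[OF g(3)]]])
       (auto simp: algebra_simps)
qed

text \<open>Every partial derivative is again a product of three members of \<open>bumps\<close>;
  the induction therefore runs over all such products at once.\<close>

lemma prod3_Ck:
  assumes "g1 \<in> bumps" "g2 \<in> bumps" "g3 \<in> bumps"
  shows "Ck k (\<lambda>x. g1 (x$1) * g2 (x$2) * g3 (x$3))"
  using assms
proof (induction k arbitrary: g1 g2 g3)
  case (0 g1 g2 g3)
  obtain g1' g2' g3' where g: "\<And>t. (g1 has_real_derivative g1' t) (at t)" "\<And>t. (g2 has_real_derivative g2' t) (at t)" "\<And>t. (g3 has_real_derivative g3' t) (at t)"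
    using bumps_deriv 0 by metis
  show ?case
    unfolding Ck.simps
    by (intro continuous_at_imp_continuous_on ballI has_derivative_continuous[OF prod3_has_derivative[OF g]])
next
  case (Suc k g1 g2 g3)
  obtain g1' g2' g3' where g: "\<And>t. (g1 has_real_derivative g1' t) (at t)" "\<And>t. (g2 has_real_derivative g2' t) (at t)" "\<And>t. (g3 has_real_derivative g3' t) (at t)"
    and g': "g1' \<in> bumps" "g2' \<in> bumps" "g3' \<in> bumps"
    using bumps_deriv Suc.prems by metis
  let ?f = "\<lambda>x::real^3. g1 (x$1) * g2 (x$2) * g3 (x$3)"
  note d = prod3_has_derivative[OF g]
  have p: "partial j ?f = (\<lambda>x. if j = 1 then g1' (x$1) * g2 (x$2) * g3 (x$3) else if j = 2 then g1 (x$1) * g2' (x$2) * g3 (x$3)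
     else g1 (x$1) * g2 (x$2) * g3' (x$3))" for j
    unfolding partial_def frechet_derivative_at[OF d, symmetric]
    using exhaust_3[of j] by (auto simp: axis_def fun_eq_iff)
  have "Ck k (partial j ?f)" for j
    unfolding p using exhaust_3[of j] Suc.IH[OF g'(1) Suc.prems(2,3)] Suc.IH[OF Suc.prems(1) g'(2) Suc.prems(3)] Suc.IH[OF Suc.prems(1,2) g'(3)]
    by auto
  moreover have "?f differentiable (at x)" for x using d by (auto simp: differentiable_def)
  ultimately show ?case by simp
qed

text \<open>Supported in the closed cube with centre \<open>y\<close> and half-side 1 / a. The
  centre and the scale are both varied when weak gradients are tested.\<close>

definition bump3 :: "real \<Rightarrow> real^3 \<Rightarrow> real^3 \<Rightarrow> real" where
  "bump3 a y x = bump 1 0 (a * ((x - y)$1)) * bump 1 0 (a * ((x - y)$2)) * bump 1 0 (a * ((x - y)$3))"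

lemma bump3_test: 
  assumes a: "a > 0" shows "bump3 a y \<in> test_functions"
proof -
  have "Ck k (bump3 a y)" for k
  proof -
    have "(\<lambda>t. bump 1 0 (a * (t - y$i))) \<in> bumps" for i
    proof -
      have "(\<lambda>t. bump 1 0 (a * (t - y$i))) = (\<lambda>t. bump 1 0 (a * t + (- a * (y$i))))" by (simp add: algebra_simps)
      then show ?thesis unfolding bumps_def by blast
    qed
    from prod3_Ck[OF this this this, of k 1 2 3] show ?thesis by (simp add: bump3_def[abs_def])
  qed
  moreover have "compact (closure {x. bump3 a y x \<noteq> 0})"
  proof -
    have "norm x \<le> norm y + 3 / a" if "bump3 a y x \<noteq> 0" for x
    proof -
      have "\<bar>a * ((x - y)$i)\<bar> < 1" for i
        using that exhaust_3[of i] by (auto simp: bump3_def bump_def split: if_splits)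
      then have "\<bar>(x - y)$i\<bar> \<le> 1 / a" for i
        using a unfolding abs_mult by (simp add: pos_le_divide_eq mult.commute less_imp_le)
      then have "(\<Sum>i\<in>UNIV. \<bar>(x - y)$i\<bar>) \<le> (\<Sum>i\<in>(UNIV::3 set). 1 / a)" by (intro sum_mono)
      then have "norm (x - y) \<le> 3 / a" using norm_le_l1_cart[of "x - y"] by simp
      then show ?thesis using norm_triangle_sub[of x y] by simp
    qed
    then have "bounded {x. bump3 a y x \<noteq> 0}" by (auto simp: bounded_iff)
    then show ?thesis by (simp add: compact_closure)
  qed
  ultimately show ?thesis by (simp add: test_functions_def)
qed

lemma compactly_supported_integrable:
  fixes f :: "real^3 \<Rightarrow> real"
  assumes c: "continuous_on UNIV f" and K: "compact K" "\<And>x. x \<notin> K \<Longrightarrow> f x = 0"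
  shows "integrable lborel (\<lambda>x. complex_of_real (f x))" "(\<lambda>x. complex_of_real (f x)) \<in> L2" "\<exists>C. \<forall>x. \<bar>f x\<bar> \<le> C"
proof -
  have [measurable]: "f \<in> borel_measurable borel" by (rule borel_measurable_continuous_onI[OF c])
  have "compact (f ` K)" using c K(1) by (intro compact_continuous_image) (auto intro: continuous_on_subset)
  then obtain C where C: "\<And>x. x \<in> K \<Longrightarrow> \<bar>f x\<bar> \<le> C" "C > 0"
    using compact_imp_bounded[of "f ` K"] unfolding bounded_pos by (metis imageI real_norm_def)
  have C': "\<bar>f x\<bar> \<le> C * indicator K x" for x using C K(2) by (cases "x \<in> K") auto
  have Ki: "integrable lborel (\<lambda>x. indicator K x :: real)" 
    using K(1) by (intro integrable_real_indicator emeasure_compact_finite) (auto intro: borel_closed compact_imp_closed)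
  show "\<exists>C. \<forall>x. \<bar>f x\<bar> \<le> C" 
  proof (intro exI allI)
    show "\<bar>f x\<bar> \<le> C" for x using C K(2)[of x] by (cases "x \<in> K") auto
  qed
  show "integrable lborel (\<lambda>x. complex_of_real (f x))"
    by (rule Bochner_Integration.integrable_bound[OF integrable_mult_right[OF Ki, of C]]) (use C' C(2) in \<open>auto simp: abs_mult\<close>)
  show "(\<lambda>x. complex_of_real (f x)) \<in> L2"
  proof (rule L2_bound[OF integrable_mult_right[OF Ki, of "C\<^sup>2"]])
    have "(norm (complex_of_real (f x)))\<^sup>2 \<le> C\<^sup>2 * indicator K x" for x
      using power_mono[OF C', of x 2] by (cases "x \<in> K") (simp_all add: K(2))
    then show "AE x in lborel. (norm (complex_of_real (f x)))\<^sup>2 \<le> C\<^sup>2 * indicator K x" by simp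
  qed measurable
qed

lemma test_function_props:
  assumes t: "\<phi> \<in> test_functions"
  shows "\<phi> differentiable (at x)" "continuous_on UNIV \<phi>" "continuous_on UNIV (partial j \<phi>)"
    "compact (closure {x. \<phi> x \<noteq> 0})" "x \<notin> closure {x. \<phi> x \<noteq> 0} \<Longrightarrow> \<phi> x = 0"
    "x \<notin> closure {x. \<phi> x \<noteq> 0} \<Longrightarrow> partial j \<phi> x = 0"
proof -
  have "Ck 1 \<phi>" using t by (simp only: test_functions_def mem_Collect_eq)
  then show d: "\<phi> differentiable (at x)" for x by simp
  from \<open>Ck 1 \<phi>\<close> show "continuous_on UNIV (partial j \<phi>)" by simp
  show "continuous_on UNIV \<phi>"
    by (intro continuous_at_imp_continuous_on ballI differentiable_imp_continuous_within d)
  show "compact (closure {x. \<phi> x \<noteq> 0})" using t by (simp add: test_functions_def)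
  show z: "x \<notin> closure {x. \<phi> x \<noteq> 0} \<Longrightarrow> \<phi> x = 0" for x using closure_subset[of "{x. \<phi> x \<noteq> 0}"] by auto
  show "partial j \<phi> x = 0" if x: "x \<notin> closure {x. \<phi> x \<noteq> 0}"
  proof -
    have "(\<phi> has_derivative (\<lambda>h. 0)) (at x)"
    proof (rule has_derivative_transform_within_open[where s="- closure {x. \<phi> x \<noteq> 0}" and f="\<lambda>_. 0"])
      show "0 = \<phi> y" if "y \<in> - closure {x. \<phi> x \<noteq> 0}" for y using z[of y] that by simp
    qed (use x in auto)
    show ?thesis unfolding partial_def frechet_derivative_at[OF \<open>(\<phi> has_derivative (\<lambda>h. 0)) (at x)\<close>, symmetric] ..
  qed
qed

lemma test_function_integrable:
  assumes t: "\<phi> \<in> test_functions"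
  shows "integrable lborel (\<lambda>x. complex_of_real (\<phi> x))" "(\<lambda>x. complex_of_real (\<phi> x)) \<in> L2" "\<exists>C. \<forall>x. \<bar>\<phi> x\<bar> \<le> C"
    "integrable lborel (\<lambda>x. complex_of_real (partial j \<phi> x))" "(\<lambda>x. complex_of_real (partial j \<phi> x)) \<in> L2" "\<exists>C. \<forall>x. \<bar>partial j \<phi> x\<bar> \<le> C"
  using compactly_supported_integrable[OF test_function_props(2,4,5)[OF t]] compactly_supported_integrable[OF test_function_props(3,4,6)[OF t]]
  by blast+

text \<open>The transform of a difference quotient is explicit, namely (cis(s xi_j) - 1) / s times
  the transform of the function. Dominated convergence in s replaces an integration by
  parts.\<close>

lemma fourier_partial:
  assumes t: "\<phi> \<in> test_functions"
  shows "fourier (\<lambda>x. of_real (partial j \<phi> x)) \<xi> = \<i> * of_real (\<xi>$j) * fourier (\<lambda>x. of_real (\<phi> x)) \<xi>"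
proof -
  note p = test_function_props[OF t] and i = test_function_integrable[OF t]
  have [measurable]: "\<phi> \<in> borel_measurable borel" "partial j \<phi> \<in> borel_measurable borel"
    by (auto intro: borel_measurable_continuous_onI p)
  define e :: "real^3" where "e = axis j 1"
  have ne: "norm e = 1" by (simp add: e_def)
  define s where "s n = inverse (real (Suc n))" for n
  have s: "s n > 0" "s n \<le> 1" for n by (auto simp: s_def inverse_le_1_iff)
  have s0: "s \<longlonglongrightarrow> 0" unfolding s_def by (rule LIMSEQ_inverse_real_of_nat)
  have s0': "filterlim s (at 0) sequentially" unfolding filterlim_at using s0 s by (auto simp: less_imp_neq[symmetric])
  obtain C where C: "\<And>x. \<bar>partial j \<phi> x\<bar> \<le> C" using i(6) by blast
  have C0: "C \<ge> 0" using C[of 0] by linarith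
  have line: "((\<lambda>r. \<phi> (x + r *\<^sub>R e)) has_real_derivative partial j \<phi> (x + r *\<^sub>R e)) (at r)" for x r
  proof -
    have "(\<phi> has_derivative frechet_derivative \<phi> (at (x + r *\<^sub>R e))) (at (x + r *\<^sub>R e))"
      using p(1) by (simp add: frechet_derivative_works[symmetric])
    moreover have "((\<lambda>r. x + r *\<^sub>R e) has_derivative (\<lambda>h. h *\<^sub>R e)) (at r)"
      by (auto intro!: derivative_eq_intros)
    ultimately have "((\<lambda>r. \<phi> (x + r *\<^sub>R e)) has_derivative (\<lambda>h. frechet_derivative \<phi> (at (x + r *\<^sub>R e)) (h *\<^sub>R e))) (at r)"
      using has_derivative_compose[of "\<lambda>r. x + r *\<^sub>R e" "\<lambda>h. h *\<^sub>R e" r UNIV \<phi>] by auto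
    moreover have "frechet_derivative \<phi> (at (x + r *\<^sub>R e)) (h *\<^sub>R e) = partial j \<phi> (x + r *\<^sub>R e) * h" for h
      using linear_scale[OF linear_frechet_derivative[OF p(1)]] by (simp add: partial_def e_def)
    ultimately show ?thesis by (simp add: has_field_derivative_def)
  qed
  obtain R where R: "\<And>x. x \<in> closure {x. \<phi> x \<noteq> 0} \<Longrightarrow> norm x \<le> R"
    using compact_imp_bounded[OF p(4)] by (auto simp: bounded_iff)
  define D where "D n x = (\<phi> (x + s n *\<^sub>R e) - \<phi> x) / s n" for n x
  have [measurable]: "D n \<in> borel_measurable borel" for n unfolding D_def[abs_def] by measurable
  have Dlim: "(\<lambda>n. D n x) \<longlonglongrightarrow> partial j \<phi> x" for x
  proof -
    have "((\<lambda>h. (\<phi> (x + h *\<^sub>R e) - \<phi> x) / h) \<longlongrightarrow> partial j \<phi> x) (at 0)"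
      using line[of x 0] by (simp add: DERIV_def)
    from filterlim_compose[OF this s0'] show ?thesis by (simp add: D_def)
  qed
  \<comment> \<open>Mean value theorem on a segment of length s n <= 1; the radius R + 1 allows for
    points that the shift moves into the support.\<close>
  have Db: "\<bar>D n x\<bar> \<le> C * indicator (cball 0 (R + 1)) x" for n x
  proof (cases "norm x \<le> R + 1")
    case True
    obtain z where "\<phi> (x + s n *\<^sub>R e) - \<phi> (x + 0 *\<^sub>R e) = (s n - 0) * partial j \<phi> (x + z *\<^sub>R e)"
      using MVT2[OF s(1) line] by blast
    then have "D n x = partial j \<phi> (x + z *\<^sub>R e)" using s(1)[of n] by (simp add: D_def)
    then show ?thesis using C True by (simp add: indicator_def)
  next
    case False
    have "norm x \<le> norm (x + s n *\<^sub>R e) + norm (s n *\<^sub>R e)" using norm_triangle_ineq4[of "x + s n *\<^sub>R e" "s n *\<^sub>R e"] by simp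
    then have "norm (x + s n *\<^sub>R e) > R" using False s[of n] ne by simp
    then have "x + s n *\<^sub>R e \<notin> closure {x. \<phi> x \<noteq> 0}" "x \<notin> closure {x. \<phi> x \<noteq> 0}"
      using R[of "x + s n *\<^sub>R e"] R[of x] False by linarith+
    then have "\<phi> (x + s n *\<^sub>R e) = 0" "\<phi> x = 0" using p(5) by blast+
    then show ?thesis using C0 by (simp add: D_def)
  qed
  have "(\<lambda>n. fourier (\<lambda>x. of_real (D n x)) \<xi>) \<longlonglongrightarrow> fourier (\<lambda>x. of_real (partial j \<phi> x)) \<xi>"
    unfolding fourier_def
  proof (rule integral_dominated_convergence[where w="\<lambda>x. C * indicator (cball 0 (R + 1)) x"])
    have "integrable lborel (\<lambda>x::real^3. indicator (cball 0 (R + 1)) x :: real)"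
      by (intro integrable_real_indicator) (use emeasure_lborel_cball_finite[of 0 "R + 1"] in auto)
    then show "integrable lborel (\<lambda>x::real^3. C * indicator (cball 0 (R + 1)) x)" by (intro integrable_mult_right)
    show "AE x in lborel. (\<lambda>n. cis (- (x \<bullet> \<xi>)) * of_real (D n x)) \<longlonglongrightarrow> cis (- (x \<bullet> \<xi>)) * of_real (partial j \<phi> x)"
      by (intro AE_I2 tendsto_intros Dlim)
    show "AE x in lborel. norm (cis (- (x \<bullet> \<xi>)) * of_real (D n x)) \<le> C * indicator (cball 0 (R + 1)) x" for n
      using Db by (intro AE_I2) (simp add: norm_mult)
  qed measurable
  moreover have "fourier (\<lambda>x. of_real (D n x)) \<xi> = (cis (s n * \<xi>$j) - 1) / of_real (s n) * fourier (\<lambda>x. of_real (\<phi> x)) \<xi>" for n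
  proof -
    have e\<xi>: "e \<bullet> \<xi> = \<xi>$j" by (simp add: e_def inner_axis' )
    have i2: "integrable lborel (\<lambda>x. complex_of_real (\<phi> (x + s n *\<^sub>R e)))"
      using integral_translate(2)[of "\<lambda>x. complex_of_real (\<phi> x)" "s n *\<^sub>R e"] i(1) by simp
    have "fourier (\<lambda>x. complex_of_real (\<phi> (x + s n *\<^sub>R e))) \<xi> = (\<integral>x. cis (- ((x + s n *\<^sub>R e) \<bullet> \<xi>) + s n * \<xi>$j) * complex_of_real (\<phi> (x + s n *\<^sub>R e)) \<partial>lborel)"
      unfolding fourier_def by (simp add: inner_add_left e\<xi>)
    also have "\<dots> = (\<integral>x. cis (- (x \<bullet> \<xi>) + s n * \<xi>$j) * complex_of_real (\<phi> x) \<partial>lborel)"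
      by (rule integral_translate(1)) measurable
    also have "\<dots> = cis (s n * \<xi>$j) * fourier (\<lambda>x. of_real (\<phi> x)) \<xi>"
      unfolding fourier_def cis_mult[symmetric] integral_mult_right_zero[symmetric] by (simp only: mult_ac)
    finally have ft: "fourier (\<lambda>x. complex_of_real (\<phi> (x + s n *\<^sub>R e))) \<xi> = cis (s n * \<xi>$j) * fourier (\<lambda>x. of_real (\<phi> x)) \<xi>" .
    have "fourier (\<lambda>x. of_real (D n x)) \<xi> = fourier (\<lambda>x. (1 / of_real (s n)) * (complex_of_real (\<phi> (x + s n *\<^sub>R e)) - complex_of_real (\<phi> x))) \<xi>"
      by (simp add: D_def)
    also have "\<dots> = (1 / of_real (s n)) * (fourier (\<lambda>x. complex_of_real (\<phi> (x + s n *\<^sub>R e))) \<xi> - fourier (\<lambda>x. complex_of_real (\<phi> x)) \<xi>)"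
      unfolding fourier_cmult fourier_diff[OF i2 i(1)] ..
    finally show ?thesis unfolding ft by (simp add: algebra_simps diff_divide_distrib)
  qed
  moreover have "(\<lambda>n. (cis (s n * \<xi>$j) - 1) / of_real (s n) * fourier (\<lambda>x. of_real (\<phi> x)) \<xi>) \<longlonglongrightarrow> \<i> * of_real (\<xi>$j) * fourier (\<lambda>x. of_real (\<phi> x)) \<xi>"
  proof -
    have "((\<lambda>z. exp (\<i> * of_real (\<xi>$j) * z)) has_field_derivative (\<i> * of_real (\<xi>$j))) (at 0)"
      by (auto intro!: derivative_eq_intros)
    then have "((\<lambda>z. (exp (\<i> * of_real (\<xi>$j) * z) - 1) / z) \<longlongrightarrow> \<i> * of_real (\<xi>$j)) (at 0)"
      by (simp add: DERIV_def)
    moreover have "filterlim (\<lambda>n. complex_of_real (s n)) (at 0) sequentially"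
      unfolding filterlim_at using tendsto_of_real[OF s0, where 'a=complex] s by (auto simp: less_imp_neq[symmetric])
    ultimately have "(\<lambda>n. (exp (\<i> * of_real (\<xi>$j) * of_real (s n)) - 1) / of_real (s n)) \<longlonglongrightarrow> \<i> * of_real (\<xi>$j)"
      by (rule filterlim_compose)
    then show ?thesis by (intro tendsto_mult tendsto_const) (simp add: cis_conv_exp mult_ac)
  qed
  ultimately show ?thesis using LIMSEQ_unique by auto
qed

lemma L2_vec_nth:
  fixes G :: "real^3 \<Rightarrow> complex^3"
  assumes G: "G \<in> L2" shows "(\<lambda>x. G x $ j) \<in> L2"
proof (rule L2_bound)
  show "integrable lborel (\<lambda>x. (norm (G x))\<^sup>2)" using G by (simp add: L2_def)
  have "G \<in> borel_measurable borel" by (rule L2_measurable[OF G])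
  then show "(\<lambda>x. G x $ j) \<in> borel_measurable borel"
    by (rule borel_measurable_continuous_on[rotated]) (intro continuous_intros)
  show "AE x in lborel. (norm (G x $ j))\<^sup>2 \<le> (norm (G x))\<^sup>2"
    by (intro AE_I2 power_mono Finite_Cartesian_Product.norm_nth_le norm_ge_zero)
qed

lemma norm_sq_vec: "(norm (v :: complex^3))\<^sup>2 = (\<Sum>j\<in>UNIV. (norm (v $ j))\<^sup>2)"
  by (simp add: norm_vec_def L2_set_def sum_nonneg)

lemma L2_vec_lambda:
  assumes g: "\<And>j. g j \<in> L2" shows "(\<lambda>x. (\<chi> j. (g j x :: complex)) :: complex^3) \<in> L2"
proof (rule L2_bound)
  show "integrable lborel (\<lambda>x. \<Sum>j\<in>(UNIV::3 set). (norm (g j x))\<^sup>2)"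
    using g by (auto simp: L2_def)
  have "(\<lambda>x. (\<chi> j. (g j x :: complex)) :: complex^3) = (\<lambda>x. \<Sum>j\<in>UNIV. axis j (g j x))"
    by (simp add: fun_eq_iff vec_eq_iff axis_def if_distrib[of "\<lambda>f. f _"] sum.delta cong: if_cong)
  moreover have "(\<lambda>x. axis j (g j x) :: complex^3) \<in> borel_measurable borel" for j
  proof (rule borel_measurable_continuous_on[OF _ L2_measurable[OF g]])
    have "bounded_linear (axis j :: complex \<Rightarrow> complex^3)"
    proof (rule bounded_linear_intro[where K=1])
      fix z :: complex
      have "(norm (axis j z :: complex^3))\<^sup>2 = (norm z)\<^sup>2"
        unfolding norm_sq_vec axis_def by (simp add: if_distrib[of norm] if_distrib[of "\<lambda>x. x\<^sup>2"] sum.delta cong: if_cong)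
      then show "norm (axis j z :: complex^3) \<le> norm z * 1" by simp
    qed (auto simp: axis_def vec_eq_iff)
    then show "continuous_on UNIV (axis j :: complex \<Rightarrow> complex^3)" by (intro linear_continuous_on)
  qed
  ultimately show "(\<lambda>x. (\<chi> j. (g j x :: complex)) :: complex^3) \<in> borel_measurable borel" by simp
qed (simp add: norm_sq_vec)

lemma has_weak_gradientI:
  assumes u: "has_L2_fourier u U" and G: "\<And>j. has_L2_fourier (g j) (\<lambda>\<xi>. \<i> * of_real (\<xi>$j) * U \<xi>)"
  shows "has_weak_gradient u (\<lambda>x. \<chi> j. g j x)"
  unfolding has_weak_gradient_def
proof (intro ballI allI)
  fix \<phi> j assume t: "\<phi> \<in> test_functions"
  note i = test_function_integrable[OF t]
  let ?p = "\<lambda>x. complex_of_real (\<phi> x)" and ?dp = "\<lambda>x. complex_of_real (partial j \<phi> x)"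
  have p: "has_L2_fourier ?p (fourier ?p)" "has_L2_fourier ?dp (fourier ?dp)"
    by (auto intro: has_L2_fourier_integrable i)
  have "fourier_const\<^sup>2 * L2_inner u ?dp = L2_inner U (fourier ?dp)" by (simp add: has_L2_fourier_L2_inner[OF u p(2)])
  also have "\<dots> = - L2_inner (\<lambda>\<xi>. \<i> * of_real (\<xi>$j) * U \<xi>) (fourier ?p)"
    unfolding L2_inner_def fourier_partial[OF t] by (simp add: mult_ac)
  also have "\<dots> = - (fourier_const\<^sup>2 * L2_inner (g j) ?p)" by (simp add: has_L2_fourier_L2_inner[OF G p(1)])
  finally have "complex_of_real (fourier_const\<^sup>2) * L2_inner u ?dp = complex_of_real (fourier_const\<^sup>2) * (- L2_inner (g j) ?p)" by simp
  then have "L2_inner u ?dp = - L2_inner (g j) ?p" by (subst (asm) mult_left_cancel) auto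
  then show "(\<integral>x. u x * ?dp x \<partial>lborel) = - (\<integral>x. (\<chi> j. g j x) $ j * ?p x \<partial>lborel)"
    by (simp add: L2_inner_def)
qed

lemma fourier_continuous:
  assumes f: "integrable lborel f" and z: "z \<longlonglongrightarrow> z0"
  shows "(\<lambda>n. fourier f (z n)) \<longlonglongrightarrow> fourier f z0"
  unfolding fourier_def
proof (rule integral_dominated_convergence[where w="\<lambda>x. norm (f x)"])
  note [measurable] = borel_measurable_integrable[OF f, simplified]
  show "AE x in lborel. (\<lambda>n. cis (- (x \<bullet> z n)) * f x) \<longlonglongrightarrow> cis (- (x \<bullet> z0)) * f x"
    unfolding cis_conv_exp by (intro AE_I2 tendsto_intros z)
  show "(\<lambda>x. cis (- (x \<bullet> z0)) * f x) \<in> borel_measurable lborel" "(\<lambda>x. cis (- (x \<bullet> z n)) * f x) \<in> borel_measurable lborel" for n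
    by measurable
  show "AE x in lborel. norm (cis (- (x \<bullet> z n)) * f x) \<le> norm (f x)" for n by (simp add: norm_mult)
qed (use f in auto)

text \<open>At frequency 0 the transform is the integral of a nonnegative function that is positive
  on the unit ball.\<close>

lemma bump3_integral: "fourier (\<lambda>x. complex_of_real (bump3 1 0 x)) 0 \<noteq> 0"
proof -
  note i = test_function_integrable[OF bump3_test[of 1 0]]
  have b1: "bump 1 0 t \<ge> 0" for t by (simp add: bump_def)
  have nn: "bump3 1 0 x \<ge> 0" for x by (simp add: bump3_def b1)
  have ir: "integrable lborel (bump3 1 0)" using i(1) by (simp add: complex_of_real_integrable_eq)
  have "\<not> (AE x in lborel. bump3 1 0 x = 0)"
  proof
    assume "AE x in lborel. bump3 1 0 x = 0"
    then have "AE x in lborel. x \<notin> ball (0::real^3) 1"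
    proof eventually_elim
      case (elim x)
      then obtain i where "bump 1 0 (x $ i) = 0" by (auto simp: bump3_def)
      then have "\<not> \<bar>x $ i\<bar> < 1" by (auto simp: bump_def)
      then show ?case using component_le_norm_cart[of x i] by auto
    qed
    then have "emeasure lborel (ball (0::real^3) 1) = 0"
      by (subst (asm) AE_iff_measurable[OF _ refl]) (auto simp: ball_def dist_norm)
    moreover have "emeasure lborel (ball (0::real^3) 1) \<noteq> 0"
    proof
      assume "emeasure lborel (ball (0::real^3) 1) = 0"
      then have "negligible (ball (0::real^3) 1)"
        unfolding negligible_iff_null_sets by (intro null_sets_completionI) (auto simp: null_sets_def)
      then show False using open_not_negligible[of "ball (0::real^3) 1"] by simp
    qed
    ultimately show False by simp
  qed
  then have "(\<integral>x. bump3 1 0 x \<partial>lborel) \<noteq> 0"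
    using integral_nonneg_eq_0_iff_AE[OF ir] nn by auto
  then have "complex_of_real (\<integral>x. bump3 1 0 x \<partial>lborel) \<noteq> 0" by (simp only: of_real_eq_0_iff) simp
  then show ?thesis by (simp add: fourier_def flip: integral_complex_of_real)
qed

text \<open>Testing with all translates of a bump shows that the difference of the two sides times the conjugate
  transform of the bump has a vanishing Fourier transform; dilating the bump makes its transform nonzero at
  any given frequency.\<close>

lemma weak_gradient_fourier:
  assumes u: "has_L2_fourier u U" and G: "G \<in> L2" and w: "has_weak_gradient u G"
    and g: "has_L2_fourier (\<lambda>x. G x $ j) V"
  shows "AE \<xi> in lborel. V \<xi> = \<i> * of_real (\<xi>$j) * U \<xi>"
proof -
  note LU = has_L2_fourierD[OF u] and LV = has_L2_fourierD[OF g]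
  define P where "P n = fourier (\<lambda>x. complex_of_real (bump3 (real (Suc n)) 0 x))" for n
  define q where "q n \<xi> = V \<xi> * cnj (P n \<xi>) + U \<xi> * cnj (\<i> * of_real (\<xi>$j) * P n \<xi>)" for n \<xi>
  have "AE \<xi> in lborel. q n \<xi> = 0" for n
  proof -
    let ?a = "real (Suc n)"
    note t = bump3_test[of ?a 0]
    note i = test_function_integrable[OF t]
    let ?p = "\<lambda>x. complex_of_real (bump3 ?a 0 x)" and ?dp = "\<lambda>x. complex_of_real (partial j (bump3 ?a 0) x)"
    have a: "?a > 0" by simp
    have dP: "fourier ?dp = (\<lambda>\<xi>. \<i> * of_real (\<xi>$j) * P n \<xi>)"
      unfolding P_def by (rule ext) (rule fourier_partial[OF t[OF a]])
    have PL: "P n \<in> L2" "fourier ?dp \<in> L2"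
      using fourier_L2(1)[OF i(2,1)] fourier_L2(1)[OF i(5,4)] by (auto simp: P_def)
    have [measurable]: "P n \<in> borel_measurable borel" "fourier ?dp \<in> borel_measurable borel"
      using PL by (auto intro: L2_measurable)
    have Pb: "norm (cnj (P n \<xi>)) \<le> (\<integral>x. norm (?p x) \<partial>lborel)" "norm (cnj (fourier ?dp \<xi>)) \<le> (\<integral>x. norm (?dp x) \<partial>lborel)" for \<xi>
      unfolding P_def complex_mod_cnj by (intro fourier_norm_le i a)+
    have q: "q n = (\<lambda>\<xi>. V \<xi> * cnj (P n \<xi>) + U \<xi> * cnj (fourier ?dp \<xi>))"
      unfolding dP q_def[abs_def] by simp
    \<comment> \<open>Integrability allows the pointwise transform of \<open>q n\<close>, and square
      integrability makes Plancherel applicable to it.\<close>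
    have qi: "integrable lborel (q n)"
      unfolding q by (intro Bochner_Integration.integrable_add L2_prod_integrable LU LV PL)
    have qL: "q n \<in> L2"
    proof -
      have "(\<lambda>\<xi>. cnj (P n \<xi>) * V \<xi> + cnj (fourier ?dp \<xi>) * U \<xi>) \<in> L2"
        by (intro L2_add L2_bounded_mult(1)[OF _ Pb(1)] L2_bounded_mult(1)[OF _ Pb(2)] LU LV) measurable
      then show ?thesis unfolding q by (simp add: mult.commute)
    qed
    have "fourier (q n) (- y) = 0" for y
    proof -
      note t' = bump3_test[OF a, of y]
      note i' = test_function_integrable[OF t']
      let ?p' = "\<lambda>x. complex_of_real (bump3 ?a y x)" and ?dp' = "\<lambda>x. complex_of_real (partial j (bump3 ?a y) x)"
      have p': "has_L2_fourier ?p' (fourier ?p')" "has_L2_fourier ?dp' (fourier ?dp')"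
        by (rule has_L2_fourier_integrable[OF i'(2,1)], rule has_L2_fourier_integrable[OF i'(5,4)])
      have fp: "fourier ?p' \<xi> = cis (- (y \<bullet> \<xi>)) * P n \<xi>" for \<xi>
      proof -
        have [measurable]: "bump3 ?a 0 \<in> borel_measurable borel"
          by (rule borel_measurable_continuous_onI[OF test_function_props(2)[OF t[OF a]]])
        have "fourier ?p' \<xi> = (\<integral>x. cis (- ((x + - y) \<bullet> \<xi>) + - (y \<bullet> \<xi>)) * complex_of_real (bump3 ?a 0 (x + - y)) \<partial>lborel)"
          unfolding fourier_def by (simp add: inner_diff_left bump3_def)
        also have "\<dots> = (\<integral>x. cis (- (x \<bullet> \<xi>) + - (y \<bullet> \<xi>)) * complex_of_real (bump3 ?a 0 x) \<partial>lborel)"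
          by (rule integral_translate(1)) measurable
        also have "\<dots> = cis (- (y \<bullet> \<xi>)) * P n \<xi>"
          unfolding P_def fourier_def cis_mult[symmetric] integral_mult_right_zero[symmetric] by (simp only: mult_ac)
        finally show ?thesis .
      qed
      have fdp: "fourier ?dp' \<xi> = cis (- (y \<bullet> \<xi>)) * fourier ?dp \<xi>" for \<xi>
        unfolding fourier_partial[OF t'] dP fp by (simp add: mult_ac)
      have "L2_inner u ?dp' = - L2_inner (\<lambda>x. G x $ j) ?p'"
        using w t' by (auto simp: has_weak_gradient_def L2_inner_def)
      then have "L2_inner U (fourier ?dp') = - L2_inner V (fourier ?p')"
        unfolding has_L2_fourier_L2_inner[OF u p'(2)] has_L2_fourier_L2_inner[OF g p'(1)] by simp
      then have "0 = L2_inner V (fourier ?p') + L2_inner U (fourier ?dp')" by simp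
      also have "\<dots> = (\<integral>\<xi>. V \<xi> * cnj (fourier ?p' \<xi>) + U \<xi> * cnj (fourier ?dp' \<xi>) \<partial>lborel)"
        unfolding L2_inner_def
        by (intro Bochner_Integration.integral_add[symmetric] L2_prod_integrable LU LV has_L2_fourierD(2)[OF p'(1)] has_L2_fourierD(2)[OF p'(2)])
      also have "\<dots> = fourier (q n) (- y)"
        unfolding fourier_def[of "q n"] unfolding q fp fdp
        by (intro Bochner_Integration.integral_cong refl)
           (simp add: cis_cnj inner_commute algebra_simps)
      finally show ?thesis by simp
    qed
    then have "fourier (q n) = (\<lambda>_. 0)" by (metis minus_minus ext)
    then have "mass (q n) = 0" using plancherel_L1(2)[OF qL qi] by (simp add: mass_def)
    then show ?thesis using mass_eq_0_iff[OF qL] by simp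
  qed
  then have "AE \<xi> in lborel. \<forall>n. q n \<xi> = 0" by (simp add: AE_all_countable)
  then show ?thesis
  proof eventually_elim
    case (elim \<xi>)
    note i1 = test_function_integrable(1)[OF bump3_test[of 1 0]]
    have bm: "(\<lambda>x. complex_of_real (bump3 1 0 x)) \<in> borel_measurable borel"
      using borel_measurable_integrable[OF i1] by simp
    have Pn: "P n \<xi> = (1 / real (Suc n) ^ 3) *\<^sub>R fourier (\<lambda>x. complex_of_real (bump3 1 0 x)) ((1 / real (Suc n)) *\<^sub>R \<xi>)" for n
    proof -
      have "bump3 (real (Suc n)) 0 = (\<lambda>x. bump3 1 0 (real (Suc n) *\<^sub>R x))" by (simp add: bump3_def fun_eq_iff)
      then show ?thesis unfolding P_def by (simp only: fourier_scale[OF bm of_nat_0_less_iff[THEN iffD2, OF zero_less_Suc]])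
    qed
    have "(\<lambda>n. (1 / real (Suc n)) *\<^sub>R \<xi>) \<longlonglongrightarrow> 0 *\<^sub>R \<xi>"
      using LIMSEQ_inverse_real_of_nat by (intro tendsto_intros) (simp add: inverse_eq_divide)
    from fourier_continuous[OF i1 this] have "(\<lambda>n. fourier (\<lambda>x. complex_of_real (bump3 1 0 x)) ((1 / real (Suc n)) *\<^sub>R \<xi>)) \<longlonglongrightarrow> fourier (\<lambda>x. complex_of_real (bump3 1 0 x)) 0"
      by simp
    from tendsto_imp_eventually_ne[OF this bump3_integral]
    obtain n where "fourier (\<lambda>x. complex_of_real (bump3 1 0 x)) ((1 / real (Suc n)) *\<^sub>R \<xi>) \<noteq> 0"
      by (auto dest: eventually_happens)
    then have "P n \<xi> \<noteq> 0" unfolding Pn by simp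
    moreover have "(V \<xi> - \<i> * of_real (\<xi>$j) * U \<xi>) * cnj (P n \<xi>) = 0"
      using elim[rule_format, of n] by (simp add: q_def algebra_simps)
    ultimately show ?case by simp
  qed
qed

section \<open>The Sobolev space in Fourier variables\<close>

lemma H1_L2: "u \<in> H1 \<Longrightarrow> u \<in> L2" by (simp add: H1_def)

lemma L2_of_bound:
  assumes "f \<in> L2" "g \<in> borel_measurable borel" "\<And>x. norm (g x) \<le> norm (f x)"
  shows "g \<in> L2"
  using assms by (intro L2_bound[of "\<lambda>x. (norm (f x))\<^sup>2"]) (auto simp: L2_def intro!: AE_I2 power_mono)

lemma norm_xi_components: "(norm (of_real (norm \<xi>) * z))\<^sup>2 = (\<Sum>j\<in>UNIV. (norm (\<i> * of_real ((\<xi>::real^3)$j) * z))\<^sup>2)"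
proof -
  have "(norm \<xi>)\<^sup>2 = (\<Sum>j\<in>UNIV. (\<xi>$j)\<^sup>2)" by (simp add: norm_vec_def L2_set_def sum_nonneg)
  then show ?thesis by (simp add: norm_mult power_mult_distrib sum_distrib_right)
qed

text \<open>\<open>weak_gradient\<close> is a chosen function, so the energy is computed for an
  arbitrary square-integrable weak gradient: \<open>weak_gradient_fourier\<close> fixes its
  transform almost everywhere. Conversely, surjectivity of the transform produces a weak
  gradient.\<close>

lemma H1_fourier:
  assumes u: "has_L2_fourier u U"
  shows "u \<in> H1 \<longleftrightarrow> (\<lambda>\<xi>. of_real (norm \<xi>) * U \<xi>) \<in> L2"
    and "u \<in> H1 \<Longrightarrow> A_fun u = mass (\<lambda>\<xi>. of_real (norm \<xi>) * U \<xi>) / fourier_const\<^sup>2"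
proof -
  note [measurable] = has_L2_fourierD(4)[OF u]
  have m: "(\<lambda>\<xi>. \<i> * of_real (\<xi>$j) * U \<xi>) \<in> borel_measurable borel" for j by measurable
  have fwd: "(\<lambda>\<xi>. of_real (norm \<xi>) * U \<xi>) \<in> L2 \<and> (\<integral>x. (norm (G x))\<^sup>2 \<partial>lborel) = mass (\<lambda>\<xi>. of_real (norm \<xi>) * U \<xi>) / fourier_const\<^sup>2"
    if G: "G \<in> L2" "has_weak_gradient u G" for G
  proof -
    have "\<exists>V. has_L2_fourier (\<lambda>x. G x $ j) V" for j using has_L2_fourier_exists[OF L2_vec_nth[OF G(1)]] by blast
    then obtain V where V: "\<And>j. has_L2_fourier (\<lambda>x. G x $ j) (V j)" by metis
    have ae: "AE \<xi> in lborel. V j \<xi> = \<i> * of_real (\<xi>$j) * U \<xi>" for j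
      by (rule weak_gradient_fourier[OF u G V])
    have L: "(\<lambda>\<xi>. \<i> * of_real (\<xi>$j) * U \<xi>) \<in> L2" for j
      by (rule L2_AE_cong[OF has_L2_fourierD(2)[OF V] m ae])
    have sumi: "integrable lborel (\<lambda>\<xi>. \<Sum>j\<in>UNIV. (norm (\<i> * of_real (\<xi>$j) * U \<xi>))\<^sup>2)"
      using L by (intro Bochner_Integration.integrable_sum) (simp add: L2_def)
    have 1: "(\<lambda>\<xi>. of_real (norm \<xi>) * U \<xi>) \<in> L2"
      by (rule L2_bound[OF sumi]) (auto simp: norm_xi_components)
    have "(\<integral>x. (norm (G x))\<^sup>2 \<partial>lborel) = (\<Sum>j\<in>UNIV. mass (\<lambda>x. G x $ j))"
      unfolding norm_sq_vec mass_def using L2_vec_nth[OF G(1)]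
      by (intro Bochner_Integration.integral_sum) (simp add: L2_def)
    also have "\<dots> = (\<Sum>j\<in>UNIV. mass (V j)) / fourier_const\<^sup>2"
      by (simp add: has_L2_fourier_mass[OF V] flip: sum_distrib_left)
    also have "(\<Sum>j\<in>UNIV. mass (V j)) = (\<Sum>j\<in>UNIV. mass (\<lambda>\<xi>. \<i> * of_real (\<xi>$j) * U \<xi>))"
      using has_L2_fourierD(4)[OF V] m by (intro sum.cong refl mass_AE_cong ae) auto
    also have "\<dots> = mass (\<lambda>\<xi>. of_real (norm \<xi>) * U \<xi>)"
      unfolding norm_xi_components mass_def using L
      by (intro Bochner_Integration.integral_sum[symmetric]) (simp add: L2_def)
    finally show ?thesis using 1 by blast
  qed
  show iff: "u \<in> H1 \<longleftrightarrow> (\<lambda>\<xi>. of_real (norm \<xi>) * U \<xi>) \<in> L2"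
  proof
    assume "u \<in> H1" then show "(\<lambda>\<xi>. of_real (norm \<xi>) * U \<xi>) \<in> L2" using fwd by (auto simp: H1_def)
  next
    assume N: "(\<lambda>\<xi>. of_real (norm \<xi>) * U \<xi>) \<in> L2"
    have "(\<lambda>\<xi>. \<i> * of_real (\<xi>$j) * U \<xi>) \<in> L2" for j
      by (rule L2_of_bound[OF N m]) (auto simp: norm_mult intro!: mult_right_mono component_le_norm_cart)
    then have "\<exists>g. has_L2_fourier g (\<lambda>\<xi>. \<i> * of_real (\<xi>$j) * U \<xi>)" for j using has_L2_fourier_surj by metis
    then obtain g where g: "\<And>j. has_L2_fourier (g j) (\<lambda>\<xi>. \<i> * of_real (\<xi>$j) * U \<xi>)" by metis
    have "(\<lambda>x. \<chi> j. g j x) \<in> L2" by (intro L2_vec_lambda has_L2_fourierD(1)[OF g])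
    with has_weak_gradientI[OF u g] show "u \<in> H1"
      unfolding H1_def using has_L2_fourierD(1)[OF u] by blast
  qed
  assume "u \<in> H1"
  then have "\<exists>G. G \<in> L2 \<and> has_weak_gradient u G" by (auto simp: H1_def)
  from someI_ex[OF this] have "weak_gradient u \<in> L2" "has_weak_gradient u (weak_gradient u)"
    by (auto simp: weak_gradient_def)
  from fwd[OF this] show "A_fun u = mass (\<lambda>\<xi>. of_real (norm \<xi>) * U \<xi>) / fourier_const\<^sup>2" by (simp add: A_fun_def)
qed

subsection \<open>The Sobolev inequality\<close>

text \<open>The Chemin--Xu argument: at height $\lambda$ split $u$ into the frequencies below $R_\lambda\sim\lambda^2$,
  whose contribution is at most $\lambda/2$ everywhere, and the remaining ones, to which Markov's inequality applies.\<close>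

lemma nn_integral_inverse_norm_sq:
  assumes R: "R > 0"
  shows "(\<integral>\<^sup>+\<xi>. ennreal (1 / (norm (\<xi> :: real^3))\<^sup>2) * indicator (ball 0 R) \<xi> \<partial>lborel) \<le> ennreal (3 * unit_ball_vol 3 * R)"
    (is "?I \<le> _")
proof -
  let ?c = "unit_ball_vol 3"
  let ?k = "\<lambda>(\<xi>::real^3) r. ennreal (2 / r ^ 3) * indicator {norm \<xi>..R} r"
  have c: "?c \<ge> 0" by simp
  \<comment> \<open>A substitute for polar coordinates: 1/|xi|^2 - 1/R^2 is an integral of 2/r^3
    over r. After Fubini the ball of radius r has volume proportional to r^3, which cancels the
    singularity. The boundary term contributes 1 and the integral 2 to the constant 3.\<close>
  have inner: "(\<integral>\<^sup>+r. ?k \<xi> r \<partial>lborel) = ennreal (1 / (norm \<xi>)\<^sup>2 - 1 / R\<^sup>2)" if "0 < norm \<xi>" "norm \<xi> \<le> R" for \<xi>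
  proof -
    have "(\<integral>\<^sup>+r. ?k \<xi> r \<partial>lborel) = ennreal (- 1 / R\<^sup>2 - (- 1 / (norm \<xi>)\<^sup>2))"
    proof (rule nn_integral_FTC_Icc)
      fix r assume r: "r \<in> {norm \<xi>..R}"
      then have "r > 0" 
        by (intro order.strict_trans2[OF that(1)]) simp
      then show "((\<lambda>r. - 1 / r\<^sup>2) has_real_derivative 2 / r ^ 3) (at r)"
        by (auto intro!: derivative_eq_intros simp: power2_eq_square power3_eq_cube)
      show "0 \<le> 2 / r ^ 3" using \<open>r > 0\<close> by simp
    qed (use that in auto)
    then show ?thesis by simp
  qed
  have "?I \<le> (\<integral>\<^sup>+\<xi>. ennreal (1 / R\<^sup>2) * indicator (cball 0 R) \<xi> + (\<integral>\<^sup>+r. ?k \<xi> r \<partial>lborel) \<partial>lborel)"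
  proof (rule nn_integral_mono)
    fix \<xi> :: "real^3"
    show "ennreal (1 / (norm \<xi>)\<^sup>2) * indicator (ball 0 R) \<xi> \<le> ennreal (1 / R\<^sup>2) * indicator (cball 0 R) \<xi> + (\<integral>\<^sup>+r. ?k \<xi> r \<partial>lborel)"
    proof (cases "0 < norm \<xi> \<and> norm \<xi> < R")
      case True
      then have "1 / R\<^sup>2 \<le> 1 / (norm \<xi>)\<^sup>2" using R by (intro divide_left_mono power_mono) auto
      then have "ennreal (1 / (norm \<xi>)\<^sup>2) = ennreal (1 / R\<^sup>2) + ennreal (1 / (norm \<xi>)\<^sup>2 - 1 / R\<^sup>2)"
        by (subst ennreal_plus[symmetric]) auto
      then show ?thesis using True inner[of \<xi>] by (simp add: indicator_def)
    qed (auto simp: indicator_def)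
  qed
  also have "\<dots> = ennreal (1 / R\<^sup>2) * emeasure lborel (cball (0::real^3) R) + (\<integral>\<^sup>+\<xi>. (\<integral>\<^sup>+r. ?k \<xi> r \<partial>lborel) \<partial>lborel)"
  proof (subst nn_integral_add)
    have [measurable]: "(\<lambda>\<xi>. indicator (cball 0 R) \<xi> :: ennreal) \<in> borel_measurable (lborel :: (real^3) measure)"
      by (rule borel_measurable_indicator) auto
    show "(\<lambda>\<xi>. ennreal (1 / R\<^sup>2) * indicator (cball 0 R) \<xi>) \<in> borel_measurable (lborel :: (real^3) measure)"
      by measurable
    show "(\<lambda>\<xi>. \<integral>\<^sup>+r. ?k \<xi> r \<partial>lborel) \<in> borel_measurable lborel"
      by (rule lborel.borel_measurable_nn_integral) (simp add: indicator_def case_prod_beta)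
    show "(\<integral>\<^sup>+\<xi>. ennreal (1 / R\<^sup>2) * indicator (cball (0::real^3) R) \<xi> \<partial>lborel) + (\<integral>\<^sup>+\<xi>. (\<integral>\<^sup>+r. ?k \<xi> r \<partial>lborel) \<partial>lborel)
      = ennreal (1 / R\<^sup>2) * emeasure lborel (cball (0::real^3) R) + (\<integral>\<^sup>+\<xi>. (\<integral>\<^sup>+r. ?k \<xi> r \<partial>lborel) \<partial>lborel)"
      by (subst nn_integral_cmult) auto
  qed
  also have "(\<integral>\<^sup>+\<xi>. (\<integral>\<^sup>+r. ?k \<xi> r \<partial>lborel) \<partial>lborel) = (\<integral>\<^sup>+r. (\<integral>\<^sup>+\<xi>. ?k \<xi> r \<partial>lborel) \<partial>lborel)"
    by (rule lborel_pair.Fubini'[symmetric]) (simp add: indicator_def case_prod_beta)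
  also have "\<dots> \<le> (\<integral>\<^sup>+r. ennreal (2 * ?c) * indicator {0..R} r \<partial>lborel)"
  proof (rule nn_integral_mono)
    fix r :: real
    show "(\<integral>\<^sup>+\<xi>. ?k \<xi> r \<partial>lborel) \<le> ennreal (2 * ?c) * indicator {0..R} r"
    proof (cases "0 < r \<and> r \<le> R")
      case True
      have "(\<integral>\<^sup>+\<xi>. ?k \<xi> r \<partial>lborel) = (\<integral>\<^sup>+\<xi>. ennreal (2 / r ^ 3) * indicator (cball (0::real^3) r) \<xi> \<partial>lborel)"
        using True by (intro nn_integral_cong) (auto simp: indicator_def)
      also have "\<dots> = ennreal (2 / r ^ 3) * ennreal (?c * r ^ 3)"
        using True by (subst nn_integral_cmult_indicator) (auto simp: emeasure_cball)
      also have "\<dots> = ennreal (2 * ?c)" using True c by (simp flip: ennreal_mult)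
      finally show ?thesis using True by simp
    next
      case False
      have "?k \<xi> r = 0" for \<xi>
      proof (cases "norm \<xi> \<le> r \<and> r \<le> R")
        case True
        then have "r = 0" using False norm_ge_zero[of \<xi>] by linarith
        then show ?thesis by simp
      qed (auto simp: indicator_def)
      then show ?thesis by (simp only: nn_integral_const mult_zero_left zero_le)
    qed
  qed
  also have "\<dots> = ennreal (2 * ?c * R)" using R c by (simp add: nn_integral_cmult flip: ennreal_mult)
  also have "ennreal (1 / R\<^sup>2) * emeasure lborel (cball (0::real^3) R) = ennreal (?c * R)"
    using R c by (simp add: emeasure_cball power2_eq_square power3_eq_cube flip: ennreal_mult)
  also have "ennreal (?c * R) + ennreal (2 * ?c * R) = ennreal (3 * ?c * R)"
    using R c by (simp flip: ennreal_plus)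
  finally show ?thesis by (simp add: add_left_mono)
qed

text \<open>Cauchy-Schwarz for 1/|xi| on the ball and |xi| U shows that \<open>W\<close> is
  integrable. Its inverse transform is then an explicit integral, bounded at every point and not
  just almost everywhere.\<close>

lemma low_frequency_bound:
  assumes U: "U \<in> L2" and N: "(\<lambda>\<xi>. of_real (norm \<xi>) * U \<xi>) \<in> L2" and R: "R > 0"
  defines "W \<equiv> \<lambda>\<xi>. indicator (ball 0 R - {0}) \<xi> * U \<xi>"
  obtains w where "has_L2_fourier w W"
    "\<And>x. norm (w x) \<le> sqrt (3 * unit_ball_vol 3 * R * mass (\<lambda>\<xi>. of_real (norm \<xi>) * U \<xi>)) / fourier_const\<^sup>2"
proof -
  note [measurable] = L2_measurable[OF U] 
  have [measurable]: "W \<in> borel_measurable borel" unfolding W_def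
    by (intro borel_measurable_times borel_measurable_indicator) auto
  let ?f = "\<lambda>\<xi>::real^3. indicator (ball 0 R) \<xi> / norm \<xi>" and ?g = "\<lambda>\<xi>. norm \<xi> * norm (U \<xi>)"
  have f2: "(?f \<xi>)\<^sup>2 = 1 / (norm \<xi>)\<^sup>2 * indicator (ball 0 R) \<xi>" for \<xi> by (simp add: power_divide indicator_def)
  have g2: "(?g \<xi>)\<^sup>2 = (norm (of_real (norm \<xi>) * U \<xi>))\<^sup>2" for \<xi> by (simp add: norm_mult)
  have nn: "(\<integral>\<^sup>+\<xi>. ennreal ((?f \<xi>)\<^sup>2) \<partial>lborel) \<le> ennreal (3 * unit_ball_vol 3 * R)"
  proof -
    have "ennreal ((?f \<xi>)\<^sup>2) = ennreal (1 / (norm \<xi>)\<^sup>2) * indicator (ball 0 R) \<xi>" for \<xi>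
      unfolding f2 by (simp add: indicator_def)
    then show ?thesis using nn_integral_inverse_norm_sq[OF R] by (simp only:)
  qed
  have [measurable]: "?f \<in> borel_measurable borel"
    by (intro borel_measurable_divide borel_measurable_indicator) auto
  have fi: "integrable lborel (\<lambda>\<xi>. (?f \<xi>)\<^sup>2)"
    by (rule integrableI_bounded) (use nn in \<open>auto simp: less_top[symmetric] top_unique intro: le_less_trans\<close>)
  have fle: "(\<integral>\<xi>. (?f \<xi>)\<^sup>2 \<partial>lborel) \<le> 3 * unit_ball_vol 3 * R"
    using nn nn_integral_eq_integral[OF fi] R by simp
  have gi: "integrable lborel (\<lambda>\<xi>. (?g \<xi>)\<^sup>2)" using N unfolding g2 by (simp add: L2_def)
  \<comment> \<open>The origin is removed from the support of \<open>W\<close> because there the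
    quotient 1 / norm is 0 and the product would not recover \<open>U\<close>.\<close>
  have W: "norm (W \<xi>) = \<bar>?f \<xi> * ?g \<xi>\<bar>" for \<xi>
    by (cases "\<xi> = 0") (auto simp: W_def norm_mult indicator_def)
  have Wi: "integrable lborel W"
  proof (rule Bochner_Integration.integrable_bound)
    show "integrable lborel (\<lambda>\<xi>. ?f \<xi> * ?g \<xi>)" by (rule integral_CS(1)[OF _ _ fi gi]) measurable
    show "AE \<xi> in lborel. norm (W \<xi>) \<le> norm (?f \<xi> * ?g \<xi>)" unfolding W by simp
  qed measurable
  have Wle: "(\<integral>\<xi>. norm (W \<xi>) \<partial>lborel) \<le> sqrt (3 * unit_ball_vol 3 * R * mass (\<lambda>\<xi>. of_real (norm \<xi>) * U \<xi>))"
  proof -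
    have "(\<integral>\<xi>. norm (W \<xi>) \<partial>lborel) \<le> sqrt (\<integral>\<xi>. (?f \<xi>)\<^sup>2 \<partial>lborel) * sqrt (\<integral>\<xi>. (?g \<xi>)\<^sup>2 \<partial>lborel)"
      unfolding W by (rule integral_CS(2)[OF _ _ fi gi]) measurable
    also have "\<dots> \<le> sqrt (3 * unit_ball_vol 3 * R) * sqrt (mass (\<lambda>\<xi>. of_real (norm \<xi>) * U \<xi>))"
      using fle R unfolding g2 by (intro mult_mono) (auto simp: mass_def)
    finally show ?thesis by (simp add: real_sqrt_mult)
  qed
  have WL: "W \<in> L2" unfolding W_def by (rule L2_bounded_mult(1)[where C=1, OF _ _ U]) (auto simp: indicator_def)
  have i': "integrable lborel (\<lambda>\<xi>. W (- \<xi>))" by (simp add: integral_reflect(2) Wi)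
  have "has_L2_fourier (\<lambda>\<xi>. W (- \<xi>)) (fourier (\<lambda>\<xi>. W (- \<xi>)))"
    by (rule has_L2_fourier_integrable[OF L2_reflect[OF WL] i'])
  from has_L2_fourier_cmult[OF has_L2_fourier_twice[OF this], of "of_real (1 / fourier_const\<^sup>2)"]
  have 1: "has_L2_fourier (\<lambda>x. of_real (1 / fourier_const\<^sup>2) * fourier (\<lambda>\<xi>. W (- \<xi>)) x) W" by simp
  show ?thesis
  proof (rule that[OF 1])
    fix x
    have "norm (fourier (\<lambda>\<xi>. W (- \<xi>)) x) \<le> (\<integral>\<xi>. norm (W (- \<xi>)) \<partial>lborel)" by (rule fourier_norm_le[OF i'])
    also have "\<dots> = (\<integral>\<xi>. norm (W \<xi>) \<partial>lborel)" by (rule integral_reflect(1)) measurable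
    also note Wle
    finally show "norm (of_real (1 / fourier_const\<^sup>2) * fourier (\<lambda>\<xi>. W (- \<xi>)) x) \<le> sqrt (3 * unit_ball_vol 3 * R * mass (\<lambda>\<xi>. of_real (norm \<xi>) * U \<xi>)) / fourier_const\<^sup>2"
      by (simp add: norm_mult norm_divide norm_power divide_right_mono)
  qed
qed

lemma distribution_bound:
  assumes u: "has_L2_fourier u U" and N: "(\<lambda>\<xi>. of_real (norm \<xi>) * U \<xi>) \<in> L2"
    and M: "mass (\<lambda>\<xi>. of_real (norm \<xi>) * U \<xi>) = M" "M > 0" and l: "l > 0"
  shows "ennreal (l\<^sup>2) * emeasure lborel {x. l \<le> norm (u x)} \<le>
    ennreal (4 / fourier_const\<^sup>2) * (\<integral>\<^sup>+\<xi>. ennreal ((norm (U \<xi>))\<^sup>2) * indicator {\<xi>. l\<^sup>2 * fourier_const ^ 4 \<le> 12 * unit_ball_vol 3 * M * norm \<xi>} \<xi> \<partial>lborel)"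
proof -
  define c where "c = unit_ball_vol 3"
  have c: "c > 0" by (simp add: c_def unit_ball_vol_pos)
  \<comment> \<open>Chosen so that the low-frequency bound sqrt(3 c R M) /
    \<open>fourier_const\<close>^2 equals l / 2; the high-frequency part must then carry the other
    half.\<close>
  define R where "R = l\<^sup>2 * fourier_const ^ 4 / (12 * c * M)"
  have R: "R > 0" using c M l fourier_const_pos by (simp add: R_def)
  note LU = has_L2_fourierD[OF u]
  obtain w where w: "has_L2_fourier w (\<lambda>\<xi>. indicator (ball 0 R - {0}) \<xi> * U \<xi>)"
    "\<And>x. norm (w x) \<le> sqrt (3 * c * R * M) / fourier_const\<^sup>2"
    using low_frequency_bound[OF LU(2) N R] unfolding M c_def by blast
  have "3 * c * R * M = (l * fourier_const\<^sup>2 / 2)\<^sup>2" using c M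
    by (simp add: R_def power_mult_distrib power_divide flip: power_mult)
  then have "sqrt (3 * c * R * M) = l * fourier_const\<^sup>2 / 2" using l by (simp only: real_sqrt_abs) simp
  then have wl: "norm (w x) \<le> l / 2" for x using w(2)[of x] unfolding \<open>sqrt (3 * c * R * M) = l * fourier_const\<^sup>2 / 2\<close> by simp
  define v where "v x = u x - w x" for x
  have v: "has_L2_fourier v (\<lambda>\<xi>. U \<xi> - indicator (ball 0 R - {0}) \<xi> * U \<xi>)"
    unfolding v_def by (rule has_L2_fourier_diff[OF u w(1)])
  note Lv = has_L2_fourierD[OF v]
  have [measurable]: "v \<in> borel_measurable borel" "u \<in> borel_measurable borel" "U \<in> borel_measurable borel" using Lv LU by auto
  have sub: "{x. l \<le> norm (u x)} \<subseteq> {x. l / 2 \<le> norm (v x)}"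
  proof safe
    fix x assume "l \<le> norm (u x)"
    moreover have "norm (u x) \<le> norm (v x) + norm (w x)" unfolding v_def using norm_triangle_ineq[of "u x - w x" "w x"] by simp
    ultimately show "l / 2 \<le> norm (v x)" using wl[of x] by linarith
  qed
  have "ennreal (l\<^sup>2) * emeasure lborel {x. l \<le> norm (u x)} \<le> ennreal (l\<^sup>2) * emeasure lborel {x. l / 2 \<le> norm (v x)}"
    by (intro mult_left_mono emeasure_mono sub) auto
  also have "\<dots> = (\<integral>\<^sup>+x. ennreal (l\<^sup>2) * indicator {x. l / 2 \<le> norm (v x)} x \<partial>lborel)"
    by (simp add: nn_integral_cmult)
  also have "\<dots> \<le> (\<integral>\<^sup>+x. ennreal (4 * (norm (v x))\<^sup>2) \<partial>lborel)"
  proof (rule nn_integral_mono)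
    fix x show "ennreal (l\<^sup>2) * indicator {x. l / 2 \<le> norm (v x)} x \<le> ennreal (4 * (norm (v x))\<^sup>2)"
      using power_mono[of "l / 2" "norm (v x)" 2] l by (auto simp: indicator_def power_divide intro!: ennreal_leI)
  qed
  also have "\<dots> = ennreal (4 * mass v)"
    using Lv(1) unfolding mass_def by (subst nn_integral_eq_integral) (auto simp: L2_def)
  also have "4 * mass v = 4 / fourier_const\<^sup>2 * mass (\<lambda>\<xi>. U \<xi> - indicator (ball 0 R - {0}) \<xi> * U \<xi>)"
    using has_L2_fourier_mass[OF v] by simp
  also have "ennreal (4 / fourier_const\<^sup>2 * mass (\<lambda>\<xi>. U \<xi> - indicator (ball 0 R - {0}) \<xi> * U \<xi>)) =
     ennreal (4 / fourier_const\<^sup>2) * (\<integral>\<^sup>+\<xi>. ennreal ((norm (U \<xi> - indicator (ball 0 R - {0}) \<xi> * U \<xi>))\<^sup>2) \<partial>lborel)"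
    using Lv(2) unfolding mass_def
    by (subst nn_integral_eq_integral, simp add: L2_def, simp, intro ennreal_mult) auto
  also have "\<dots> \<le> ennreal (4 / fourier_const\<^sup>2) * (\<integral>\<^sup>+\<xi>. ennreal ((norm (U \<xi>))\<^sup>2) * indicator {\<xi>. l\<^sup>2 * fourier_const ^ 4 \<le> 12 * unit_ball_vol 3 * M * norm \<xi>} \<xi> \<partial>lborel)"
  proof (intro mult_left_mono nn_integral_mono_AE)
    show "AE \<xi> in lborel. ennreal ((norm (U \<xi> - indicator (ball 0 R - {0}) \<xi> * U \<xi>))\<^sup>2) \<le> ennreal ((norm (U \<xi>))\<^sup>2) * indicator {\<xi>. l\<^sup>2 * fourier_const ^ 4 \<le> 12 * unit_ball_vol 3 * M * norm \<xi>} \<xi>"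
      using AE_lborel_singleton[of 0]
    proof eventually_elim
      case (elim \<xi>)
      show ?case
      proof (cases "norm \<xi> < R")
        case False
        then have "l\<^sup>2 * fourier_const ^ 4 \<le> 12 * c * M * norm \<xi>" 
          using c M(2) by (simp add: R_def not_less pos_divide_le_eq mult_ac)
        then show ?thesis using False by (simp add: c_def)
      qed (use elim in simp)
    qed
  qed simp
  finally show ?thesis .
qed

text \<open>Write |u|^6 as the integral of 6 l^5 over l <= |u| and insert the distribution bound.
  After exchanging integrals, 4 l^3 is integrated up to sqrt s with s proportional to M |xi|. This
  produces M^2 |xi|^2 |U|^2, whose integral is M^3.\<close>

lemma sobolev_L6_fourier:
  assumes u: "has_L2_fourier u U" and N: "(\<lambda>\<xi>. of_real (norm \<xi>) * U \<xi>) \<in> L2"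
  defines "M \<equiv> mass (\<lambda>\<xi>. of_real (norm \<xi>) * U \<xi>)"
  defines "C \<equiv> 24 / fourier_const\<^sup>2 * (12 * unit_ball_vol 3 / fourier_const ^ 4)\<^sup>2 / 4"
  shows "(\<integral>\<^sup>+x. ennreal (norm (u x) ^ 6) \<partial>lborel) \<le> ennreal (C * M ^ 3)"
proof (cases "M = 0")
  \<comment> \<open>The frequency threshold is inversely proportional to M, so M = 0 is treated
    apart; there u vanishes almost everywhere.\<close>
  case True
  note LU = has_L2_fourierD[OF u]
  have "AE \<xi> in lborel. of_real (norm \<xi>) * U \<xi> = 0" using True mass_eq_0_iff[OF N] by (simp add: M_def)
  with AE_lborel_singleton[of 0] have "AE \<xi> in lborel. U \<xi> = 0" by eventually_elim auto
  then have "mass U = 0" using mass_eq_0_iff[OF LU(2)] by simp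
  then have "mass u = 0" using has_L2_fourier_mass[OF u] by simp
  then have "AE x in lborel. u x = 0" using mass_eq_0_iff[OF LU(1)] by simp
  then have "AE x in lborel. ennreal (norm (u x) ^ 6) = 0" by eventually_elim simp
  then have "(\<integral>\<^sup>+x. ennreal (norm (u x) ^ 6) \<partial>lborel) = 0" using LU(3) by (subst nn_integral_0_iff_AE) auto
  then show ?thesis by simp
next
  case False
  then have M: "M > 0" using mass_nonneg[of "\<lambda>\<xi>. of_real (norm \<xi>) * U \<xi>"] by (simp add: M_def less_le)
  note LU = has_L2_fourierD[OF u]
  note [measurable] = LU(3,4)
  let ?c = "unit_ball_vol 3"
  have c: "?c > 0" by (simp add: unit_ball_vol_pos)
  have FTC: "(\<integral>\<^sup>+l. ennreal (real k * l ^ (k - 1)) * indicator {0..a} l \<partial>lborel) = ennreal (a ^ k)" if "a \<ge> 0" "k > 0" for a k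
  proof -
    have "(\<integral>\<^sup>+l. ennreal (real k * l ^ (k - 1)) * indicator {0..a} l \<partial>lborel) = ennreal (a ^ k - 0 ^ k)"
      by (rule nn_integral_FTC_Icc) (use that in \<open>auto intro!: derivative_eq_intros\<close>)
    then show ?thesis using that by simp
  qed
  have "(\<integral>\<^sup>+x. ennreal (norm (u x) ^ 6) \<partial>lborel) = (\<integral>\<^sup>+x. (\<integral>\<^sup>+l. ennreal (6 * l ^ 5) * indicator {0..norm (u x)} l \<partial>lborel) \<partial>lborel)"
    using FTC[of "norm (u x)" 6 for x] by (intro nn_integral_cong) simp
  also have "\<dots> = (\<integral>\<^sup>+l. (\<integral>\<^sup>+x. ennreal (6 * l ^ 5) * indicator {0..norm (u x)} l \<partial>lborel) \<partial>lborel)"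
    by (rule lborel_pair.Fubini'[symmetric]) (simp add: indicator_def case_prod_beta)
  also have "\<dots> \<le> (\<integral>\<^sup>+l. (\<integral>\<^sup>+\<xi>. ennreal (24 / fourier_const\<^sup>2 * l ^ 3) * indicator {0..} l * (ennreal ((norm (U \<xi>))\<^sup>2) * indicator {\<xi>. l\<^sup>2 * fourier_const ^ 4 \<le> 12 * ?c * M * norm \<xi>} \<xi>) \<partial>lborel) \<partial>lborel)"
  proof (rule nn_integral_mono)
    fix l :: real
    let ?J = "\<integral>\<^sup>+\<xi>. ennreal ((norm (U \<xi>))\<^sup>2) * indicator {\<xi>. l\<^sup>2 * fourier_const ^ 4 \<le> 12 * ?c * M * norm \<xi>} \<xi> \<partial>lborel"
    show "(\<integral>\<^sup>+x. ennreal (6 * l ^ 5) * indicator {0..norm (u x)} l \<partial>lborel) \<le>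
      (\<integral>\<^sup>+\<xi>. ennreal (24 / fourier_const\<^sup>2 * l ^ 3) * indicator {0..} l * (ennreal ((norm (U \<xi>))\<^sup>2) * indicator {\<xi>. l\<^sup>2 * fourier_const ^ 4 \<le> 12 * ?c * M * norm \<xi>} \<xi>) \<partial>lborel)"
    proof (cases "l > 0")
      case True
      have "(\<integral>\<^sup>+x. ennreal (6 * l ^ 5) * indicator {0..norm (u x)} l \<partial>lborel) = (\<integral>\<^sup>+x. ennreal (6 * l ^ 5) * indicator {x. l \<le> norm (u x)} x \<partial>lborel)"
        using True by (intro nn_integral_cong) (auto simp: indicator_def)
      also have "\<dots> = ennreal (6 * l ^ 3) * (ennreal (l\<^sup>2) * emeasure lborel {x. l \<le> norm (u x)})"
      proof -
        have "6 * l ^ 5 = 6 * l ^ 3 * l\<^sup>2" by (simp flip: power_add)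
        then have "ennreal (6 * l ^ 5) = ennreal (6 * l ^ 3) * ennreal (l\<^sup>2)"
          using True by (simp only:) (rule ennreal_mult, auto)
        then show ?thesis by (simp add: nn_integral_cmult mult.assoc)
      qed
      also have "\<dots> \<le> ennreal (6 * l ^ 3) * (ennreal (4 / fourier_const\<^sup>2) * ?J)"
        by (intro mult_left_mono distribution_bound[OF u N _ M True]) (auto simp: M_def)
      also have "\<dots> = ennreal (24 / fourier_const\<^sup>2 * l ^ 3) * ?J"
        using True by (subst mult.assoc[symmetric], subst ennreal_mult[symmetric]) (auto simp: mult.commute)
      also have "\<dots> = (\<integral>\<^sup>+\<xi>. ennreal (24 / fourier_const\<^sup>2 * l ^ 3) * indicator {0..} l * (ennreal ((norm (U \<xi>))\<^sup>2) * indicator {\<xi>. l\<^sup>2 * fourier_const ^ 4 \<le> 12 * ?c * M * norm \<xi>} \<xi>) \<partial>lborel)"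
        using True by (subst nn_integral_cmult) auto
      finally show ?thesis .
    next
      case False
      have "ennreal (6 * l ^ 5) * indicator {0..norm (u x)} l = 0" for x
        using False by (cases "l = 0") (auto simp: indicator_def)
      then show ?thesis by (simp only: nn_integral_const mult_zero_left zero_le)
    qed
  qed
  also have "\<dots> = (\<integral>\<^sup>+\<xi>. (\<integral>\<^sup>+l. ennreal (24 / fourier_const\<^sup>2 * l ^ 3) * indicator {0..} l * (ennreal ((norm (U \<xi>))\<^sup>2) * indicator {\<xi>. l\<^sup>2 * fourier_const ^ 4 \<le> 12 * ?c * M * norm \<xi>} \<xi>) \<partial>lborel) \<partial>lborel)"
    by (rule lborel_pair.Fubini') (simp add: indicator_def case_prod_beta)
  also have "\<dots> = (\<integral>\<^sup>+\<xi>. ennreal (C * M\<^sup>2) * ennreal ((norm (of_real (norm \<xi>) * U \<xi>))\<^sup>2) \<partial>lborel)"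
  proof (rule nn_integral_cong)
    fix \<xi> :: "real^3"
    define s where "s = 12 * ?c * M * norm \<xi> / fourier_const ^ 4"
    have s: "s \<ge> 0" using c M fourier_const_pos by (simp add: s_def)
    have iff: "l\<^sup>2 * fourier_const ^ 4 \<le> 12 * ?c * M * norm \<xi> \<longleftrightarrow> l \<le> sqrt s" if "l \<ge> 0" for l
    proof -
      have "l\<^sup>2 * fourier_const ^ 4 \<le> 12 * ?c * M * norm \<xi> \<longleftrightarrow> l\<^sup>2 \<le> s" using fourier_const_pos by (simp add: s_def pos_le_divide_eq)
      also have "\<dots> \<longleftrightarrow> l \<le> sqrt s" using that s by (metis real_le_rsqrt real_sqrt_le_iff real_sqrt_pow2 power_mono)
      finally show ?thesis .
    qed
    have "(\<integral>\<^sup>+l. ennreal (24 / fourier_const\<^sup>2 * l ^ 3) * indicator {0..} l * (ennreal ((norm (U \<xi>))\<^sup>2) * indicator {\<xi>. l\<^sup>2 * fourier_const ^ 4 \<le> 12 * ?c * M * norm \<xi>} \<xi>) \<partial>lborel)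
       = (\<integral>\<^sup>+l. ennreal (6 / fourier_const\<^sup>2 * (norm (U \<xi>))\<^sup>2) * (ennreal (4 * l ^ 3) * indicator {0..sqrt s} l) \<partial>lborel)"
    proof (rule nn_integral_cong)
      fix l :: real
      show "ennreal (24 / fourier_const\<^sup>2 * l ^ 3) * indicator {0..} l * (ennreal ((norm (U \<xi>))\<^sup>2) * indicator {\<xi>. l\<^sup>2 * fourier_const ^ 4 \<le> 12 * ?c * M * norm \<xi>} \<xi>) =
        ennreal (6 / fourier_const\<^sup>2 * (norm (U \<xi>))\<^sup>2) * (ennreal (4 * l ^ 3) * indicator {0..sqrt s} l)"
        using iff[of l] by (cases "l \<ge> 0") (auto simp: indicator_def mult_ac simp flip: ennreal_mult)
    qed
    also have "\<dots> = ennreal (6 / fourier_const\<^sup>2 * (norm (U \<xi>))\<^sup>2) * ennreal (sqrt s ^ 4)"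
      using FTC[of "sqrt s" 4] s by (subst nn_integral_cmult) auto
    also have "sqrt s ^ 4 = s\<^sup>2" using s by (metis mult_2 numeral_Bit0 power2_eq_square power_mult real_sqrt_pow2 power_add)
    also have "ennreal (6 / fourier_const\<^sup>2 * (norm (U \<xi>))\<^sup>2) * ennreal (s\<^sup>2) = ennreal (C * M\<^sup>2) * ennreal ((norm (of_real (norm \<xi>) * U \<xi>))\<^sup>2)"
    proof -
      have "6 / fourier_const\<^sup>2 * (norm (U \<xi>))\<^sup>2 * s\<^sup>2 = C * M\<^sup>2 * (norm (of_real (norm \<xi>) * U \<xi>))\<^sup>2"
        by (simp add: s_def C_def norm_mult power_mult_distrib power_divide)
      then show ?thesis by (subst (1 2) ennreal_mult[symmetric]) (auto simp: C_def)
    qed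
    finally show "(\<integral>\<^sup>+l. ennreal (24 / fourier_const\<^sup>2 * l ^ 3) * indicator {0..} l * (ennreal ((norm (U \<xi>))\<^sup>2) * indicator {\<xi>. l\<^sup>2 * fourier_const ^ 4 \<le> 12 * ?c * M * norm \<xi>} \<xi>) \<partial>lborel)
      = ennreal (C * M\<^sup>2) * ennreal ((norm (of_real (norm \<xi>) * U \<xi>))\<^sup>2)" .
  qed
  also have "\<dots> = ennreal (C * M\<^sup>2) * ennreal M"
    using N unfolding M_def mass_def by (subst nn_integral_cmult) (auto simp: L2_def nn_integral_eq_integral)
  also have "\<dots> = ennreal (C * M ^ 3)"
  proof -
    have "C \<ge> 0" unfolding C_def by simp
    then show ?thesis using M by (subst ennreal_mult[symmetric]) (auto simp: power2_eq_square power3_eq_cube)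
  qed
  finally show ?thesis .
qed

lemma sobolev_L6:
  obtains C where "C \<ge> 0" "\<And>u. u \<in> H1 \<Longrightarrow> integrable lborel (\<lambda>x. norm (u x) ^ 6) \<and> (\<integral>x. norm (u x) ^ 6 \<partial>lborel) \<le> C * A_fun u ^ 3"
proof -
  define C0 where "C0 = 24 / fourier_const\<^sup>2 * (12 * unit_ball_vol 3 / fourier_const ^ 4)\<^sup>2 / 4"
  have C0: "C0 \<ge> 0" by (simp add: C0_def)
  show ?thesis
  proof (rule that[of "C0 * (fourier_const\<^sup>2) ^ 3"])
    fix u assume uH: "u \<in> H1"
    obtain U where u: "has_L2_fourier u U" using has_L2_fourier_exists[OF H1_L2[OF uH]] .
    note [measurable] = has_L2_fourierD(3)[OF u]
    have N: "(\<lambda>\<xi>. of_real (norm \<xi>) * U \<xi>) \<in> L2" using H1_fourier(1)[OF u] uH by simp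
    have M: "mass (\<lambda>\<xi>. of_real (norm \<xi>) * U \<xi>) = fourier_const\<^sup>2 * A_fun u" using H1_fourier(2)[OF u uH] by simp
    have nn: "(\<integral>\<^sup>+x. ennreal (norm (u x) ^ 6) \<partial>lborel) \<le> ennreal (C0 * (fourier_const\<^sup>2 * A_fun u) ^ 3)"
      using sobolev_L6_fourier[OF u N] by (simp add: C0_def M)
    have i: "integrable lborel (\<lambda>x. norm (u x) ^ 6)"
      by (rule integrableI_bounded) (use nn in \<open>auto intro: le_less_trans\<close>)
    moreover have "0 \<le> C0 * (fourier_const\<^sup>2 * A_fun u) ^ 3" unfolding M[symmetric] using C0 by simp
    ultimately show "integrable lborel (\<lambda>x. norm (u x) ^ 6) \<and> (\<integral>x. norm (u x) ^ 6 \<partial>lborel) \<le> C0 * (fourier_const\<^sup>2) ^ 3 * A_fun u ^ 3"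
      using nn nn_integral_eq_integral[OF i] by (simp add: power_mult_distrib mult.assoc)
  qed (use C0 in simp)
qed

subsection \<open>The energy functionals in Fourier space\<close>

text \<open>A fixed representative of the transform; identities for it hold almost
  everywhere.\<close>

definition FT :: "(real^3 \<Rightarrow> complex) \<Rightarrow> real^3 \<Rightarrow> complex" where
  "FT f = (SOME F. has_L2_fourier f F)"

lemma has_FT: "f \<in> L2 \<Longrightarrow> has_L2_fourier f (FT f)"
  unfolding FT_def using has_L2_fourier_exists[of f] by (metis someI_ex)

lemma FT_L2: "f \<in> L2 \<Longrightarrow> FT f \<in> L2" "f \<in> L2 \<Longrightarrow> FT f \<in> borel_measurable borel"
  using has_L2_fourierD[OF has_FT] by auto

lemma FT_AE: "has_L2_fourier f F \<Longrightarrow> AE \<xi> in lborel. FT f \<xi> = F \<xi>"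
  by (rule has_L2_fourier_unique[OF has_FT]) (rule has_L2_fourierD)

lemma FT_add_AE:
  assumes "f \<in> L2" "g \<in> L2" 
  shows "AE \<xi> in lborel. FT (\<lambda>x. f x + g x) \<xi> = FT f \<xi> + FT g \<xi>"
  by (intro FT_AE has_L2_fourier_add has_FT assms)

lemma FT_cmult_AE:
  assumes "f \<in> L2" 
  shows "AE \<xi> in lborel. FT (\<lambda>x. c * f x) \<xi> = c * FT f \<xi>"
  by (intro FT_AE has_L2_fourier_cmult has_FT assms)

lemma L2_inner_AE_cong:
  assumes "f \<in> borel_measurable borel" "f' \<in> borel_measurable borel" "g \<in> borel_measurable borel" "g' \<in> borel_measurable borel"
    and "AE x in lborel. f x = f' x" "AE x in lborel. g x = g' x"
  shows "L2_inner f g = L2_inner f' g'"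
  unfolding L2_inner_def using assms(1-4) assms(5,6)
  by (intro integral_cong_AE) (auto elim!: eventually_elim2)

text \<open>The Dirichlet energy has the weight $|\xi|^2$, the interaction energy the weight $\lambda_1+\lambda_2\hat K$.\<close>

definition wform :: "(real^3 \<Rightarrow> real) \<Rightarrow> (real^3 \<Rightarrow> complex) \<Rightarrow> (real^3 \<Rightarrow> complex) \<Rightarrow> real" where
  "wform m F G = Re (\<integral>\<xi>. of_real (m \<xi>) * (F \<xi> * cnj (G \<xi>)) \<partial>lborel) / fourier_const\<^sup>2"

lemma wform_AE_cong:
  assumes [measurable]: "f \<in> borel_measurable borel" "f' \<in> borel_measurable borel" "g \<in> borel_measurable borel" "g' \<in> borel_measurable borel" "m \<in> borel_measurable borel"
    and ae: "AE x in lborel. f x = f' x" "AE x in lborel. g x = g' x"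
  shows "wform m f g = wform m f' g'"
proof -
  have "AE \<xi> in lborel. complex_of_real (m \<xi>) * (f \<xi> * cnj (g \<xi>)) = of_real (m \<xi>) * (f' \<xi> * cnj (g' \<xi>))"
    using ae by eventually_elim simp
  then have "(\<integral>\<xi>. complex_of_real (m \<xi>) * (f \<xi> * cnj (g \<xi>)) \<partial>lborel) = (\<integral>\<xi>. of_real (m \<xi>) * (f' \<xi> * cnj (g' \<xi>)) \<partial>lborel)"
    by (intro integral_cong_AE) measurable
  then show ?thesis by (simp add: wform_def)
qed

lemma wform_commute: "wform m F G = wform m G F"
proof -
  have "(\<integral>\<xi>. of_real (m \<xi>) * (F \<xi> * cnj (G \<xi>)) \<partial>lborel) = cnj (\<integral>\<xi>. of_real (m \<xi>) * (G \<xi> * cnj (F \<xi>)) \<partial>lborel)"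
    by (simp add: mult.commute flip: Bochner_Integration.integral_cnj)
  then show ?thesis by (simp add: wform_def)
qed

lemma wform_add_left:
  assumes "integrable lborel (\<lambda>\<xi>. of_real (m \<xi>) * (F \<xi> * cnj (H \<xi>)))" "integrable lborel (\<lambda>\<xi>. of_real (m \<xi>) * (G \<xi> * cnj (H \<xi>)))"
  shows "wform m (\<lambda>\<xi>. F \<xi> + G \<xi>) H = wform m F H + wform m G H"
proof -
  have "complex_of_real (m \<xi>) * ((F \<xi> + G \<xi>) * cnj (H \<xi>)) = of_real (m \<xi>) * (F \<xi> * cnj (H \<xi>)) + of_real (m \<xi>) * (G \<xi> * cnj (H \<xi>))" for \<xi>
    by (simp add: algebra_simps)
  then show ?thesis unfolding wform_def by (simp only: Bochner_Integration.integral_add[OF assms] plus_complex.sel add_divide_distrib)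
qed

lemma wform_scale_left: "wform m (\<lambda>\<xi>. of_real r * F \<xi>) G = r * wform m F G"
proof -
  have "(\<integral>\<xi>. of_real (m \<xi>) * ((of_real r * F \<xi>) * cnj (G \<xi>)) \<partial>lborel) = of_real r * (\<integral>\<xi>. of_real (m \<xi>) * (F \<xi> * cnj (G \<xi>)) \<partial>lborel)"
    unfolding integral_mult_right_zero[symmetric] by (intro Bochner_Integration.integral_cong) auto
  then show ?thesis by (simp add: wform_def)
qed

text \<open>A scalar stand-in for the gradient: its L^2 norm is \<open>fourier_const\<close> times
  that of the weak gradient, so the Dirichlet form becomes one inner product.\<close>

definition grad :: "(real^3 \<Rightarrow> complex) \<Rightarrow> real^3 \<Rightarrow> complex" where
  "grad u \<xi> = of_real (norm \<xi>) * FT u \<xi>"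

definition aform :: "(real^3 \<Rightarrow> complex) \<Rightarrow> (real^3 \<Rightarrow> complex) \<Rightarrow> real" where
  "aform u h = wform (\<lambda>\<xi>. (norm \<xi>)\<^sup>2) (FT u) (FT h)"

lemma H1_iff: "u \<in> H1 \<longleftrightarrow> u \<in> L2 \<and> grad u \<in> L2"
  using H1_fourier(1)[OF has_FT, of u] H1_L2[of u] unfolding grad_def[abs_def] by blast

lemma A_fun_grad: "u \<in> H1 \<Longrightarrow> A_fun u = mass (grad u) / fourier_const\<^sup>2"
  using H1_fourier(2)[OF has_FT, of u] H1_L2[of u] unfolding grad_def[abs_def] by blast

lemma A_fun_nonneg: "u \<in> H1 \<Longrightarrow> 0 \<le> A_fun u"
  by (simp add: A_fun_grad)

lemma aform_L2_inner: "aform u h = Re (L2_inner (grad u) (grad h)) / fourier_const\<^sup>2"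
  by (simp add: aform_def wform_def L2_inner_def grad_def power2_eq_square mult_ac)

lemma A_fun_aform: "u \<in> H1 \<Longrightarrow> A_fun u = aform u u"
  by (simp add: A_fun_grad aform_L2_inner L2_inner_self)

lemma grad_add_AE: "u \<in> L2 \<Longrightarrow> h \<in> L2 \<Longrightarrow> AE \<xi> in lborel. grad (\<lambda>x. u x + h x) \<xi> = grad u \<xi> + grad h \<xi>"
  by (rule eventually_mono[OF FT_add_AE[of u h]]) (simp_all add: grad_def distrib_left)

lemma grad_cmult_AE: "u \<in> L2 \<Longrightarrow> AE \<xi> in lborel. grad (\<lambda>x. c * u x) \<xi> = c * grad u \<xi>"
  by (rule eventually_mono[OF FT_cmult_AE[of u c]]) (simp_all add: grad_def)

lemma grad_measurable: "u \<in> L2 \<Longrightarrow> grad u \<in> borel_measurable borel"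
  using FT_L2(2)[of u] unfolding grad_def[abs_def] by measurable

lemma H1_add: 
  assumes u: "u \<in> H1" and h: "h \<in> H1" shows "(\<lambda>x. u x + h x) \<in> H1"
proof -
  have L: "u \<in> L2" "h \<in> L2" using u h by (auto simp: H1_iff)
  have "grad (\<lambda>x. u x + h x) \<in> L2"
  proof (rule L2_AE_cong)
    show "(\<lambda>\<xi>. grad u \<xi> + grad h \<xi>) \<in> L2" using u h by (intro L2_add) (simp_all add: H1_iff)
    show "AE \<xi> in lborel. grad u \<xi> + grad h \<xi> = grad (\<lambda>x. u x + h x) \<xi>"
      by (rule eventually_mono[OF grad_add_AE[OF L]]) simp
  qed (rule grad_measurable[OF L2_add[OF L]])
  then show ?thesis using L2_add[OF L] by (simp add: H1_iff)
qed

lemma H1_cmult: 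
  assumes u: "u \<in> H1" shows "(\<lambda>x. c * u x) \<in> H1"
proof -
  have L: "u \<in> L2" using u by (auto simp: H1_iff)
  have "grad (\<lambda>x. c * u x) \<in> L2"
  proof (rule L2_AE_cong)
    show "(\<lambda>\<xi>. c * grad u \<xi>) \<in> L2" using u by (intro L2_cmult) (simp add: H1_iff)
    show "AE \<xi> in lborel. c * grad u \<xi> = grad (\<lambda>x. c * u x) \<xi>"
      by (rule eventually_mono[OF grad_cmult_AE[OF L, of c]]) simp
  qed (rule grad_measurable[OF L2_cmult[OF L]])
  then show ?thesis using L2_cmult[OF L] by (simp add: H1_iff)
qed

lemma H1_diff: "u \<in> H1 \<Longrightarrow> h \<in> H1 \<Longrightarrow> (\<lambda>x. u x - h x) \<in> H1"
  using H1_add[OF _ H1_cmult[of h "-1"]] by simp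

lemma H1_scaleR: "u \<in> H1 \<Longrightarrow> (\<lambda>x. r *\<^sub>R u x) \<in> H1"
  using H1_cmult[of u "of_real r"] by (simp add: scaleR_conv_of_real)

lemma aform_commute: "aform u h = aform h u"
  by (simp add: aform_def wform_commute)

lemma aform_add_left:
  assumes "u \<in> H1" "v \<in> H1" "h \<in> H1"
  shows "aform (\<lambda>x. u x + v x) h = aform u h + aform v h"
proof -
  have L: "u \<in> L2" "v \<in> L2" "h \<in> L2" "grad u \<in> L2" "grad v \<in> L2" "grad h \<in> L2" using assms by (auto simp: H1_iff)
  have "L2_inner (grad (\<lambda>x. u x + v x)) (grad h) = L2_inner (\<lambda>\<xi>. grad u \<xi> + grad v \<xi>) (grad h)"
    using L by (intro L2_inner_AE_cong grad_add_AE grad_measurable L2_measurable L2_add) auto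
  then show ?thesis using L by (simp add: aform_L2_inner L2_inner_add_left add_divide_distrib)
qed

lemma aform_scaleR_left:
  assumes "u \<in> H1" "h \<in> H1"
  shows "aform (\<lambda>x. r *\<^sub>R u x) h = r * aform u h"
proof -
  have L: "u \<in> L2" "h \<in> L2" "grad u \<in> L2" "grad h \<in> L2" using assms by (auto simp: H1_iff)
  have "L2_inner (grad (\<lambda>x. of_real r * u x)) (grad h) = L2_inner (\<lambda>\<xi>. of_real r * grad u \<xi>) (grad h)"
    using L by (intro L2_inner_AE_cong grad_cmult_AE grad_measurable L2_measurable L2_cmult) auto
  then show ?thesis by (simp add: aform_L2_inner L2_inner_cmult_left scaleR_conv_of_real)
qed

lemma aform_bound:
  assumes "u \<in> H1" "h \<in> H1"
  shows "\<bar>aform u h\<bar> \<le> sqrt (A_fun u) * sqrt (A_fun h)"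
proof -
  have L: "grad u \<in> L2" "grad h \<in> L2" using assms by (auto simp: H1_iff)
  have "\<bar>aform u h\<bar> \<le> norm (L2_inner (grad u) (grad h)) / fourier_const\<^sup>2"
    unfolding aform_L2_inner using abs_Re_le_cmod by (simp add: divide_right_mono)
  also have "\<dots> \<le> L2_norm (grad u) * L2_norm (grad h) / fourier_const\<^sup>2"
    by (intro divide_right_mono L2_inner_CS L) auto
  also have "\<dots> = sqrt (A_fun u) * sqrt (A_fun h)"
    using assms fourier_const_pos by (simp add: A_fun_grad L2_norm_def real_sqrt_divide power2_eq_square)
  finally show ?thesis .
qed

lemma A_fun_add:
  assumes "u \<in> H1" "h \<in> H1"
  shows "A_fun (\<lambda>x. u x + h x) = A_fun u + 2 * aform u h + A_fun h"
proof -
  let ?v = "\<lambda>x. u x + h x"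
  have v: "?v \<in> H1" by (rule H1_add[OF assms])
  have "A_fun ?v = aform u ?v + aform h ?v"
    unfolding A_fun_aform[OF v] by (rule aform_add_left[OF assms v])
  also have "aform u ?v = aform u u + aform h u"
    unfolding aform_commute[of u ?v] by (rule aform_add_left[OF assms assms(1)])
  also have "aform h ?v = aform u h + aform h h"
    unfolding aform_commute[of h ?v] by (rule aform_add_left[OF assms assms(2)])
  finally show ?thesis
    using aform_commute[of h u] by (simp add: A_fun_aform assms)
qed

lemma H1_norm_bounds:
  assumes "u \<in> H1"
  shows "0 \<le> H1_norm u" "mass u \<le> (H1_norm u)\<^sup>2" "A_fun u \<le> (H1_norm u)\<^sup>2" "L2_norm u \<le> H1_norm u" "sqrt (A_fun u) \<le> H1_norm u"
  using A_fun_nonneg[OF assms] by (auto simp: H1_norm_def L2_norm_def)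

lemma H1_norm_scaleR:
  assumes u: "u \<in> H1" shows "H1_norm (\<lambda>x. r *\<^sub>R u x) = \<bar>r\<bar> * H1_norm u"
proof -
  have "mass (\<lambda>x. r *\<^sub>R u x) = r\<^sup>2 * mass u" by (simp add: mass_def power_mult_distrib)
  moreover have "A_fun (\<lambda>x. r *\<^sub>R u x) = r\<^sup>2 * A_fun u"
    unfolding A_fun_aform[OF u] A_fun_aform[OF H1_scaleR[OF u]] aform_scaleR_left[OF u H1_scaleR[OF u]]
      aform_commute[of u "\<lambda>x. r *\<^sub>R u x"] aform_scaleR_left[OF u u] by (simp add: power2_eq_square)
  ultimately show ?thesis by (simp add: H1_norm_def real_sqrt_mult flip: distrib_left)
qed

subsection \<open>The interaction energy\<close>

definition msym :: "real \<Rightarrow> real \<Rightarrow> real^3 \<Rightarrow> real" where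
  "msym l1 l2 \<xi> = l1 + l2 * dipolar_symbol \<xi>"

definition bform :: "real \<Rightarrow> real \<Rightarrow> (real^3 \<Rightarrow> complex) \<Rightarrow> (real^3 \<Rightarrow> complex) \<Rightarrow> real" where
  "bform l1 l2 f g = wform (msym l1 l2) (FT f) (FT g)"

text \<open>Supremum bound for the weight; the quotient in the dipolar symbol has modulus at most
  2.\<close>

definition msym_const :: "real \<Rightarrow> real \<Rightarrow> real" where
  "msym_const l1 l2 = \<bar>l1\<bar> + \<bar>l2\<bar> * (4 / 3 * pi * 2)"

lemma msym_const_nonneg: "0 \<le> msym_const l1 l2" by (simp add: msym_const_def)

lemma norm_sq_3: "(norm (\<xi>::real^3))\<^sup>2 = (\<xi>$1)\<^sup>2 + (\<xi>$2)\<^sup>2 + (\<xi>$3)\<^sup>2"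
  by (simp add: norm_vec_def L2_set_def sum_3)

lemma dipolar_symbol_bound: "\<bar>dipolar_symbol \<xi>\<bar> \<le> 4 / 3 * pi * 2"
proof (cases "\<xi> = 0")
  case False
  then have p: "(norm \<xi>)\<^sup>2 > 0" by simp
  have "\<bar>2 * (\<xi> $ 3)\<^sup>2 - (\<xi> $ 1)\<^sup>2 - (\<xi> $ 2)\<^sup>2\<bar> \<le> 2 * (norm \<xi>)\<^sup>2"
    unfolding norm_sq_3 by (simp add: abs_le_iff)
  then have "\<bar>(2 * (\<xi> $ 3)\<^sup>2 - (\<xi> $ 1)\<^sup>2 - (\<xi> $ 2)\<^sup>2) / (norm \<xi>)\<^sup>2\<bar> \<le> 2"
    using p by (simp add: abs_divide pos_divide_le_eq)
  then show ?thesis unfolding dipolar_symbol_def abs_mult by (intro mult_mono) auto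
qed (simp add: dipolar_symbol_def)

lemma dipolar_symbol_borel [measurable]: "dipolar_symbol \<in> borel_measurable borel"
  unfolding dipolar_symbol_def[abs_def] by measurable

lemma msym_borel [measurable]: "msym l1 l2 \<in> borel_measurable borel"
  unfolding msym_def[abs_def] by measurable

lemma msym_bound: "\<bar>msym l1 l2 \<xi>\<bar> \<le> msym_const l1 l2"
  unfolding msym_def msym_const_def
  by (rule order_trans[OF abs_triangle_ineq]) (simp add: abs_mult mult_left_mono[OF dipolar_symbol_bound, simplified])

lemma bform_integrable:
  assumes "F \<in> L2" "G \<in> L2"
  shows "integrable lborel (\<lambda>\<xi>. of_real (msym l1 l2 \<xi>) * (F \<xi> * cnj (G \<xi>)))"
proof -
  have "(\<lambda>\<xi>. of_real (msym l1 l2 \<xi>) * F \<xi>) \<in> L2"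
    by (rule L2_bounded_mult(1)[where C="msym_const l1 l2", OF _ _ assms(1)]) (use msym_bound in auto)
  from L2_prod_integrable(2)[OF this assms(2)] show ?thesis by (simp add: mult.assoc)
qed

lemma bform_commute: "bform l1 l2 f g = bform l1 l2 g f"
  by (simp add: bform_def wform_commute)

lemma bform_eqI:
  assumes "has_L2_fourier f F" "has_L2_fourier g G"
  shows "bform l1 l2 f g = wform (msym l1 l2) F G"
  unfolding bform_def using assms
  by (intro wform_AE_cong FT_L2 FT_AE has_L2_fourierD) auto

lemma bform_add_left:
  assumes "f \<in> L2" "g \<in> L2" "h \<in> L2"
  shows "bform l1 l2 (\<lambda>x. f x + g x) h = bform l1 l2 f h + bform l1 l2 g h"
  unfolding bform_eqI[OF has_L2_fourier_add[OF has_FT[OF assms(1)] has_FT[OF assms(2)]] has_FT[OF assms(3)]]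
  unfolding bform_def by (intro wform_add_left bform_integrable FT_L2 assms)

lemma bform_scale_left:
  assumes "f \<in> L2" "h \<in> L2"
  shows "bform l1 l2 (\<lambda>x. of_real r * f x) h = r * bform l1 l2 f h"
  unfolding bform_eqI[OF has_L2_fourier_cmult[OF has_FT[OF assms(1)]] has_FT[OF assms(2)]]
  unfolding bform_def by (rule wform_scale_left)

lemma bform_diff_left:
  assumes "f \<in> L2" "g \<in> L2" "h \<in> L2"
  shows "bform l1 l2 (\<lambda>x. f x - g x) h = bform l1 l2 f h - bform l1 l2 g h"
  using bform_add_left[OF assms(1) L2_cmult[OF assms(2), of "of_real (-1)"] assms(3)]
  unfolding bform_scale_left[OF assms(2,3)] by simp

lemma bform_add_right:
  assumes "f \<in> L2" "g \<in> L2" "h \<in> L2"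
  shows "bform l1 l2 h (\<lambda>x. f x + g x) = bform l1 l2 h f + bform l1 l2 h g"
  using bform_add_left[OF assms] by (simp add: bform_commute[of _ _ h])

lemma bform_scale_right:
  assumes "f \<in> L2" "h \<in> L2"
  shows "bform l1 l2 h (\<lambda>x. of_real r * f x) = r * bform l1 l2 h f"
  using bform_scale_left[OF assms] by (simp add: bform_commute[of _ _ h])

lemma bform_diff_right:
  assumes "f \<in> L2" "g \<in> L2" "h \<in> L2"
  shows "bform l1 l2 h (\<lambda>x. f x - g x) = bform l1 l2 h f - bform l1 l2 h g"
  using bform_diff_left[OF assms] by (simp add: bform_commute[of _ _ h])

lemma bform_bound:
  assumes "f \<in> L2" "g \<in> L2"
  shows "\<bar>bform l1 l2 f g\<bar> \<le> msym_const l1 l2 * L2_norm f * L2_norm g"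
proof -
  let ?F = "\<lambda>\<xi>. of_real (msym l1 l2 \<xi>) * FT f \<xi>"
  have F: "?F \<in> L2" "mass ?F \<le> (msym_const l1 l2)\<^sup>2 * mass (FT f)"
    by (rule L2_bounded_mult[where C="msym_const l1 l2", OF _ _ FT_L2(1)[OF assms(1)]]; use msym_bound in auto)+
  have n: "L2_norm ?F \<le> msym_const l1 l2 * L2_norm (FT f)"
    using real_sqrt_le_mono[OF F(2)] msym_const_nonneg by (simp add: L2_norm_def real_sqrt_mult)
  have "\<bar>bform l1 l2 f g\<bar> = \<bar>Re (L2_inner ?F (FT g))\<bar> / fourier_const\<^sup>2" by (simp add: bform_def wform_def L2_inner_def mult.assoc)
  also have "\<dots> \<le> norm (L2_inner ?F (FT g)) / fourier_const\<^sup>2" by (intro divide_right_mono abs_Re_le_cmod) auto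
  also have "\<dots> \<le> L2_norm ?F * L2_norm (FT g) / fourier_const\<^sup>2" by (intro divide_right_mono L2_inner_CS F FT_L2 assms) auto
  also have "\<dots> \<le> msym_const l1 l2 * L2_norm (FT f) * L2_norm (FT g) / fourier_const\<^sup>2" by (intro divide_right_mono mult_right_mono n) auto
  also have "\<dots> = msym_const l1 l2 * L2_norm f * L2_norm g"
    unfolding has_L2_fourier_L2_norm[OF has_FT[OF assms(1)]] has_L2_fourier_L2_norm[OF has_FT[OF assms(2)]]
    using fourier_const_pos by (simp add: power2_eq_square)
  finally show ?thesis .
qed

lemma bform_translate:
  assumes f: "f \<in> L2" and g: "g \<in> L2"
  shows "bform l1 l2 (\<lambda>x. f (x + a)) (\<lambda>x. g (x + a)) = bform l1 l2 f g"
proof -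
  have "complex_of_real m * (cis s * F * cnj (cis s * G)) = of_real m * (F * cnj G)" for m s F G
    by (simp add: cis_cnj mult_ac) (simp add: mult.assoc[symmetric] cis_mult)
  then show ?thesis
    unfolding bform_eqI[OF has_L2_fourier_translate[OF has_FT[OF f]] has_L2_fourier_translate[OF has_FT[OF g]]]
    unfolding bform_def wform_def by (simp only:)
qed

text \<open>The real symmetric bilinear map whose diagonal is the density; twice it is the
  derivative of the density at u in direction h.\<close>

definition reprod :: "(real^3 \<Rightarrow> complex) \<Rightarrow> (real^3 \<Rightarrow> complex) \<Rightarrow> real^3 \<Rightarrow> complex" where
  "reprod u h x = of_real (Re (cnj (u x) * h x))"

lemma density_reprod: "Defs.density u = reprod u u"
  by (auto simp: Defs.density_def reprod_def fun_eq_iff norm_complex_def power2_eq_square)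

lemma norm_density: "norm (Defs.density u x) = (norm (u x))\<^sup>2"
  by (simp add: Defs.density_def norm_power)

lemma density_add: "Defs.density (\<lambda>x. u x + h x) x = Defs.density u x + (of_real 2 * reprod u h x + Defs.density h x)"
  unfolding density_reprod reprod_def of_real_mult[symmetric] of_real_add[symmetric] of_real_eq_iff
  by (simp add: algebra_simps)

definition sobolev_const :: real where
  "sobolev_const = (SOME C. C \<ge> 0 \<and> (\<forall>u\<in>H1. integrable lborel (\<lambda>x. norm (u x) ^ 6) \<and> (\<integral>x. norm (u x) ^ 6 \<partial>lborel) \<le> C * A_fun u ^ 3))"

lemma sobolev_const: "sobolev_const \<ge> 0" 
  "u \<in> H1 \<Longrightarrow> integrable lborel (\<lambda>x. norm (u x) ^ 6)"
  "u \<in> H1 \<Longrightarrow> (\<integral>x. norm (u x) ^ 6 \<partial>lborel) \<le> sobolev_const * A_fun u ^ 3"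
proof -
  have "\<exists>C. C \<ge> 0 \<and> (\<forall>u\<in>H1. integrable lborel (\<lambda>x. norm (u x) ^ 6) \<and> (\<integral>x. norm (u x) ^ 6 \<partial>lborel) \<le> C * A_fun u ^ 3)"
    using sobolev_L6 by metis
  from someI_ex[OF this] show "sobolev_const \<ge> 0" 
  "u \<in> H1 \<Longrightarrow> integrable lborel (\<lambda>x. norm (u x) ^ 6)"
  "u \<in> H1 \<Longrightarrow> (\<integral>x. norm (u x) ^ 6 \<partial>lborel) \<le> sobolev_const * A_fun u ^ 3"
    unfolding sobolev_const_def[symmetric] by blast+
qed

text \<open>Cauchy-Schwarz for |u|^4 = |u| |u|^3 between L^2 and L^6. The two factors stay separate
  because in \<open>error_term\<close> the first is of order s whereas the second only tends to
  0.\<close>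

lemma density_L2:
  assumes u: "u \<in> H1"
  shows "Defs.density u \<in> L2" "mass (Defs.density u) \<le> L2_norm u * sqrt (sobolev_const * A_fun u ^ 3)"
proof -
  have uL: "u \<in> L2" by (rule H1_L2[OF u])
  note [measurable] = L2_measurable[OF uL]
  have p4: "norm (u x) ^ 4 = norm (u x) * norm (u x) ^ 3" for x by (simp add: numeral_eq_Suc)
  have p6: "(norm (u x) ^ 3)\<^sup>2 = norm (u x) ^ 6" for x by (simp flip: power_mult)
  have dm: "(norm (Defs.density u x))\<^sup>2 = norm (u x) ^ 4" for x by (simp add: norm_density flip: power_mult)
  have i2: "integrable lborel (\<lambda>x. (norm (u x))\<^sup>2)" using uL by (simp add: L2_def)
  have i6: "integrable lborel (\<lambda>x. (norm (u x) ^ 3)\<^sup>2)" unfolding p6 by (rule sobolev_const(2)[OF u])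
  have m3: "(\<lambda>x. norm (u x) ^ 3) \<in> borel_measurable lborel" "(\<lambda>x. norm (u x)) \<in> borel_measurable lborel" by measurable
  have i4: "integrable lborel (\<lambda>x. norm (u x) ^ 4)"
    unfolding p4 by (rule integral_CS(1)[OF m3(2,1) i2 i6])
  have [measurable]: "Defs.density u \<in> borel_measurable borel" unfolding Defs.density_def[abs_def] by measurable
  show "Defs.density u \<in> L2" using i4 by (simp add: L2_iff dm)
  have "mass (Defs.density u) \<le> sqrt (mass u) * sqrt (\<integral>x. (norm (u x) ^ 3)\<^sup>2 \<partial>lborel)"
    using integral_CS(2)[OF m3(2,1) i2 i6] unfolding mass_def dm p4 by simp
  also have "\<dots> \<le> sqrt (mass u) * sqrt (sobolev_const * A_fun u ^ 3)"
    unfolding p6 by (intro mult_left_mono real_sqrt_le_mono sobolev_const(3)[OF u]) auto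
  finally show "mass (Defs.density u) \<le> L2_norm u * sqrt (sobolev_const * A_fun u ^ 3)" by (simp add: L2_norm_def)
qed

definition L4_const :: real where "L4_const = sqrt (sqrt sobolev_const)"

lemma L4_const_nonneg: "0 \<le> L4_const" by (simp add: L4_const_def sobolev_const)

lemma L2_norm_density:
  assumes u: "u \<in> H1"
  shows "L2_norm (Defs.density u) \<le> L4_const * (H1_norm u)\<^sup>2"
proof -
  let ?N = "H1_norm u"
  note b = H1_norm_bounds[OF u]
  have "A_fun u ^ 3 \<le> (?N\<^sup>2) ^ 3" by (intro power_mono b A_fun_nonneg u)
  then have "sqrt (sobolev_const * A_fun u ^ 3) \<le> sqrt (sobolev_const * (?N ^ 3)\<^sup>2)"
    by (intro real_sqrt_le_mono mult_left_mono sobolev_const) (simp flip: power_mult)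
  also have "\<dots> = sqrt sobolev_const * ?N ^ 3" using b(1) unfolding real_sqrt_mult real_sqrt_abs by simp
  finally have "mass (Defs.density u) \<le> ?N * (sqrt sobolev_const * ?N ^ 3)"
    using b sobolev_const(1) A_fun_nonneg[OF u] by (intro order_trans[OF density_L2(2)[OF u]] mult_mono) auto
  also have "\<dots> = (L4_const * ?N\<^sup>2)\<^sup>2" by (simp add: L4_const_def power_mult_distrib sobolev_const numeral_eq_Suc)
  finally show ?thesis unfolding L2_norm_def using L4_const_nonneg by (intro real_le_lsqrt) auto
qed

lemma reprod_L2:
  assumes u: "u \<in> H1" and h: "h \<in> H1"
  shows "reprod u h \<in> L2" "L2_norm (reprod u h) \<le> L4_const * H1_norm u * H1_norm h"
proof -
  note [measurable] = L2_measurable[OF H1_L2[OF u]] L2_measurable[OF H1_L2[OF h]]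
  have [measurable]: "reprod u h \<in> borel_measurable borel" unfolding reprod_def[abs_def] by measurable
  note D = L2_prod_integrable(3,4)[OF density_L2(1)[OF u] density_L2(1)[OF h]]
  have le: "(norm (reprod u h x))\<^sup>2 \<le> norm (Defs.density u x) * norm (Defs.density h x)" for x
  proof -
    have "\<bar>Re (cnj (u x) * h x)\<bar> \<le> norm (u x) * norm (h x)"
      using abs_Re_le_cmod[of "cnj (u x) * h x"] by (simp add: norm_mult)
    then have "(\<bar>Re (cnj (u x) * h x)\<bar>)\<^sup>2 \<le> (norm (u x) * norm (h x))\<^sup>2" by (rule power_mono) auto
    then show ?thesis by (simp only: reprod_def norm_density power_mult_distrib norm_of_real)
  qed
  show L: "reprod u h \<in> L2"
    by (rule L2_bound[OF D(1)]) (use le in auto)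
  have "mass (reprod u h) \<le> (\<integral>x. norm (Defs.density u x) * norm (Defs.density h x) \<partial>lborel)"
    unfolding mass_def using L D le by (intro integral_mono) (auto simp: L2_def)
  also have "\<dots> \<le> L2_norm (Defs.density u) * L2_norm (Defs.density h)" by (rule D(2))
  also have "\<dots> \<le> (L4_const * (H1_norm u)\<^sup>2) * (L4_const * (H1_norm h)\<^sup>2)"
    using L2_norm_density[OF u] L2_norm_density[OF h] L4_const_nonneg by (intro mult_mono) auto
  also have "\<dots> = (L4_const * H1_norm u * H1_norm h)\<^sup>2" by (simp add: power_mult_distrib power2_eq_square mult_ac)
  finally show "L2_norm (reprod u h) \<le> L4_const * H1_norm u * H1_norm h"
    unfolding L2_norm_def using L4_const_nonneg H1_norm_bounds(1)[OF u] H1_norm_bounds(1)[OF h] by (intro real_le_lsqrt) auto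
qed

text \<open>\<open>dipolar_conv\<close> is a chosen function: surjectivity of the transform shows
  that a choice exists, and Parseval evaluates the integral for whichever function was
  chosen.\<close>

lemma B_fun_bform:
  assumes u: "u \<in> H1"
  shows "B_fun l1 l2 u = bform l1 l2 (Defs.density u) (Defs.density u)"
proof -
  let ?r = "Defs.density u" and ?d = "\<lambda>\<xi>. complex_of_real (dipolar_symbol \<xi>)"
  have r: "?r \<in> L2" by (rule density_L2[OF u])
  have "\<exists>g. \<exists>F. has_L2_fourier ?r F \<and> has_L2_fourier g (\<lambda>\<xi>. of_real (dipolar_symbol \<xi>) * F \<xi>)"
  proof -
    have "(\<lambda>\<xi>. ?d \<xi> * FT ?r \<xi>) \<in> L2"
      by (rule L2_bounded_mult(1)[where C="4 / 3 * pi * 2", OF _ _ FT_L2(1)[OF r]]) (use dipolar_symbol_bound in auto)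
    from has_L2_fourier_surj[OF this] has_FT[OF r] show ?thesis by metis
  qed
  from someI_ex[OF this, folded dipolar_conv_def]
  obtain F where F: "has_L2_fourier ?r F" and g: "has_L2_fourier (dipolar_conv ?r) (\<lambda>\<xi>. ?d \<xi> * F \<xi>)" by blast
  note FL = has_L2_fourierD(2)[OF F] has_L2_fourierD(2)[OF g]
  have 1: "(\<integral>x. dipolar_conv ?r x * ?r x \<partial>lborel) = L2_inner (dipolar_conv ?r) ?r"
    by (simp add: L2_inner_def Defs.density_def)
  have 2: "L2_inner (dipolar_conv ?r) ?r = L2_inner (\<lambda>\<xi>. ?d \<xi> * F \<xi>) F / fourier_const\<^sup>2"
    using has_L2_fourier_L2_inner[OF g F] by simp
  have 3: "(\<integral>x. (norm (u x))^4 \<partial>lborel) = mass ?r"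
    by (simp add: mass_def norm_density flip: power_mult)
  have 4: "mass ?r = Re (L2_inner F F) / fourier_const\<^sup>2" using has_L2_fourier_mass[OF F] by (simp add: L2_inner_self)
  have "of_real (msym l1 l2 \<xi>) * (F \<xi> * cnj (F \<xi>)) = of_real l1 * F \<xi> * cnj (F \<xi>) + of_real l2 * (?d \<xi> * F \<xi>) * cnj (F \<xi>)" for \<xi>
    by (simp add: msym_def algebra_simps)
  then have "(\<integral>\<xi>. of_real (msym l1 l2 \<xi>) * (F \<xi> * cnj (F \<xi>)) \<partial>lborel) = L2_inner (\<lambda>\<xi>. of_real l1 * F \<xi> + of_real l2 * (?d \<xi> * F \<xi>)) F"
    by (simp add: L2_inner_def distrib_right)
  also have "\<dots> = of_real l1 * L2_inner F F + of_real l2 * L2_inner (\<lambda>\<xi>. ?d \<xi> * F \<xi>) F"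
    by (simp only: L2_inner_add_left[OF L2_cmult[OF FL(1)] L2_cmult[OF FL(2)] FL(1)] L2_inner_cmult_left)
  finally have "bform l1 l2 ?r ?r = (l1 * Re (L2_inner F F) + l2 * Re (L2_inner (\<lambda>\<xi>. ?d \<xi> * F \<xi>) F)) / fourier_const\<^sup>2"
    unfolding bform_eqI[OF F F] wform_def by simp
  then show ?thesis unfolding B_fun_def 1 2 3 4 by (simp add: add_divide_distrib flip: of_real_power)
qed

subsection \<open>Frechet derivatives\<close>

text \<open>Makes the chosen \<open>H1_derivative\<close> computable. Along r h both remainders are
  small against r, while linearity makes the difference of the two candidates exactly proportional
  to r.\<close>

lemma has_H1_derivative_unique:
  assumes L: "has_H1_derivative F L u" and L': "has_H1_derivative F L' u" and h: "h \<in> H1"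
  shows "L h = L' h"
proof (cases "H1_norm h = 0")
  \<comment> \<open>Such an h vanishes almost everywhere but need not be the zero function, so
    scaling is useless; boundedness forces both values to be 0.\<close>
  case True
  obtain C where "\<forall>h\<in>H1. \<bar>L h\<bar> \<le> C * H1_norm h"
    using L[unfolded has_H1_derivative_def, THEN conjunct2, THEN conjunct2, THEN conjunct1] ..
  moreover obtain C' where "\<forall>h\<in>H1. \<bar>L' h\<bar> \<le> C' * H1_norm h"
    using L'[unfolded has_H1_derivative_def, THEN conjunct2, THEN conjunct2, THEN conjunct1] ..
  ultimately have "\<bar>L h\<bar> \<le> C * H1_norm h" "\<bar>L' h\<bar> \<le> C' * H1_norm h" using h by auto
  then show ?thesis using True by simp
next
  case False
  let ?N = "H1_norm h"
  have N: "?N > 0" using False H1_norm_bounds(1)[OF h] by simp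
  have "\<bar>L h - L' h\<bar> \<le> e" if "e > 0" for e
  proof -
    let ?e = "e / (2 * ?N)"
    have e: "?e > 0" using that N by simp
    obtain d where d: "d > 0" "\<And>k. k \<in> H1 \<Longrightarrow> H1_norm k < d \<Longrightarrow> \<bar>F (\<lambda>x. u x + k x) - F u - L k\<bar> \<le> ?e * H1_norm k"
      using L[unfolded has_H1_derivative_def, THEN conjunct2, THEN conjunct2, THEN conjunct2] e by meson
    obtain d' where d': "d' > 0" "\<And>k. k \<in> H1 \<Longrightarrow> H1_norm k < d' \<Longrightarrow> \<bar>F (\<lambda>x. u x + k x) - F u - L' k\<bar> \<le> ?e * H1_norm k"
      using L'[unfolded has_H1_derivative_def, THEN conjunct2, THEN conjunct2, THEN conjunct2] e by meson
    \<comment> \<open>Gives r h the norm min d d' / 2, strictly below both radii.\<close>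
    define r where "r = min d d' / (2 * ?N)"
    have r: "r > 0" using d d' N by (simp add: r_def)
    let ?k = "\<lambda>x. r *\<^sub>R h x"
    have k: "?k \<in> H1" by (rule H1_scaleR[OF h])
    have nk: "H1_norm ?k = r * ?N" using r by (simp add: H1_norm_scaleR[OF h])
    also have "r * ?N = min d d' / 2" using N by (simp add: r_def)
    finally have "H1_norm ?k < d" "H1_norm ?k < d'" using d(1) d'(1) by auto
    with d(2)[OF k] d'(2)[OF k] have "\<bar>L ?k - L' ?k\<bar> \<le> 2 * (?e * H1_norm ?k)" by linarith
    also have "\<dots> = r * e" unfolding nk using N by simp
    also have "L ?k - L' ?k = r * (L h - L' h)"
      using L[unfolded has_H1_derivative_def, THEN conjunct2, THEN conjunct1] 
        L'[unfolded has_H1_derivative_def, THEN conjunct2, THEN conjunct1] h by (simp add: right_diff_distrib)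
    finally show "\<bar>L h - L' h\<bar> \<le> e" using r by (simp add: abs_mult)
  qed
  then have "\<bar>L h - L' h\<bar> \<le> 0" by (rule field_le_epsilon) simp
  then show ?thesis by simp
qed

text \<open>A quadratic remainder is demanded on the unit ball only, because the quartic energy also
  contributes cubic and quartic terms in h.\<close>

lemma has_H1_derivativeI:
  assumes add: "\<And>h k. h \<in> H1 \<Longrightarrow> k \<in> H1 \<Longrightarrow> L (\<lambda>x. h x + k x) = L h + L k"
    and scale: "\<And>h r. h \<in> H1 \<Longrightarrow> L (\<lambda>x. r *\<^sub>R h x) = r * L h"
    and bound: "\<And>h. h \<in> H1 \<Longrightarrow> \<bar>L h\<bar> \<le> C * H1_norm h"
    and rem: "\<And>h. h \<in> H1 \<Longrightarrow> H1_norm h \<le> 1 \<Longrightarrow> \<bar>F (\<lambda>x. u x + h x) - F u - L h\<bar> \<le> K * (H1_norm h)\<^sup>2"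
  shows "has_H1_derivative F L u"
  unfolding has_H1_derivative_def
proof (intro conjI ballI allI impI)
  show "\<exists>C. \<forall>h\<in>H1. \<bar>L h\<bar> \<le> C * H1_norm h" using bound by blast
  fix e :: real assume e: "e > 0"
  define d where "d = min 1 (e / (\<bar>K\<bar> + 1))"
  show "\<exists>d>0. \<forall>h\<in>H1. H1_norm h < d \<longrightarrow> \<bar>F (\<lambda>x. u x + h x) - F u - L h\<bar> \<le> e * H1_norm h"
  proof (intro exI[of _ d] conjI ballI impI)
    show "d > 0" using e by (simp add: d_def)
    fix h assume h: "h \<in> H1" "H1_norm h < d"
    note n = H1_norm_bounds(1)[OF h(1)]
    have "\<bar>F (\<lambda>x. u x + h x) - F u - L h\<bar> \<le> K * (H1_norm h)\<^sup>2"
      using rem[OF h(1)] h(2) by (simp add: d_def)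
    also have "\<dots> \<le> (\<bar>K\<bar> + 1) * (H1_norm h)\<^sup>2" by (intro mult_right_mono) auto
    also have "\<dots> = ((\<bar>K\<bar> + 1) * H1_norm h) * H1_norm h" by (simp add: power2_eq_square)
    also have "\<dots> \<le> e * H1_norm h"
    proof (intro mult_right_mono n)
      have "H1_norm h \<le> e / (\<bar>K\<bar> + 1)" using h(2) by (simp add: d_def)
      then show "(\<bar>K\<bar> + 1) * H1_norm h \<le> e" by (simp add: pos_le_divide_eq mult.commute)
    qed
    finally show "\<bar>F (\<lambda>x. u x + h x) - F u - L h\<bar> \<le> e * H1_norm h" .
  qed
qed (auto simp: add scale)

lemma reprod_add: "reprod u (\<lambda>x. h x + k x) = (\<lambda>x. reprod u h x + reprod u k x)"
  by (auto simp: reprod_def fun_eq_iff algebra_simps)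

lemma reprod_scaleR: "reprod u (\<lambda>x. r *\<^sub>R h x) = (\<lambda>x. of_real r * reprod u h x)"
  by (auto simp: reprod_def fun_eq_iff algebra_simps)

text \<open>\<open>w\<close> is the increment of the density. The bracket collects what is at least
  quadratic in h; the term before it is the derivative.\<close>

lemma B_fun_add:
  assumes u: "u \<in> H1" and h: "h \<in> H1"
  defines "\<rho> \<equiv> Defs.density u" and "w \<equiv> \<lambda>x. of_real 2 * reprod u h x + Defs.density h x"
  shows "B_fun l1 l2 (\<lambda>x. u x + h x) = B_fun l1 l2 u + 4 * bform l1 l2 \<rho> (reprod u h)
    + (2 * bform l1 l2 \<rho> (Defs.density h) + bform l1 l2 w w)"
proof -
  have L: "\<rho> \<in> L2" "reprod u h \<in> L2" "Defs.density h \<in> L2"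
    using density_L2(1)[OF u] density_L2(1)[OF h] reprod_L2(1)[OF u h] by (auto simp: \<rho>_def)
  have wL: "w \<in> L2" unfolding w_def by (intro L2_add L2_cmult L)
  have d: "Defs.density (\<lambda>x. u x + h x) = (\<lambda>x. \<rho> x + w x)"
    by (rule ext) (simp only: density_add \<rho>_def w_def)
  have "B_fun l1 l2 (\<lambda>x. u x + h x) = bform l1 l2 \<rho> \<rho> + bform l1 l2 \<rho> w + (bform l1 l2 w \<rho> + bform l1 l2 w w)"
    unfolding B_fun_bform[OF H1_add[OF u h]] d
    by (simp only: bform_add_left[OF L(1) wL L2_add[OF L(1) wL]] bform_add_right[OF L(1) wL L(1)] bform_add_right[OF L(1) wL wL])
  also have "bform l1 l2 w \<rho> = bform l1 l2 \<rho> w" by (rule bform_commute)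
  also have "bform l1 l2 \<rho> w = 2 * bform l1 l2 \<rho> (reprod u h) + bform l1 l2 \<rho> (Defs.density h)"
    unfolding w_def by (simp only: bform_add_right[OF L2_cmult[OF L(2)] L(3) L(1)] bform_scale_right[OF L(2,1)])
  finally show ?thesis using B_fun_bform[OF u] by (simp add: \<rho>_def)
qed

text \<open>Stated for general coefficients so that E and Q are both instances.\<close>

lemma has_H1_derivative_energy:
  assumes u: "u \<in> H1"
  shows "has_H1_derivative (\<lambda>v. \<alpha> * A_fun v + \<beta> * B_fun l1 l2 v)
    (\<lambda>h. \<alpha> * (2 * aform u h) + \<beta> * (4 * bform l1 l2 (Defs.density u) (reprod u h))) u"
proof -
  define \<rho> where "\<rho> = Defs.density u"
  have rL: "\<rho> \<in> L2" unfolding \<rho>_def by (rule density_L2[OF u])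
  define Kc where "Kc = msym_const l1 l2"
  define N where "N = H1_norm u"
  have K0: "Kc \<ge> 0" "N \<ge> 0" using msym_const_nonneg H1_norm_bounds(1)[OF u] by (auto simp: Kc_def N_def)
  \<comment> \<open>Bounds the density increment by \<open>D\<close> times the norm of h as long as
    that norm is at most 1: the linear part gives the first summand, the quadratic part the
    second.\<close>
  define D where "D = 2 * L4_const * N + L4_const"
  have D0: "D \<ge> 0" using K0 L4_const_nonneg by (simp add: D_def)
  show ?thesis
    unfolding \<rho>_def[symmetric]
  proof (rule has_H1_derivativeI[where C="\<bar>\<alpha>\<bar> * (2 * N) + \<bar>\<beta>\<bar> * (4 * (Kc * L2_norm \<rho> * (L4_const * N)))"
      and K="\<bar>\<alpha>\<bar> + \<bar>\<beta>\<bar> * (2 * (Kc * L2_norm \<rho> * L4_const) + Kc * D * D)"])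
    fix h k assume h: "h \<in> H1" and k: "k \<in> H1"
    have "aform u (\<lambda>x. h x + k x) = aform u h + aform u k"
      unfolding aform_commute[of u] by (rule aform_add_left[OF h k u])
    moreover have "bform l1 l2 \<rho> (reprod u (\<lambda>x. h x + k x)) = bform l1 l2 \<rho> (reprod u h) + bform l1 l2 \<rho> (reprod u k)"
      unfolding reprod_add by (intro bform_add_right reprod_L2 u h k rL)
    ultimately show "\<alpha> * (2 * aform u (\<lambda>x. h x + k x)) + \<beta> * (4 * bform l1 l2 \<rho> (reprod u (\<lambda>x. h x + k x))) =
      \<alpha> * (2 * aform u h) + \<beta> * (4 * bform l1 l2 \<rho> (reprod u h)) + (\<alpha> * (2 * aform u k) + \<beta> * (4 * bform l1 l2 \<rho> (reprod u k)))"
      by (simp add: algebra_simps)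
  next
    fix h r assume h: "h \<in> H1"
    have "aform u (\<lambda>x. r *\<^sub>R h x) = r * aform u h"
      unfolding aform_commute[of u] by (rule aform_scaleR_left[OF h u])
    moreover have "bform l1 l2 \<rho> (reprod u (\<lambda>x. r *\<^sub>R h x)) = r * bform l1 l2 \<rho> (reprod u h)"
      unfolding reprod_scaleR by (intro bform_scale_right reprod_L2 u h rL)
    ultimately show "\<alpha> * (2 * aform u (\<lambda>x. r *\<^sub>R h x)) + \<beta> * (4 * bform l1 l2 \<rho> (reprod u (\<lambda>x. r *\<^sub>R h x))) =
      r * (\<alpha> * (2 * aform u h) + \<beta> * (4 * bform l1 l2 \<rho> (reprod u h)))"
      by (simp add: algebra_simps)
  next
    fix h assume h: "h \<in> H1"
    note n = H1_norm_bounds[OF h]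
    have a: "\<bar>aform u h\<bar> \<le> N * H1_norm h"
      using H1_norm_bounds(5)[OF u] n K0 A_fun_nonneg[OF h]
      by (intro order_trans[OF aform_bound[OF u h]] mult_mono) (auto simp: N_def)
    have "\<bar>bform l1 l2 \<rho> (reprod u h)\<bar> \<le> Kc * L2_norm \<rho> * (L4_const * N * H1_norm h)"
      using reprod_L2(2)[OF u h] K0 unfolding Kc_def N_def
      by (intro order_trans[OF bform_bound[OF rL reprod_L2(1)[OF u h]]] mult_left_mono) auto
    then have b: "\<bar>bform l1 l2 \<rho> (reprod u h)\<bar> \<le> Kc * L2_norm \<rho> * (L4_const * N) * H1_norm h" by (simp add: mult.assoc)
    have "\<bar>\<alpha> * (2 * aform u h) + \<beta> * (4 * bform l1 l2 \<rho> (reprod u h))\<bar>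
      \<le> \<bar>\<alpha>\<bar> * (2 * \<bar>aform u h\<bar>) + \<bar>\<beta>\<bar> * (4 * \<bar>bform l1 l2 \<rho> (reprod u h)\<bar>)"
      by (rule order_trans[OF abs_triangle_ineq]) (simp add: abs_mult)
    also have "\<dots> \<le> \<bar>\<alpha>\<bar> * (2 * (N * H1_norm h)) + \<bar>\<beta>\<bar> * (4 * (Kc * L2_norm \<rho> * (L4_const * N) * H1_norm h))"
      using a b by (intro add_mono mult_left_mono) auto
    finally show "\<bar>\<alpha> * (2 * aform u h) + \<beta> * (4 * bform l1 l2 \<rho> (reprod u h))\<bar>
      \<le> (\<bar>\<alpha>\<bar> * (2 * N) + \<bar>\<beta>\<bar> * (4 * (Kc * L2_norm \<rho> * (L4_const * N)))) * H1_norm h"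
      by (simp add: algebra_simps)
  next
    fix h assume h: "h \<in> H1" and h1: "H1_norm h \<le> 1"
    note n = H1_norm_bounds[OF h]
    let ?n = "H1_norm h" and ?d = "Defs.density h"
    define w where "w = (\<lambda>x. of_real 2 * reprod u h x + ?d x)"
    have dL: "?d \<in> L2" by (rule density_L2[OF h])
    have rhL: "reprod u h \<in> L2" by (rule reprod_L2[OF u h])
    have wL: "w \<in> L2" unfolding w_def by (intro L2_add L2_cmult dL rhL)
    have "L2_norm w \<le> norm (complex_of_real 2) * L2_norm (reprod u h) + L2_norm ?d"
      unfolding w_def L2_norm_cmult[symmetric] by (intro L2_norm_triangle L2_cmult rhL dL)
    also have "\<dots> \<le> 2 * (L4_const * N * ?n) + L4_const * ?n\<^sup>2"
      using reprod_L2(2)[OF u h] L2_norm_density[OF h] by (simp add: N_def)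
    also have "L4_const * ?n\<^sup>2 \<le> L4_const * ?n"
      using n(1) h1 L4_const_nonneg by (intro mult_left_mono) (auto simp: power2_eq_square mult_left_le)
    finally have nw: "L2_norm w \<le> D * ?n" by (simp add: D_def algebra_simps)
    have "\<bar>bform l1 l2 w w\<bar> \<le> Kc * L2_norm w * L2_norm w" unfolding Kc_def by (rule bform_bound[OF wL wL])
    also have "\<dots> \<le> Kc * (D * ?n) * (D * ?n)" using nw K0 D0 n(1) by (intro mult_mono) auto
    finally have bw: "\<bar>bform l1 l2 w w\<bar> \<le> Kc * D * D * ?n\<^sup>2" by (simp add: power2_eq_square mult_ac)
    have "\<bar>bform l1 l2 \<rho> ?d\<bar> \<le> Kc * L2_norm \<rho> * L2_norm ?d" unfolding Kc_def by (rule bform_bound[OF rL dL])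
    also have "\<dots> \<le> Kc * L2_norm \<rho> * (L4_const * ?n\<^sup>2)" using L2_norm_density[OF h] K0 by (intro mult_left_mono) auto
    finally have bd: "\<bar>bform l1 l2 \<rho> ?d\<bar> \<le> Kc * L2_norm \<rho> * L4_const * ?n\<^sup>2" by (simp add: mult.assoc)
    have eq: "\<alpha> * A_fun (\<lambda>x. u x + h x) + \<beta> * B_fun l1 l2 (\<lambda>x. u x + h x) - (\<alpha> * A_fun u + \<beta> * B_fun l1 l2 u)
       - (\<alpha> * (2 * aform u h) + \<beta> * (4 * bform l1 l2 \<rho> (reprod u h)))
       = \<alpha> * A_fun h + \<beta> * (2 * bform l1 l2 \<rho> ?d + bform l1 l2 w w)"
      unfolding A_fun_add[OF u h] B_fun_add[OF u h] \<rho>_def[symmetric] w_def[symmetric] by (simp add: algebra_simps)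
    have "\<bar>\<alpha> * A_fun h + \<beta> * (2 * bform l1 l2 \<rho> ?d + bform l1 l2 w w)\<bar>
      \<le> \<bar>\<alpha>\<bar> * A_fun h + \<bar>\<beta>\<bar> * (2 * \<bar>bform l1 l2 \<rho> ?d\<bar> + \<bar>bform l1 l2 w w\<bar>)"
      using A_fun_nonneg[OF h] by (intro order_trans[OF abs_triangle_ineq] add_mono) (auto simp: abs_mult intro!: mult_left_mono)
    also have "\<dots> \<le> \<bar>\<alpha>\<bar> * ?n\<^sup>2 + \<bar>\<beta>\<bar> * (2 * (Kc * L2_norm \<rho> * L4_const * ?n\<^sup>2) + Kc * D * D * ?n\<^sup>2)"
      using bd bw n(3) by (intro add_mono mult_left_mono) auto
    finally show "\<bar>\<alpha> * A_fun (\<lambda>x. u x + h x) + \<beta> * B_fun l1 l2 (\<lambda>x. u x + h x) - (\<alpha> * A_fun u + \<beta> * B_fun l1 l2 u)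
       - (\<alpha> * (2 * aform u h) + \<beta> * (4 * bform l1 l2 \<rho> (reprod u h)))\<bar>
       \<le> (\<bar>\<alpha>\<bar> + \<bar>\<beta>\<bar> * (2 * (Kc * L2_norm \<rho> * L4_const) + Kc * D * D)) * ?n\<^sup>2"
      unfolding eq by (simp add: algebra_simps)
  qed
qed

lemma H1_derivative_energy:
  assumes u: "u \<in> H1" and h: "h \<in> H1"
  shows "H1_derivative (\<lambda>v. \<alpha> * A_fun v + \<beta> * B_fun l1 l2 v) u h
    = \<alpha> * (2 * aform u h) + \<beta> * (4 * bform l1 l2 (Defs.density u) (reprod u h))"
proof -
  note d = has_H1_derivative_energy[OF u, of \<alpha> \<beta> l1 l2]
  have "has_H1_derivative (\<lambda>v. \<alpha> * A_fun v + \<beta> * B_fun l1 l2 v) (H1_derivative (\<lambda>v. \<alpha> * A_fun v + \<beta> * B_fun l1 l2 v) u) u"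
    unfolding H1_derivative_def by (rule someI[of "\<lambda>L. has_H1_derivative _ L u", OF d])
  from has_H1_derivative_unique[OF this d h] show ?thesis .
qed

lemma E_derivative:
  assumes "u \<in> H1" "h \<in> H1"
  shows "H1_derivative (E_fun l1 l2) u h = aform u h + 2 * bform l1 l2 (Defs.density u) (reprod u h)"
  using H1_derivative_energy[OF assms, of "1/2" "1/2" l1 l2] by (simp add: E_fun_def[abs_def])

lemma Q_derivative:
  assumes "u \<in> H1" "h \<in> H1"
  shows "H1_derivative (Q_fun l1 l2) u h = 2 * aform u h + 6 * bform l1 l2 (Defs.density u) (reprod u h)"
  using H1_derivative_energy[OF assms, of "1" "3/2" l1 l2] by (simp add: Q_fun_def[abs_def])

subsection \<open>A discrete dilation vector field\<close>

text \<open>The generator $x_j\partial_j+\frac12$ of dilations is replaced by an antisymmetric bounded operator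
  built from the translation by $s$ and the multiplication by $\sin(\varepsilon x_j)/\varepsilon$. Both have explicit
  Fourier transforms, and the result stays in $H^1$ without any decay or regularity of the argument.\<close>

definition phi :: "3 \<Rightarrow> real \<Rightarrow> real^3 \<Rightarrow> real" where
  "phi j e x = sin (e * x$j) / e"

definition dil :: "3 \<Rightarrow> real \<Rightarrow> real \<Rightarrow> (real^3 \<Rightarrow> complex) \<Rightarrow> real^3 \<Rightarrow> complex" where
  "dil j e s f x = of_real (phi j e x) * f (x + s *\<^sub>R axis j 1) - of_real (phi j e (x - s *\<^sub>R axis j 1)) * f (x - s *\<^sub>R axis j 1)"

text \<open>Coefficient of the frequency shift by e in the transform of \<open>dil\<close>. The
  first phase is evaluated at the shifted frequency, since there the translation acts before the
  multiplication; in the second term the order is reversed.\<close>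

definition dil_mult :: "real \<Rightarrow> real \<Rightarrow> real \<Rightarrow> complex" where
  "dil_mult e s t = cis (s * (t - e)) - cis (- (s * t))"

definition fdil :: "3 \<Rightarrow> real \<Rightarrow> real \<Rightarrow> (real^3 \<Rightarrow> complex) \<Rightarrow> real^3 \<Rightarrow> complex" where
  "fdil j e s F \<xi> = (dil_mult e s (\<xi>$j) * F (\<xi> - e *\<^sub>R axis j 1) - dil_mult (- e) s (\<xi>$j) * F (\<xi> + e *\<^sub>R axis j 1)) / (2 * \<i> * of_real e)"

lemma inner_scale_axis: "(r *\<^sub>R axis j 1) \<bullet> \<xi> = r * \<xi>$j" "\<xi> \<bullet> (r *\<^sub>R axis j 1) = r * \<xi>$j" for \<xi> :: "real^3"
  by (simp_all add: inner_axis inner_axis' )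

lemma axis_component: "(x + r *\<^sub>R axis j 1)$j = x$j + r" "(x - r *\<^sub>R axis j 1)$j = x$j - r" for x :: "real^3"
  by (simp_all add: axis_def)

lemma phi_borel [measurable]: "phi j e \<in> borel_measurable borel"
  unfolding phi_def[abs_def] by measurable

lemma phi_bound: "e > 0 \<Longrightarrow> \<bar>phi j e x\<bar> \<le> 1 / e"
  by (simp add: phi_def abs_divide divide_right_mono)

text \<open>The sine is a difference of two characters divided by 2 i, and each character shifts the
  frequency.\<close>

lemma has_fourier_phi:
  assumes f: "has_L2_fourier f F" and e: "e \<noteq> 0"
  shows "has_L2_fourier (\<lambda>x. of_real (phi j e x) * f x) (\<lambda>\<xi>. (F (\<xi> - e *\<^sub>R axis j 1) - F (\<xi> + e *\<^sub>R axis j 1)) / (2 * \<i> * of_real e))"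
proof -
  have c: "of_real (phi j e x) = 1 / (2 * \<i> * of_real e) * (cis (x \<bullet> (e *\<^sub>R axis j 1)) - cis (x \<bullet> ((- e) *\<^sub>R axis j 1)))" for x
    unfolding inner_scale_axis phi_def by (simp add: complex_eq_iff Re_divide Im_divide field_simps power2_eq_square)
  have "has_L2_fourier (\<lambda>x. 1 / (2 * \<i> * of_real e) * (cis (x \<bullet> (e *\<^sub>R axis j 1)) * f x - cis (x \<bullet> ((- e) *\<^sub>R axis j 1)) * f x))
     (\<lambda>\<xi>. 1 / (2 * \<i> * of_real e) * (F (\<xi> - e *\<^sub>R axis j 1) - F (\<xi> - (- e) *\<^sub>R axis j 1)))"
    by (intro has_L2_fourier_cmult has_L2_fourier_diff has_L2_fourier_modulate f)
  then show ?thesis unfolding c by (simp add: algebra_simps diff_divide_distrib)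
qed

lemma has_fourier_dil:
  assumes f: "has_L2_fourier f F" and e: "e \<noteq> 0"
  shows "has_L2_fourier (dil j e s f) (fdil j e s F)"
proof -
  have "has_L2_fourier (\<lambda>x. of_real (phi j e x) * f (x + s *\<^sub>R axis j 1) - of_real (phi j e (x + (- s) *\<^sub>R axis j 1)) * f (x + (- s) *\<^sub>R axis j 1))
    (\<lambda>\<xi>. (cis ((s *\<^sub>R axis j 1) \<bullet> (\<xi> - e *\<^sub>R axis j 1)) * F (\<xi> - e *\<^sub>R axis j 1) - cis ((s *\<^sub>R axis j 1) \<bullet> (\<xi> + e *\<^sub>R axis j 1)) * F (\<xi> + e *\<^sub>R axis j 1)) / (2 * \<i> * of_real e)
      - cis (((- s) *\<^sub>R axis j 1) \<bullet> \<xi>) * ((F (\<xi> - e *\<^sub>R axis j 1) - F (\<xi> + e *\<^sub>R axis j 1)) / (2 * \<i> * of_real e)))"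
    by (rule has_L2_fourier_diff[OF has_fourier_phi[OF has_L2_fourier_translate[OF f] e] has_L2_fourier_translate[OF has_fourier_phi[OF f e]]])
  moreover have "(\<lambda>\<xi>. (cis ((s *\<^sub>R axis j 1) \<bullet> (\<xi> - e *\<^sub>R axis j 1)) * F (\<xi> - e *\<^sub>R axis j 1) - cis ((s *\<^sub>R axis j 1) \<bullet> (\<xi> + e *\<^sub>R axis j 1)) * F (\<xi> + e *\<^sub>R axis j 1)) / (2 * \<i> * of_real e)
      - cis (((- s) *\<^sub>R axis j 1) \<bullet> \<xi>) * ((F (\<xi> - e *\<^sub>R axis j 1) - F (\<xi> + e *\<^sub>R axis j 1)) / (2 * \<i> * of_real e))) = fdil j e s F"
  proof
    fix \<xi> :: "real^3"
    have "(a * X - b * Y) / d - c * ((X - Y) / d) = ((a - c) * X - (b - c) * Y) / d" for a b c d X Y :: complex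
      by (simp add: divide_simps) (simp add: algebra_simps)
    then show "(cis ((s *\<^sub>R axis j 1) \<bullet> (\<xi> - e *\<^sub>R axis j 1)) * F (\<xi> - e *\<^sub>R axis j 1) - cis ((s *\<^sub>R axis j 1) \<bullet> (\<xi> + e *\<^sub>R axis j 1)) * F (\<xi> + e *\<^sub>R axis j 1)) / (2 * \<i> * of_real e)
      - cis (((- s) *\<^sub>R axis j 1) \<bullet> \<xi>) * ((F (\<xi> - e *\<^sub>R axis j 1) - F (\<xi> + e *\<^sub>R axis j 1)) / (2 * \<i> * of_real e)) = fdil j e s F \<xi>"
      unfolding fdil_def dil_mult_def inner_scale_axis axis_component by (simp only: minus_mult_left[symmetric] diff_minus_eq_add)
  qed
  ultimately show ?thesis by (simp add: dil_def[abs_def])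
qed

lemma norm_cis_diff_le: "norm (cis a - cis b) \<le> \<bar>a - b\<bar>"
proof -
  have "(norm (cis a - cis b))\<^sup>2 = 2 - 2 * cos (a - b)"
    unfolding cmod_power2 by (simp add: power2_diff cos_diff algebra_simps sin_squared_eq)
  also have "\<dots> = (2 * sin ((a - b) / 2))\<^sup>2"
  proof -
    have "2 * ((a - b) / 2) = a - b" by simp
    from cos_double_sin[of "(a - b) / 2", unfolded this] show ?thesis by (simp add: power_mult_distrib)
  qed
  also have "\<dots> \<le> (a - b)\<^sup>2"
    using power_mono[OF abs_sin_x_le_abs_x[of "(a - b) / 2"], of 2] by (simp add: power_mult_distrib power_divide)
  finally have "(norm (cis a - cis b))\<^sup>2 \<le> \<bar>a - b\<bar>\<^sup>2" by simp
  then show ?thesis by (rule power2_le_imp_le) simp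
qed

text \<open>The constant bound gives integrability at fixed s. The other one, chord against arc
  between the angles s (t - e) and -s t, dominates the quotient by s.\<close>

lemma dil_mult_bounds: "norm (dil_mult e s t) \<le> 2" "s > 0 \<Longrightarrow> norm (dil_mult e s t) \<le> s * \<bar>2 * t - e\<bar>"
proof -
  show "norm (dil_mult e s t) \<le> 2" unfolding dil_mult_def by (rule order_trans[OF norm_triangle_ineq4]) simp
  assume s: "s > 0"
  have eq: "\<bar>s * (t - e) - - (s * t)\<bar> = s * \<bar>2 * t - e\<bar>"
  proof -
    have "s * (t - e) - - (s * t) = s * (2 * t - e)" by (simp add: algebra_simps)
    then show ?thesis using s by (simp only: abs_mult abs_of_pos)
  qed
  show "norm (dil_mult e s t) \<le> s * \<bar>2 * t - e\<bar>" unfolding dil_mult_def eq[symmetric] by (rule norm_cis_diff_le)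
qed

text \<open>The antisymmetry of the operator seen in frequency: it links the coefficients of the two
  opposite shifts.\<close>

lemma dil_mult_cnj: "cnj (dil_mult (- e) s (t - e)) = - dil_mult e s t"
  by (simp add: dil_mult_def cis_cnj)

lemma dil_mult_borel [measurable]: "dil_mult e s \<in> borel_measurable borel"
  unfolding dil_mult_def[abs_def] by measurable

lemma dil_mult_tendsto:
  assumes s: "s \<longlonglongrightarrow> 0" "\<And>n. s n > 0"
  shows "(\<lambda>n. cnj (dil_mult e (s n) t) / of_real (s n)) \<longlonglongrightarrow> - \<i> * of_real (2 * t - e)"
proof -
  have d: "(\<lambda>n. (cis (s n * a) - 1) / of_real (s n)) \<longlonglongrightarrow> \<i> * of_real a" for a
  proof -
    have "((\<lambda>z. exp (\<i> * of_real a * z)) has_field_derivative (\<i> * of_real a)) (at 0)"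
      by (auto intro!: derivative_eq_intros)
    then have "((\<lambda>z. (exp (\<i> * of_real a * z) - 1) / z) \<longlongrightarrow> \<i> * of_real a) (at 0)" by (simp add: DERIV_def)
    moreover have "filterlim (\<lambda>n. complex_of_real (s n)) (at 0) sequentially"
      unfolding filterlim_at using tendsto_of_real[OF s(1), where 'a=complex] s(2) by (auto simp: less_imp_neq[symmetric])
    ultimately have "(\<lambda>n. (exp (\<i> * of_real a * of_real (s n)) - 1) / of_real (s n)) \<longlonglongrightarrow> \<i> * of_real a"
      by (rule filterlim_compose)
    then show ?thesis by (simp add: cis_conv_exp mult_ac)
  qed
  have "(\<lambda>n. cnj ((cis (s n * (t - e)) - 1) / of_real (s n) - (cis (s n * (- t)) - 1) / of_real (s n))) \<longlonglongrightarrow> cnj (\<i> * of_real (t - e) - \<i> * of_real (- t))"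
    by (intro tendsto_intros d)
  moreover have "cnj ((cis (s n * (t - e)) - 1) / of_real (s n) - (cis (s n * (- t)) - 1) / of_real (s n)) = cnj (dil_mult e (s n) t) / of_real (s n)" for n
    by (simp add: dil_mult_def diff_divide_distrib)
  moreover have "cnj (\<i> * of_real (t - e) - \<i> * of_real (- t)) = - \<i> * of_real (2 * t - e)" by (simp add: algebra_simps)
  ultimately show ?thesis by (simp only:)
qed

section \<open>Weighted forms paired with the discrete dilation\<close>

text \<open>Translating the variable in the summand with the opposite shift gives both summands the
  same product of F and its shift. By \<open>dil_mult_cnj\<close> their coefficients are conjugate
  up to sign, and the real part leaves the difference of the weight at xi and xi - E.\<close>

lemma wform_fdil:
  fixes j :: 3 and F :: "real^3 \<Rightarrow> complex" and W :: "real^3 \<Rightarrow> real" and e :: real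
  assumes [measurable]: "F \<in> borel_measurable borel" "W \<in> borel_measurable borel" and e: "e > 0"
  defines "E \<equiv> e *\<^sub>R axis j (1::real) :: real^3"
  assumes i1: "integrable lborel (\<lambda>\<xi>. of_real (W \<xi>) * (F \<xi> * cnj (F (\<xi> - E))))"
    and i2: "integrable lborel (\<lambda>\<xi>. of_real (W (\<xi> - E)) * (F \<xi> * cnj (F (\<xi> - E))))"
  shows "wform W F (fdil j e s F) = 
    Re (\<integral>\<xi>. \<i> / (2 * of_real e) * (of_real (W \<xi> - W (\<xi> - E)) * cnj (dil_mult e s (\<xi>$j)) * (F \<xi> * cnj (F (\<xi> - E)))) \<partial>lborel) / fourier_const\<^sup>2"
proof -
  let ?Z = "\<lambda>\<xi>. F \<xi> * cnj (F (\<xi> - E))" and ?c = "\<lambda>\<xi>::real^3. dil_mult e s (\<xi>$j)"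
  have bdd: "integrable lborel (\<lambda>\<xi>. k \<xi> * g \<xi>)" 
    if "integrable lborel g" and [measurable]: "k \<in> borel_measurable borel" and "\<And>\<xi>. norm (k \<xi>) \<le> 2" for k g :: "real^3 \<Rightarrow> complex"
    by (rule Bochner_Integration.integrable_bound[OF integrable_mult_right[OF integrable_norm[OF that(1)], of 2]])
       (use that borel_measurable_integrable[OF that(1)] in \<open>auto simp: norm_mult intro!: mult_right_mono\<close>)
  have j1: "integrable lborel (\<lambda>\<xi>. cnj (?c \<xi>) * (of_real (W \<xi>) * ?Z \<xi>))"
    by (rule bdd[OF i1]) (auto simp: dil_mult_bounds)
  have j2: "integrable lborel (\<lambda>\<xi>. cnj (?c \<xi>) * (of_real (W (\<xi> - E)) * ?Z \<xi>))"
    by (rule bdd[OF i2]) (auto simp: dil_mult_bounds)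
  define h where "h \<xi> = cnj (dil_mult (- e) s (\<xi>$j)) * of_real (W \<xi>) * (F \<xi> * cnj (F (\<xi> + E)))" for \<xi>
  have hm[measurable]: "h \<in> borel_measurable borel" unfolding h_def by measurable
  have hE: "h (\<xi> + - E) = - cnj (cnj (?c \<xi>) * (of_real (W (\<xi> - E)) * ?Z \<xi>))" for \<xi>
    by (simp add: h_def axis_component E_def dil_mult_cnj mult_ac)
  have hi: "integrable lborel h"
    unfolding integral_translate(2)[OF hm, of "- E", symmetric] hE by (intro Bochner_Integration.integrable_minus integrable_bounded_linear[OF bounded_linear_cnj j2])
  have hI: "(\<integral>\<xi>. h \<xi> \<partial>lborel) = - cnj (\<integral>\<xi>. cnj (?c \<xi>) * (of_real (W (\<xi> - E)) * ?Z \<xi>) \<partial>lborel)"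
    unfolding integral_translate(1)[OF hm, of "- E", symmetric] hE by (simp only: Bochner_Integration.integral_minus Bochner_Integration.integral_cnj)
  let ?I1 = "\<integral>\<xi>. cnj (?c \<xi>) * (of_real (W \<xi>) * ?Z \<xi>) \<partial>lborel" and ?I2 = "\<integral>\<xi>. cnj (?c \<xi>) * (of_real (W (\<xi> - E)) * ?Z \<xi>) \<partial>lborel"
  have "of_real (W \<xi>) * (F \<xi> * cnj (fdil j e s F \<xi>)) = \<i> / (2 * of_real e) * (cnj (?c \<xi>) * (of_real (W \<xi>) * ?Z \<xi>) - h \<xi>)" for \<xi>
    using e by (simp add: fdil_def h_def E_def field_simps)
  then have "(\<integral>\<xi>. of_real (W \<xi>) * (F \<xi> * cnj (fdil j e s F \<xi>)) \<partial>lborel) = \<i> / (2 * of_real e) * (?I1 + cnj ?I2)"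
    by (simp only: integral_mult_right_zero Bochner_Integration.integral_diff[OF j1 hi] hI diff_minus_eq_add)
  then have "wform W F (fdil j e s F) = Re (\<i> / (2 * of_real e) * (?I1 + cnj ?I2)) / fourier_const\<^sup>2" by (simp add: wform_def)
  \<comment> \<open>Multiplication by i selects the imaginary part up to sign, and conjugation
    reverses that sign.\<close>
  also have "Re (\<i> / (2 * of_real e) * (?I1 + cnj ?I2)) = Re (\<i> / (2 * of_real e) * (?I1 - ?I2))"
    by (simp add: complex_eq_iff Re_divide Im_divide)
  also have "?I1 - ?I2 = (\<integral>\<xi>. of_real (W \<xi> - W (\<xi> - E)) * cnj (?c \<xi>) * ?Z \<xi> \<partial>lborel)"
    unfolding Bochner_Integration.integral_diff[OF j1 j2, symmetric]
    by (intro Bochner_Integration.integral_cong) (auto simp: algebra_simps)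
  finally show ?thesis by (simp only: integral_mult_right_zero)
qed

text \<open>The discrete version of the weight xi_j d_j W: a backward difference quotient of W times
  the midpoint xi_j - e / 2, against F and its shift.\<close>

definition dform :: "(real^3 \<Rightarrow> real) \<Rightarrow> 3 \<Rightarrow> real \<Rightarrow> (real^3 \<Rightarrow> complex) \<Rightarrow> real" where
  "dform W j e F = Re (\<integral>\<xi>. of_real ((W \<xi> - W (\<xi> - e *\<^sub>R axis j 1)) * (2 * \<xi>$j - e) / (2 * e)) * (F \<xi> * cnj (F (\<xi> - e *\<^sub>R axis j 1))) \<partial>lborel) / fourier_const\<^sup>2"

text \<open>By the second part of \<open>dil_mult_bounds\<close> the integrand at every s is
  dominated by the modulus of its own limit, whose integrability is the third integrability
  hypothesis.\<close>

lemma wform_fdil_tendsto: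
  fixes j :: 3 and F :: "real^3 \<Rightarrow> complex" and W :: "real^3 \<Rightarrow> real" and e :: real
  assumes [measurable]: "F \<in> borel_measurable borel" "W \<in> borel_measurable borel" and e: "e > 0"
  defines "E \<equiv> e *\<^sub>R axis j (1::real) :: real^3"
  assumes i1: "integrable lborel (\<lambda>\<xi>. of_real (W \<xi>) * (F \<xi> * cnj (F (\<xi> - E))))"
    and i2: "integrable lborel (\<lambda>\<xi>. of_real (W (\<xi> - E)) * (F \<xi> * cnj (F (\<xi> - E))))"
    and i3: "integrable lborel (\<lambda>\<xi>. of_real ((W \<xi> - W (\<xi> - E)) * (2 * \<xi>$j - e) / (2 * e)) * (F \<xi> * cnj (F (\<xi> - E))))"
    and s: "s \<longlonglongrightarrow> 0" "\<And>n. s n > 0"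
  shows "(\<lambda>n. wform W F (fdil j e (s n) F) / s n) \<longlonglongrightarrow> dform W j e F"
proof -
  let ?Z = "\<lambda>\<xi>. F \<xi> * cnj (F (\<xi> - E))"
  let ?g = "\<lambda>n \<xi>. \<i> / (2 * of_real e) * (of_real (W \<xi> - W (\<xi> - E)) * (cnj (dil_mult e (s n) (\<xi>$j)) / of_real (s n)) * ?Z \<xi>)"
  let ?G = "\<lambda>\<xi>. of_real ((W \<xi> - W (\<xi> - E)) * (2 * \<xi>$j - e) / (2 * e)) * ?Z \<xi>"
  have "(\<lambda>n. \<integral>\<xi>. ?g n \<xi> \<partial>lborel) \<longlonglongrightarrow> (\<integral>\<xi>. ?G \<xi> \<partial>lborel)"
  proof (rule integral_dominated_convergence[where w="\<lambda>\<xi>. norm (?G \<xi>)"])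
    show "AE \<xi> in lborel. (\<lambda>n. ?g n \<xi>) \<longlonglongrightarrow> ?G \<xi>"
    proof (rule AE_I2)
      fix \<xi> :: "real^3"
      have "(\<lambda>n. ?g n \<xi>) \<longlonglongrightarrow> \<i> / (2 * of_real e) * (of_real (W \<xi> - W (\<xi> - E)) * (- \<i> * of_real (2 * \<xi>$j - e)) * ?Z \<xi>)"
        by (intro tendsto_mult tendsto_const dil_mult_tendsto s)
      also have "\<i> / (2 * of_real e) * (of_real (W \<xi> - W (\<xi> - E)) * (- \<i> * of_real (2 * \<xi>$j - e)) * ?Z \<xi>) = ?G \<xi>"
        using e by (simp add: field_simps)
      finally show "(\<lambda>n. ?g n \<xi>) \<longlonglongrightarrow> ?G \<xi>" .
    qed
    fix n
    show "AE \<xi> in lborel. norm (?g n \<xi>) \<le> norm (?G \<xi>)"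
    proof (rule AE_I2)
      fix \<xi> :: "real^3"
      have "norm (dil_mult e (s n) (\<xi>$j)) / s n \<le> \<bar>2 * \<xi>$j - e\<bar>"
        using dil_mult_bounds(2)[OF s(2)] s(2)[of n] by (simp add: divide_le_eq mult.commute)
      then have "1 / (2 * e) * (\<bar>W \<xi> - W (\<xi> - E)\<bar> * (norm (dil_mult e (s n) (\<xi>$j)) / s n) * norm (?Z \<xi>))
        \<le> 1 / (2 * e) * (\<bar>W \<xi> - W (\<xi> - E)\<bar> * \<bar>2 * \<xi>$j - e\<bar> * norm (?Z \<xi>))"
        using e by (intro mult_left_mono mult_right_mono) auto
      moreover have "norm (?g n \<xi>) = 1 / (2 * e) * (\<bar>W \<xi> - W (\<xi> - E)\<bar> * (norm (dil_mult e (s n) (\<xi>$j)) / s n) * norm (?Z \<xi>))"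
        using e s(2)[of n] by (simp only: norm_mult norm_divide norm_of_real complex_mod_cnj norm_ii norm_numeral abs_of_pos)
      moreover have "norm (?G \<xi>) = 1 / (2 * e) * (\<bar>W \<xi> - W (\<xi> - E)\<bar> * \<bar>2 * \<xi>$j - e\<bar> * norm (?Z \<xi>))"
        using e by (simp only: norm_mult norm_of_real abs_mult abs_divide) simp
      ultimately show "norm (?g n \<xi>) \<le> norm (?G \<xi>)" by simp
    qed
    show "?g n \<in> borel_measurable lborel" by measurable
  qed (use i3 in \<open>auto intro: borel_measurable_integrable\<close>)
  then have "(\<lambda>n. Re (\<integral>\<xi>. ?g n \<xi> \<partial>lborel) / fourier_const\<^sup>2) \<longlonglongrightarrow> Re (\<integral>\<xi>. ?G \<xi> \<partial>lborel) / fourier_const\<^sup>2"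
    by (intro tendsto_intros) auto
  moreover have "Re (\<integral>\<xi>. ?g n \<xi> \<partial>lborel) / fourier_const\<^sup>2 = wform W F (fdil j e (s n) F) / s n" for n
  proof -
    have "(\<integral>\<xi>. ?g n \<xi> \<partial>lborel) = (1 / of_real (s n)) * (\<integral>\<xi>. \<i> / (2 * of_real e) * (of_real (W \<xi> - W (\<xi> - E)) * cnj (dil_mult e (s n) (\<xi>$j)) * ?Z \<xi>) \<partial>lborel)"
      unfolding integral_mult_right_zero[symmetric] by (intro Bochner_Integration.integral_cong) auto
    then show ?thesis
      unfolding wform_fdil[OF assms(1-3) i1[unfolded E_def] i2[unfolded E_def], folded E_def] by simp
  qed
  ultimately show ?thesis by (simp add: dform_def E_def)
qed

text \<open>Bound and convergence are required only almost everywhere, since the dipolar weights are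
  controlled only off the origin and its shift.\<close>

lemma mult_tendsto_L2:
  fixes k :: "nat \<Rightarrow> real^3 \<Rightarrow> complex"
  assumes f: "f \<in> L2" and [measurable]: "\<And>n. k n \<in> borel_measurable borel" "k' \<in> borel_measurable borel"
    and b: "\<And>n. AE x in lborel. norm (k n x) \<le> C" and l: "AE x in lborel. (\<lambda>n. k n x) \<longlonglongrightarrow> k' x"
  shows "(\<lambda>x. k n x * f x) \<in> L2" "(\<lambda>x. k' x * f x) \<in> L2" "(\<lambda>n. L2_norm (\<lambda>x. k n x * f x - k' x * f x)) \<longlonglongrightarrow> 0"
proof -
  note [measurable] = L2_measurable[OF f]
  have fi: "integrable lborel (\<lambda>x. (norm (f x))\<^sup>2)" using f by (simp add: L2_def)
  have b': "AE x in lborel. norm (k' x) \<le> C"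
  proof -
    have "AE x in lborel. \<forall>n. norm (k n x) \<le> C" using b by (simp add: AE_all_countable)
    then show ?thesis using l
    proof eventually_elim
      case (elim x)
      show ?case by (rule tendsto_upperbound[OF tendsto_norm[OF elim(2)]]) (use elim(1) in auto)
    qed
  qed
  have L: "(\<lambda>x. m x * f x) \<in> L2" if [measurable]: "m \<in> borel_measurable borel" and m: "AE x in lborel. norm (m x) \<le> C" for m
  proof (rule L2_bound[OF integrable_mult_right[OF fi, of "C\<^sup>2"]])
    show "AE x in lborel. (norm (m x * f x))\<^sup>2 \<le> C\<^sup>2 * (norm (f x))\<^sup>2"
      using m by eventually_elim (auto simp: norm_mult power_mult_distrib intro!: mult_right_mono power_mono)
  qed measurable
  show 1: "(\<lambda>x. k n x * f x) \<in> L2" for n by (rule L[OF _ b]) measurable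
  show 2: "(\<lambda>x. k' x * f x) \<in> L2" by (rule L[OF _ b']) measurable
  have "(\<lambda>n. mass (\<lambda>x. k n x * f x - k' x * f x)) \<longlonglongrightarrow> (\<integral>x. 0 \<partial>(lborel :: (real^3) measure))"
    unfolding mass_def
  proof (rule integral_dominated_convergence[where w="\<lambda>x. (2 * C)\<^sup>2 * (norm (f x))\<^sup>2"])
    show "AE x in lborel. (\<lambda>n. (norm (k n x * f x - k' x * f x))\<^sup>2) \<longlonglongrightarrow> 0"
      using l
    proof eventually_elim
      case (elim x)
      have "(\<lambda>n. (norm (k n x * f x - k' x * f x))\<^sup>2) \<longlonglongrightarrow> (norm (k' x * f x - k' x * f x))\<^sup>2"
        by (intro tendsto_intros elim)
      then show ?case by simp
    qed
    show "AE x in lborel. norm ((norm (k n x * f x - k' x * f x))\<^sup>2) \<le> (2 * C)\<^sup>2 * (norm (f x))\<^sup>2" for n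
      using b[of n] b'
    proof eventually_elim
      case (elim x)
      have "norm (k n x - k' x) \<le> 2 * C" using norm_triangle_ineq4[of "k n x" "k' x"] elim by linarith
      then have "(norm (k n x - k' x) * norm (f x))\<^sup>2 \<le> (2 * C * norm (f x))\<^sup>2"
        by (intro power_mono mult_right_mono) auto
      then show ?case by (simp add: norm_mult power_mult_distrib flip: left_diff_distrib)
    qed
  qed (use fi in auto)
  from tendsto_real_sqrt[OF this] show "(\<lambda>n. L2_norm (\<lambda>x. k n x * f x - k' x * f x)) \<longlonglongrightarrow> 0" by (simp add: L2_norm_def)
qed

lemma weight_shift_L2:
  fixes F :: "real^3 \<Rightarrow> complex"
  assumes F: "F \<in> L2" and N: "(\<lambda>\<xi>. of_real (norm \<xi>) * F \<xi>) \<in> L2"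
  shows "(\<lambda>\<xi>. of_real (norm (\<xi> + a)) * F (\<xi> + b)) \<in> L2"
proof -
  note [measurable] = L2_measurable[OF F]
  have 1: "(\<lambda>\<xi>. of_real (norm (\<xi> + b)) * F (\<xi> + b)) \<in> L2" using L2_translate[OF N, of b] .
  have 2: "(\<lambda>\<xi>. of_real (norm (a - b)) * F (\<xi> + b)) \<in> L2" by (rule L2_cmult[OF L2_translate[OF F]])
  show ?thesis
  proof (rule L2_of_bound[OF L2_add[OF 1 2]])
    fix \<xi>
    have "norm (\<xi> + a) \<le> norm (\<xi> + b) + norm (a - b)" using norm_triangle_ineq[of "\<xi> + b" "a - b"] by (simp add: algebra_simps)
    then have "norm (\<xi> + a) * norm (F (\<xi> + b)) \<le> (norm (\<xi> + b) + norm (a - b)) * norm (F (\<xi> + b))" by (intro mult_right_mono) auto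
    moreover have "norm (of_real (norm (\<xi> + b)) * F (\<xi> + b) + of_real (norm (a - b)) * F (\<xi> + b)) = (norm (\<xi> + b) + norm (a - b)) * norm (F (\<xi> + b))"
      unfolding distrib_right[symmetric] of_real_add[symmetric] norm_mult norm_of_real by (simp add: abs_of_nonneg)
    ultimately show "norm (of_real (norm (\<xi> + a)) * F (\<xi> + b)) \<le> norm (of_real (norm (\<xi> + b)) * F (\<xi> + b) + of_real (norm (a - b)) * F (\<xi> + b))"
      by (simp add: norm_mult)
  qed measurable
qed

text \<open>On the Fourier side \<open>dil\<close> consists of two bounded frequency shifts with
  bounded coefficients, and a shift changes |xi| by at most a constant.\<close>

lemma dil_H1:
  assumes u: "u \<in> H1" and e: "e > 0"
  shows "dil j e s u \<in> H1"
proof -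
  have uL: "u \<in> L2" by (rule H1_L2[OF u])
  let ?F = "FT u" and ?E = "e *\<^sub>R axis j (1::real) :: real^3"
  have N: "(\<lambda>\<xi>. of_real (norm \<xi>) * ?F \<xi>) \<in> L2" using H1_fourier(1)[OF has_FT[OF uL]] u by simp
  have s1: "(\<lambda>\<xi>. of_real (norm \<xi>) * ?F (\<xi> + b)) \<in> L2" for b
    using weight_shift_L2[OF FT_L2(1)[OF uL] N, of 0 b] by simp
  have c: "norm (dil_mult e' s (\<xi>$j) / (2 * \<i> * of_real e)) \<le> 1 / e" for e' and \<xi> :: "real^3"
    using dil_mult_bounds(1)[of e' s "\<xi>$j"] e by (simp add: norm_divide norm_mult field_simps)
  have "(\<lambda>\<xi>. dil_mult e s (\<xi>$j) / (2 * \<i> * of_real e) * (of_real (norm \<xi>) * ?F (\<xi> + - ?E)) - dil_mult (- e) s (\<xi>$j) / (2 * \<i> * of_real e) * (of_real (norm \<xi>) * ?F (\<xi> + ?E))) \<in> L2"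
    by (intro L2_diff L2_bounded_mult(1)[OF _ c s1]) measurable
  then have "(\<lambda>\<xi>. of_real (norm \<xi>) * fdil j e s ?F \<xi>) \<in> L2"
    by (simp add: fdil_def diff_divide_distrib algebra_simps)
  then show ?thesis using H1_fourier(1)[OF has_fourier_dil[OF has_FT[OF uL]]] e by simp
qed

text \<open>The constant weight W = 1 in \<open>wform_fdil\<close> has vanishing difference.\<close>

lemma dil_orthogonal:
  assumes u: "u \<in> L2" and e: "e > 0"
  shows "L2_orthogonal u (dil j e s u)"
proof -
  let ?F = "FT u"
  note FL = FT_L2[OF u]
  have i: "integrable lborel (\<lambda>\<xi>. of_real 1 * (?F \<xi> * cnj (?F (\<xi> - e *\<^sub>R axis j 1))))"
    using L2_prod_integrable(2)[OF FL(1) L2_translate[OF FL(1), of "- (e *\<^sub>R axis j 1)"]] by simp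
  have "wform (\<lambda>_. 1) ?F (fdil j e s ?F) = 0"
    by (subst wform_fdil[OF FL(2) _ e i i]) auto
  then have "Re (L2_inner ?F (fdil j e s ?F)) = 0" by (simp add: wform_def L2_inner_def)
  then have "Re (of_real (fourier_const\<^sup>2) * L2_inner u (dil j e s u)) = 0"
    using has_L2_fourier_L2_inner[OF has_FT[OF u] has_fourier_dil[OF has_FT[OF u]], of e j s] e by simp
  then have "Re (L2_inner u (dil j e s u)) = 0" by (simp del: of_real_power)
  then show ?thesis by (simp add: L2_orthogonal_def L2_inner_def)
qed

lemma L2_shift: "F \<in> L2 \<Longrightarrow> (\<lambda>\<xi>. F (\<xi> - b) :: complex) \<in> L2"
  using L2_translate[of F "- b"] by simp

lemma L2_shift_tendsto:
  assumes F: "F \<in> L2" and e: "e \<longlonglongrightarrow> 0"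
  shows "(\<lambda>n. L2_norm (\<lambda>\<xi>. F (\<xi> - e n *\<^sub>R a) - F \<xi>)) \<longlonglongrightarrow> 0"
proof -
  have "(\<lambda>n. - (e n *\<^sub>R a)) \<longlonglongrightarrow> - (0 *\<^sub>R a)" by (intro tendsto_intros e)
  from L2_translate_tendsto[OF F this[simplified]] show "(\<lambda>n. L2_norm (\<lambda>\<xi>. F (\<xi> - e n *\<^sub>R a) - F \<xi>)) \<longlonglongrightarrow> 0" by simp
qed

lemma L2_norm_perturb_tendsto:
  assumes F: "F \<in> L2" "\<And>n. G n \<in> L2" "P \<in> L2" "\<And>n. Pn n \<in> L2"
    and e: "e \<longlonglongrightarrow> 0" and G: "\<And>n. L2_norm (G n) = L2_norm F" and P: "(\<lambda>n. L2_norm (\<lambda>x. Pn n x - P x)) \<longlonglongrightarrow> 0"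
  shows "(\<lambda>n. L2_norm (\<lambda>x. (of_real 2 * Pn n x + of_real (e n) * G n x) - of_real 2 * P x)) \<longlonglongrightarrow> 0"
proof (rule tendsto_0_le[OF L2_norm_nonneg])
  fix n
  have "L2_norm (\<lambda>x. of_real 2 * (Pn n x - P x) + of_real (e n) * G n x) \<le> L2_norm (\<lambda>x. of_real 2 * (Pn n x - P x)) + L2_norm (\<lambda>x. of_real (e n) * G n x)"
    by (intro L2_norm_triangle L2_cmult L2_diff assms)
  then show "L2_norm (\<lambda>x. (of_real 2 * Pn n x + of_real (e n) * G n x) - of_real 2 * P x) \<le> 2 * L2_norm (\<lambda>x. Pn n x - P x) + \<bar>e n\<bar> * L2_norm F"
    unfolding L2_norm_cmult G by (simp add: algebra_simps)
next
  have "(\<lambda>n. 2 * L2_norm (\<lambda>x. Pn n x - P x) + \<bar>e n\<bar> * L2_norm F) \<longlonglongrightarrow> 2 * 0 + \<bar>0\<bar> * L2_norm F"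
    by (intro tendsto_intros P e)
  then show "(\<lambda>n. 2 * L2_norm (\<lambda>x. Pn n x - P x) + \<bar>e n\<bar> * L2_norm F) \<longlonglongrightarrow> 0" by simp
qed

lemma norm_sq_shift: "(norm (\<xi> :: real^3))\<^sup>2 - (norm (\<xi> - e *\<^sub>R axis j 1))\<^sup>2 = e * (2 * \<xi>$j - e)"
  using exhaust_3[of j] unfolding norm_sq_3 by (auto simp: axis_def power2_eq_square algebra_simps)

text \<open>By \<open>norm_sq_shift\<close> the discrete weight is exactly (2 xi_j - e)^2 / 2. One
  factor 2 xi_j - e is given to F and one to its shift, which keeps both square integrable; as e
  tends to 0 both approach 2 xi_j F.\<close>

lemma dirichlet_limits:
  assumes u: "u \<in> H1"
  defines "F \<equiv> FT u"
  shows "\<And>e s. e > 0 \<Longrightarrow> s \<longlonglongrightarrow> 0 \<Longrightarrow> (\<And>n. s n > 0) \<Longrightarrow> (\<lambda>n. aform u (dil j e (s n) u) / s n) \<longlonglongrightarrow> dform (\<lambda>\<xi>. (norm \<xi>)\<^sup>2) j e F"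
    and "\<And>e. e \<longlonglongrightarrow> 0 \<Longrightarrow> (\<And>n. e n > 0) \<Longrightarrow> (\<lambda>n. dform (\<lambda>\<xi>. (norm \<xi>)\<^sup>2) j (e n) F) \<longlonglongrightarrow> 2 * mass (\<lambda>\<xi>. of_real (\<xi>$j) * F \<xi>) / fourier_const\<^sup>2"
proof -
  have uL: "u \<in> L2" by (rule H1_L2[OF u])
  note FL = FT_L2(1)[OF uL, folded F_def] and hF = has_FT[OF uL, folded F_def]
  note [measurable] = FT_L2(2)[OF uL, folded F_def]
  have N: "(\<lambda>\<xi>. of_real (norm \<xi>) * F \<xi>) \<in> L2" using H1_fourier(1)[OF hF] u by simp
  define p where "p \<xi> = of_real (\<xi>$j) * F \<xi>" for \<xi>
  have pL: "p \<in> L2"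
    by (rule L2_of_bound[OF N]) (auto simp: p_def[abs_def] norm_mult intro!: mult_right_mono component_le_norm_cart)
  define P1 where "P1 e \<xi> = of_real 2 * p \<xi> + of_real (- e) * F \<xi>" for e \<xi>
  \<comment> \<open>This is (2 xi_j - e) times the shifted F, written through the shifted
    \<open>p\<close>: there 2 (xi_j - e) + e = 2 xi_j - e.\<close>
  define P2 where "P2 e \<xi> = of_real 2 * p (\<xi> - e *\<^sub>R axis j 1) + of_real e * F (\<xi> - e *\<^sub>R axis j 1)" for e \<xi>
  have PL: "P1 e \<in> L2" "P2 e \<in> L2" for e
    unfolding P1_def[abs_def] P2_def[abs_def] by (intro L2_add L2_cmult pL FL L2_shift)+
  have i3eq: "complex_of_real (((norm \<xi>)\<^sup>2 - (norm (\<xi> - e *\<^sub>R axis j 1))\<^sup>2) * (2 * \<xi>$j - e) / (2 * e)) * (F \<xi> * cnj (F (\<xi> - e *\<^sub>R axis j 1)))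
     = of_real (1 / 2) * (P1 e \<xi> * cnj (P2 e \<xi>))" if "e > 0" for e \<xi>
  proof -
    have "((norm \<xi>)\<^sup>2 - (norm (\<xi> - e *\<^sub>R axis j 1))\<^sup>2) * (2 * \<xi>$j - e) / (2 * e) = 1 / 2 * ((2 * \<xi>$j - e) * (2 * \<xi>$j - e))"
      unfolding norm_sq_shift using that by simp
    moreover have "P1 e \<xi> = of_real (2 * \<xi>$j - e) * F \<xi>" by (simp add: P1_def p_def algebra_simps)
    moreover have "P2 e \<xi> = of_real (2 * \<xi>$j - e) * F (\<xi> - e *\<^sub>R axis j 1)" 
      by (simp add: P2_def p_def axis_component algebra_simps)
    ultimately show ?thesis by (simp only: of_real_mult complex_cnj_mult complex_cnj_complex_of_real mult_ac)
  qed
  show "(\<lambda>n. aform u (dil j e (s n) u) / s n) \<longlonglongrightarrow> dform (\<lambda>\<xi>. (norm \<xi>)\<^sup>2) j e F"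
    if e: "e > 0" and s: "s \<longlonglongrightarrow> 0" "\<And>n. s n > 0" for e s
  proof -
    let ?E = "e *\<^sub>R axis j (1::real) :: real^3"
    have i1: "integrable lborel (\<lambda>\<xi>. of_real ((norm \<xi>)\<^sup>2) * (F \<xi> * cnj (F (\<xi> - ?E))))"
      using L2_prod_integrable(2)[OF N weight_shift_L2[OF FL N, of 0 "- ?E"]] by (simp add: power2_eq_square mult_ac)
    have i2: "integrable lborel (\<lambda>\<xi>. of_real ((norm (\<xi> - ?E))\<^sup>2) * (F \<xi> * cnj (F (\<xi> - ?E))))"
      using L2_prod_integrable(2)[OF weight_shift_L2[OF FL N, of "- ?E" 0] weight_shift_L2[OF FL N, of "- ?E" "- ?E"]] by (simp add: power2_eq_square mult_ac)
    have i3: "integrable lborel (\<lambda>\<xi>. of_real (((norm \<xi>)\<^sup>2 - (norm (\<xi> - ?E))\<^sup>2) * (2 * \<xi>$j - e) / (2 * e)) * (F \<xi> * cnj (F (\<xi> - ?E))))"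
      unfolding i3eq[OF e] by (intro integrable_mult_right L2_prod_integrable PL)
    have "aform u (dil j e (s n) u) = wform (\<lambda>\<xi>. (norm \<xi>)\<^sup>2) F (fdil j e (s n) F)" for n
    proof -
      have h: "has_L2_fourier (dil j e (s n) u) (fdil j e (s n) F)" using has_fourier_dil[OF hF] e by simp
      show ?thesis unfolding aform_def F_def[symmetric]
        by (intro wform_AE_cong FT_AE[OF h] FT_L2 has_L2_fourierD[OF h]) auto
    qed
    then show ?thesis using wform_fdil_tendsto[OF _ _ e i1 i2 i3 s] by simp
  qed
  show "(\<lambda>n. dform (\<lambda>\<xi>. (norm \<xi>)\<^sup>2) j (e n) F) \<longlonglongrightarrow> 2 * mass (\<lambda>\<xi>. of_real (\<xi>$j) * F \<xi>) / fourier_const\<^sup>2"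
    if e: "e \<longlonglongrightarrow> 0" "\<And>n. e n > 0" for e
  proof -
    have d: "dform (\<lambda>\<xi>. (norm \<xi>)\<^sup>2) j (e n) F = Re (of_real (1 / 2) * L2_inner (P1 (e n)) (P2 (e n))) / fourier_const\<^sup>2" for n
      unfolding dform_def i3eq[OF e(2)] L2_inner_def integral_mult_right_zero ..
    have "(\<lambda>n. L2_inner (P1 (e n)) (P2 (e n))) \<longlonglongrightarrow> L2_inner (\<lambda>\<xi>. of_real 2 * p \<xi>) (\<lambda>\<xi>. of_real 2 * p \<xi>)"
    proof (intro L2_inner_tendsto PL L2_cmult pL)
      have me: "(\<lambda>n. - e n) \<longlonglongrightarrow> 0" using tendsto_minus[OF e(1)] by simp
      show "(\<lambda>n. L2_norm (\<lambda>x. P1 (e n) x - of_real 2 * p x)) \<longlonglongrightarrow> 0"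
        unfolding P1_def by (rule L2_norm_perturb_tendsto[OF FL FL pL pL me]) (auto simp: L2_norm_def mass_def)
      show "(\<lambda>n. L2_norm (\<lambda>x. P2 (e n) x - of_real 2 * p x)) \<longlonglongrightarrow> 0"
        unfolding P2_def 
      proof (rule L2_norm_perturb_tendsto[OF FL L2_shift[OF FL] pL L2_shift[OF pL] e(1)])
        show "L2_norm (\<lambda>\<xi>. F (\<xi> - e n *\<^sub>R axis j 1)) = L2_norm F" for n
          using mass_translate[OF FL, of "- (e n *\<^sub>R axis j 1)"] by (simp add: L2_norm_def)
        show "(\<lambda>n. L2_norm (\<lambda>x. p (x - e n *\<^sub>R axis j 1) - p x)) \<longlonglongrightarrow> 0" by (rule L2_shift_tendsto[OF pL e(1)])
      qed
    qed
    then have "(\<lambda>n. Re (of_real (1 / 2) * L2_inner (P1 (e n)) (P2 (e n))) / fourier_const\<^sup>2) \<longlonglongrightarrow> Re (of_real (1 / 2) * L2_inner (\<lambda>\<xi>. of_real 2 * p \<xi>) (\<lambda>\<xi>. of_real 2 * p \<xi>)) / fourier_const\<^sup>2"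
      by (intro tendsto_intros) auto
    also have "Re (of_real (1 / 2) * L2_inner (\<lambda>\<xi>. of_real 2 * p \<xi>) (\<lambda>\<xi>. of_real 2 * p \<xi>)) / fourier_const\<^sup>2 = 2 * mass p / fourier_const\<^sup>2"
      unfolding L2_inner_self mass_cmult by simp
    finally show ?thesis unfolding d by (simp add: p_def[abs_def])
  qed
qed

section \<open>Differences and the radial derivative of the dipolar symbol\<close>

text \<open>Homogeneity of degree 0 reduces to unit vectors a and b: |xi| |a - b| <= 2 |xi - eta|,
  and the difference of squared third components factors with a second factor of modulus at most
  2.\<close>

lemma symbol_lipschitz:
  fixes \<xi> \<eta> :: "real^3"
  assumes \<eta>: "\<eta> \<noteq> 0" and \<xi>: "\<xi> \<noteq> 0"
  shows "\<bar>(\<xi>$3)\<^sup>2 / (norm \<xi>)\<^sup>2 - (\<eta>$3)\<^sup>2 / (norm \<eta>)\<^sup>2\<bar> * norm \<xi> \<le> 4 * norm (\<xi> - \<eta>)"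
proof -
  define a where "a = (1 / norm \<xi>) *\<^sub>R \<xi>"
  define b where "b = (1 / norm \<eta>) *\<^sub>R \<eta>"
  have n: "norm a = 1" "norm b = 1" using \<xi> \<eta> by (auto simp: a_def b_def)
  have "norm \<xi> *\<^sub>R (a - b) = (\<xi> - \<eta>) + (norm \<eta> - norm \<xi>) *\<^sub>R b"
    using \<xi> \<eta> by (simp add: a_def b_def algebra_simps)
  then have "norm (norm \<xi> *\<^sub>R (a - b)) \<le> norm (\<xi> - \<eta>) + norm ((norm \<eta> - norm \<xi>) *\<^sub>R b)"
    by (simp only: norm_triangle_ineq)
  then have "norm \<xi> * norm (a - b) \<le> norm (\<xi> - \<eta>) + \<bar>norm \<eta> - norm \<xi>\<bar>" by (simp add: n)
  also have "\<dots> \<le> 2 * norm (\<xi> - \<eta>)"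
    using norm_triangle_ineq3[of \<eta> \<xi>] by (simp add: norm_minus_commute)
  finally have ab: "norm \<xi> * norm (a - b) \<le> 2 * norm (\<xi> - \<eta>)" .
  have "(\<xi>$3)\<^sup>2 / (norm \<xi>)\<^sup>2 - (\<eta>$3)\<^sup>2 / (norm \<eta>)\<^sup>2 = ((a - b)$3) * ((a + b)$3)"
    by (simp add: a_def b_def power2_eq_square algebra_simps)
  then have "\<bar>(\<xi>$3)\<^sup>2 / (norm \<xi>)\<^sup>2 - (\<eta>$3)\<^sup>2 / (norm \<eta>)\<^sup>2\<bar> \<le> norm (a - b) * 2"
    using component_le_norm_cart[of "a - b" 3] component_le_norm_cart[of "a + b" 3] norm_triangle_ineq[of a b] n
    by (simp only: abs_mult) (intro mult_mono, auto)
  then have "\<bar>(\<xi>$3)\<^sup>2 / (norm \<xi>)\<^sup>2 - (\<eta>$3)\<^sup>2 / (norm \<eta>)\<^sup>2\<bar> * norm \<xi> \<le> norm (a - b) * 2 * norm \<xi>"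
    by (rule mult_right_mono) simp
  also have "\<dots> \<le> 4 * norm (\<xi> - \<eta>)" using ab by (simp add: mult_ac)
  finally show ?thesis .
qed

text \<open>Off the origin the symbol is 4 pi xi_3^2 / |xi|^2 minus a constant, and constants cancel
  in differences.\<close>

lemma msym_diff:
  assumes "\<xi> \<noteq> 0" "\<eta> \<noteq> 0"
  shows "msym l1 l2 \<xi> - msym l1 l2 \<eta> = 4 * pi * l2 * ((\<xi>$3)\<^sup>2 / (norm \<xi>)\<^sup>2 - (\<eta>$3)\<^sup>2 / (norm \<eta>)\<^sup>2)"
proof -
  have "dipolar_symbol \<zeta> = 4 / 3 * pi * (3 * ((\<zeta>$3)\<^sup>2 / (norm \<zeta>)\<^sup>2) - 1)" if "\<zeta> \<noteq> 0" for \<zeta>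
  proof -
    have eq: "2 * (\<zeta> $ 3)\<^sup>2 - (\<zeta> $ 1)\<^sup>2 - (\<zeta> $ 2)\<^sup>2 = 3 * (\<zeta>$3)\<^sup>2 - (norm \<zeta>)\<^sup>2" by (simp add: norm_sq_3)
    show ?thesis using that unfolding dipolar_symbol_def eq by (simp add: diff_divide_distrib)
  qed
  from this[OF assms(1)] this[OF assms(2)] show ?thesis
    unfolding msym_def by (simp only:) (simp add: algebra_simps)
qed

definition Gsym :: "real \<Rightarrow> real \<Rightarrow> 3 \<Rightarrow> real \<Rightarrow> real^3 \<Rightarrow> real" where
  "Gsym l1 l2 j e \<xi> = (msym l1 l2 \<xi> - msym l1 l2 (\<xi> - e *\<^sub>R axis j 1)) * (2 * \<xi>$j - e) / (2 * e)"

text \<open>xi_j times the j-th partial derivative of the weight off the origin, written out by the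
  quotient rule for xi_3^2 / |xi|^2.\<close>

definition gsym :: "real \<Rightarrow> 3 \<Rightarrow> real^3 \<Rightarrow> real" where
  "gsym l2 j \<xi> = 4 * pi * l2 * (\<xi>$j * (2 * (if j = 3 then \<xi>$3 else 0) * (norm \<xi>)\<^sup>2 - 2 * \<xi>$j * (\<xi>$3)\<^sup>2) / ((norm \<xi>)\<^sup>2 * (norm \<xi>)\<^sup>2))"

text \<open>Euler's relation for the homogeneous symbol of degree $0$.\<close>

lemma gsym_sum: "(\<Sum>j\<in>UNIV. gsym l2 j \<xi>) = 0"
proof -
  have "(\<Sum>j\<in>UNIV. \<xi>$j * (2 * (if j = 3 then \<xi>$3 else 0) * (norm \<xi>)\<^sup>2 - 2 * \<xi>$j * (\<xi>$3)\<^sup>2)) = 0"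
    unfolding sum_3 norm_sq_3 by (simp add: power2_eq_square algebra_simps)
  then show ?thesis unfolding gsym_def by (simp flip: sum_distrib_left sum_divide_distrib)
qed

text \<open>Uniform in e although the symbol is discontinuous at 0: with \<eta> the shifted
  frequency, 2 xi_j - e = xi_j + \<eta>_j, and the Lipschitz estimate weighted by |xi| + |\<eta>|
  absorbs this factor and gains e.\<close>

lemma Gsym_bound:
  assumes e: "e > 0" and nz: "\<xi> \<noteq> 0" "\<xi> \<noteq> e *\<^sub>R axis j 1"
  shows "\<bar>Gsym l1 l2 j e \<xi>\<bar> \<le> 16 * pi * \<bar>l2\<bar>"
proof -
  define \<eta> where "\<eta> = \<xi> - e *\<^sub>R axis j 1"
  have \<eta>: "\<eta> \<noteq> 0" using nz by (simp add: \<eta>_def)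
  let ?D = "\<bar>(\<xi>$3)\<^sup>2 / (norm \<xi>)\<^sup>2 - (\<eta>$3)\<^sup>2 / (norm \<eta>)\<^sup>2\<bar>"
  have d: "norm (\<xi> - \<eta>) = e" using e by (simp add: \<eta>_def)
  have "\<bar>2 * \<xi>$j - e\<bar> \<le> norm \<xi> + norm \<eta>"
    using component_le_norm_cart[of \<xi> j] component_le_norm_cart[of \<eta> j] by (simp add: \<eta>_def)
  then have "?D * \<bar>2 * \<xi>$j - e\<bar> \<le> ?D * (norm \<xi> + norm \<eta>)" by (intro mult_left_mono) auto
  also have "\<dots> \<le> 8 * e"
    using symbol_lipschitz[OF \<eta> nz(1)] symbol_lipschitz[OF nz(1) \<eta>] d norm_minus_commute[of \<xi> \<eta>] by (simp add: distrib_left abs_minus_commute)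
  finally have D: "?D * \<bar>2 * \<xi>$j - e\<bar> \<le> 8 * e" .
  have "\<bar>Gsym l1 l2 j e \<xi>\<bar> = 4 * pi * \<bar>l2\<bar> * (?D * \<bar>2 * \<xi>$j - e\<bar>) / (2 * e)"
    unfolding Gsym_def \<eta>_def[symmetric] msym_diff[OF nz(1) \<eta>] using e by (simp add: abs_mult)
  also have "\<dots> \<le> 4 * pi * \<bar>l2\<bar> * (8 * e) / (2 * e)"
    using e by (intro divide_right_mono mult_left_mono D) auto
  finally show ?thesis using e by simp
qed

lemma Gsym_tendsto:
  assumes e: "e \<longlonglongrightarrow> 0" "\<And>n. e n > 0" and \<xi>: "\<xi> \<noteq> 0"
  shows "(\<lambda>n. Gsym l1 l2 j (e n) \<xi>) \<longlonglongrightarrow> gsym l2 j \<xi>"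
proof -
  define E where "E n = e n *\<^sub>R axis j (1::real)" for n
  define d where "d = (if j = 3 then 1 else 0 :: real)"
  have lim\<eta>: "(\<lambda>n. \<xi> - E n) \<longlonglongrightarrow> \<xi>"
  proof -
    have "(\<lambda>n. \<xi> - e n *\<^sub>R axis j 1) \<longlonglongrightarrow> \<xi> - 0 *\<^sub>R axis j 1" by (intro tendsto_intros e)
    then show ?thesis by (simp add: E_def)
  qed
  \<comment> \<open>\<open>Gsym\<close> over a common denominator with one factor e n already
    cancelled, so that its limit can be taken termwise; \<open>d\<close> is the Kronecker symbol for
    j = 3.\<close>
  define q where "q n = 4 * pi * l2 * ((2 * d * \<xi>$3 * (norm \<xi>)\<^sup>2 - e n * d * (norm \<xi>)\<^sup>2 - 2 * \<xi>$j * (\<xi>$3)\<^sup>2 + e n * (\<xi>$3)\<^sup>2) / ((norm \<xi>)\<^sup>2 * (norm (\<xi> - E n))\<^sup>2)) * (2 * \<xi>$j - e n) / 2" for n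
  have "q \<longlonglongrightarrow> 4 * pi * l2 * ((2 * d * \<xi>$3 * (norm \<xi>)\<^sup>2 - 0 * d * (norm \<xi>)\<^sup>2 - 2 * \<xi>$j * (\<xi>$3)\<^sup>2 + 0 * (\<xi>$3)\<^sup>2) / ((norm \<xi>)\<^sup>2 * (norm \<xi>)\<^sup>2)) * (2 * \<xi>$j - 0) / 2"
    unfolding q_def using \<xi> by (intro tendsto_intros e lim\<eta>) auto
  also have "4 * pi * l2 * ((2 * d * \<xi>$3 * (norm \<xi>)\<^sup>2 - 0 * d * (norm \<xi>)\<^sup>2 - 2 * \<xi>$j * (\<xi>$3)\<^sup>2 + 0 * (\<xi>$3)\<^sup>2) / ((norm \<xi>)\<^sup>2 * (norm \<xi>)\<^sup>2)) * (2 * \<xi>$j - 0) / 2 = gsym l2 j \<xi>"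
    by (simp add: gsym_def d_def)
  finally have lim: "q \<longlonglongrightarrow> gsym l2 j \<xi>" .
  \<comment> \<open>A shifted point may hit the origin, where the symbol takes its default value;
    this is excluded only for large n.\<close>
  have "\<forall>\<^sub>F n in sequentially. \<xi> - E n \<noteq> 0" by (rule tendsto_imp_eventually_ne[OF lim\<eta> \<xi>])
  then have "\<forall>\<^sub>F n in sequentially. q n = Gsym l1 l2 j (e n) \<xi>"
  proof eventually_elim
    case (elim n)
    let ?x = "(norm \<xi>)\<^sup>2" and ?y = "(norm (\<xi> - E n))\<^sup>2"
    have nz: "?x \<noteq> 0" "?y \<noteq> 0" "e n \<noteq> 0" using \<xi> elim e(2)[of n] by auto
    have y: "?y = ?x - e n * (2 * \<xi>$j - e n)" using norm_sq_shift[of \<xi> "e n" j] by (simp add: E_def)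
    have c3: "(\<xi> - E n)$3 = \<xi>$3 - e n * d" by (simp add: E_def d_def axis_def)
    have dd: "d * d = d" by (simp add: d_def)
    have "(\<xi>$3)\<^sup>2 * ?y - (\<xi>$3 - e n * d)\<^sup>2 * ?x = (\<xi>$3)\<^sup>2 * (?x - e n * (2 * \<xi>$j - e n)) - (\<xi>$3 - e n * d)\<^sup>2 * ?x" unfolding y ..
    also have "\<dots> = e n * (2 * d * \<xi>$3 * ?x - e n * (d * d) * ?x - 2 * \<xi>$j * (\<xi>$3)\<^sup>2 + e n * (\<xi>$3)\<^sup>2)"
      by (simp add: power2_eq_square algebra_simps)
    finally have num: "(\<xi>$3)\<^sup>2 * ?y - (\<xi>$3 - e n * d)\<^sup>2 * ?x = e n * (2 * d * \<xi>$3 * ?x - e n * d * ?x - 2 * \<xi>$j * (\<xi>$3)\<^sup>2 + e n * (\<xi>$3)\<^sup>2)"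
      unfolding dd by simp
    have "(\<xi>$3)\<^sup>2 / ?x - ((\<xi> - E n)$3)\<^sup>2 / ?y = ((\<xi>$3)\<^sup>2 * ?y - (\<xi>$3 - e n * d)\<^sup>2 * ?x) / (?x * ?y)"
      unfolding c3 using nz by (simp add: field_simps)
    then have D: "(\<xi>$3)\<^sup>2 / ?x - ((\<xi> - E n)$3)\<^sup>2 / ?y = e n * ((2 * d * \<xi>$3 * ?x - e n * d * ?x - 2 * \<xi>$j * (\<xi>$3)\<^sup>2 + e n * (\<xi>$3)\<^sup>2) / (?x * ?y))"
      unfolding num by simp
    show "q n = Gsym l1 l2 j (e n) \<xi>"
      unfolding Gsym_def E_def[symmetric] msym_diff[OF \<xi> elim] D q_def using nz(3) by simp
  qed
  from Lim_transform_eventually[OF lim this] show ?thesis .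
qed

lemma Gsym_borel [measurable]: "Gsym l1 l2 j e \<in> borel_measurable borel"
  unfolding Gsym_def[abs_def] by measurable

lemma gsym_borel [measurable]: "gsym l2 j \<in> borel_measurable borel"
  unfolding gsym_def[abs_def] by measurable

lemma Gsym_AE_bound: "e > 0 \<Longrightarrow> AE \<xi> in lborel. norm (complex_of_real (Gsym l1 l2 j e \<xi>)) \<le> 16 * pi * \<bar>l2\<bar>"
  using AE_lborel_singleton[of 0] AE_lborel_singleton[of "e *\<^sub>R axis j 1"]
  by eventually_elim (simp add: Gsym_bound)

text \<open>The counterpart of \<open>dirichlet_limits\<close> for a bounded weight: no factor has
  to be split off, since \<open>Gsym\<close> times F converges in L^2 by dominated convergence. The
  third claim is Euler's relation integrated against |F|^2.\<close>

lemma interaction_limits: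
  assumes r: "\<rho> \<in> L2"
  defines "F \<equiv> FT \<rho>"
  shows "\<And>e s. e > 0 \<Longrightarrow> s \<longlonglongrightarrow> 0 \<Longrightarrow> (\<And>n. s n > 0) \<Longrightarrow> (\<lambda>n. bform l1 l2 \<rho> (dil j e (s n) \<rho>) / s n) \<longlonglongrightarrow> dform (msym l1 l2) j e F"
    and "\<And>e. e \<longlonglongrightarrow> 0 \<Longrightarrow> (\<And>n. e n > 0) \<Longrightarrow> (\<lambda>n. dform (msym l1 l2) j (e n) F) \<longlonglongrightarrow> Re (L2_inner (\<lambda>\<xi>. of_real (gsym l2 j \<xi>) * F \<xi>) F) / fourier_const\<^sup>2"
    and "(\<Sum>j\<in>UNIV. Re (L2_inner (\<lambda>\<xi>. of_real (gsym l2 j \<xi>) * F \<xi>) F) / fourier_const\<^sup>2) = 0"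
proof -
  note FL = FT_L2(1)[OF r, folded F_def] and hF = has_FT[OF r, folded F_def]
  note [measurable] = FT_L2(2)[OF r, folded F_def]
  have sL: "(\<lambda>\<xi>. F (\<xi> - b)) \<in> L2" for b using L2_translate[OF FL, of "- b"] by simp
  \<comment> \<open>The facts about \<open>gsym\<close> do not mention e; any positive null sequence
    serves to instantiate them.\<close>
  define e0 where "e0 n = inverse (real (Suc n))" for n
  have e0: "e0 \<longlonglongrightarrow> 0" "\<And>n. e0 n > 0" unfolding e0_def using LIMSEQ_inverse_real_of_nat by auto
  have AEt: "AE \<xi> in lborel. (\<lambda>n. complex_of_real (Gsym l1 l2 j (e n) \<xi>)) \<longlonglongrightarrow> of_real (gsym l2 j \<xi>)"
    if "e \<longlonglongrightarrow> 0" "\<And>n. e n > 0" for e j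
    using AE_lborel_singleton[of 0] by eventually_elim (intro tendsto_of_real Gsym_tendsto that)
  have mt: "(\<lambda>\<xi>. of_real (Gsym l1 l2 j (e n) \<xi>) * F \<xi>) \<in> L2" "(\<lambda>\<xi>. of_real (gsym l2 j \<xi>) * F \<xi>) \<in> L2"
    "(\<lambda>n. L2_norm (\<lambda>\<xi>. of_real (Gsym l1 l2 j (e n) \<xi>) * F \<xi> - of_real (gsym l2 j \<xi>) * F \<xi>)) \<longlonglongrightarrow> 0"
    if e: "e \<longlonglongrightarrow> 0" "\<And>n. e n > 0" for e n j
    by (rule mult_tendsto_L2[OF FL _ _ Gsym_AE_bound[OF e(2)] AEt[OF e]]; measurable)+
  have dG: "dform (msym l1 l2) j e F = Re (L2_inner (\<lambda>\<xi>. of_real (Gsym l1 l2 j e \<xi>) * F \<xi>) (\<lambda>\<xi>. F (\<xi> - e *\<^sub>R axis j 1))) / fourier_const\<^sup>2" for e j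
    by (simp only: dform_def Gsym_def[symmetric] L2_inner_def mult.assoc)
  show "(\<lambda>n. bform l1 l2 \<rho> (dil j e (s n) \<rho>) / s n) \<longlonglongrightarrow> dform (msym l1 l2) j e F"
    if e: "e > 0" and s: "s \<longlonglongrightarrow> 0" "\<And>n. s n > 0" for e s
  proof -
    let ?E = "e *\<^sub>R axis j (1::real) :: real^3"
    have i1: "integrable lborel (\<lambda>\<xi>. of_real (msym l1 l2 \<xi>) * (F \<xi> * cnj (F (\<xi> - ?E))))"
      by (rule bform_integrable[OF FL sL])
    have m2: "(\<lambda>\<xi>. of_real (msym l1 l2 (\<xi> - ?E)) * F \<xi>) \<in> L2"
      by (rule L2_bounded_mult(1)[where C="msym_const l1 l2", OF _ _ FL]) (use msym_bound in auto)
    have i2: "integrable lborel (\<lambda>\<xi>. of_real (msym l1 l2 (\<xi> - ?E)) * (F \<xi> * cnj (F (\<xi> - ?E))))"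
      using L2_prod_integrable(2)[OF m2 sL] by (simp add: mult.assoc)
    have m3: "(\<lambda>\<xi>. of_real (Gsym l1 l2 j e \<xi>) * F \<xi>) \<in> L2"
    proof (rule L2_bound)
      show "integrable lborel (\<lambda>x. (16 * pi * \<bar>l2\<bar>)\<^sup>2 * (norm (F x))\<^sup>2)" using FL by (simp add: L2_def)
      show "AE x in lborel. (norm (of_real (Gsym l1 l2 j e x) * F x))\<^sup>2 \<le> (16 * pi * \<bar>l2\<bar>)\<^sup>2 * (norm (F x))\<^sup>2"
        using Gsym_AE_bound[OF e, of l1 l2 j]
      proof eventually_elim
        case (elim x)
        show ?case unfolding norm_mult power_mult_distrib[of "norm (complex_of_real (Gsym l1 l2 j e x))"]
          by (intro mult_right_mono power_mono elim) auto
      qed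
    qed measurable
    have i3: "integrable lborel (\<lambda>\<xi>. of_real ((msym l1 l2 \<xi> - msym l1 l2 (\<xi> - ?E)) * (2 * \<xi>$j - e) / (2 * e)) * (F \<xi> * cnj (F (\<xi> - ?E))))"
      using L2_prod_integrable(2)[OF m3 sL] by (simp only: Gsym_def mult.assoc)
    have "bform l1 l2 \<rho> (dil j e (s n) \<rho>) = wform (msym l1 l2) F (fdil j e (s n) F)" for n
      using e by (intro bform_eqI hF has_fourier_dil) auto
    then show ?thesis using wform_fdil_tendsto[OF _ _ e i1 i2 i3 s] by simp
  qed
  show "(\<lambda>n. dform (msym l1 l2) j (e n) F) \<longlonglongrightarrow> Re (L2_inner (\<lambda>\<xi>. of_real (gsym l2 j \<xi>) * F \<xi>) F) / fourier_const\<^sup>2"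
    if e: "e \<longlonglongrightarrow> 0" "\<And>n. e n > 0" for e
    unfolding dG
    by (intro tendsto_divide tendsto_const tendsto_Re L2_inner_tendsto mt[OF e] FL sL L2_shift_tendsto[OF FL e(1)]) simp
  have "(\<Sum>j\<in>UNIV. L2_inner (\<lambda>\<xi>. of_real (gsym l2 j \<xi>) * F \<xi>) F) = (\<integral>\<xi>. (\<Sum>j\<in>UNIV. of_real (gsym l2 j \<xi>) * F \<xi> * cnj (F \<xi>)) \<partial>lborel)"
    unfolding L2_inner_def by (intro Bochner_Integration.integral_sum[symmetric] L2_prod_integrable mt[OF e0] FL)
  also have "\<dots> = 0" by (simp add: gsym_sum flip: sum_distrib_right of_real_sum)
  finally have "Re (\<Sum>j\<in>UNIV. L2_inner (\<lambda>\<xi>. of_real (gsym l2 j \<xi>) * F \<xi>) F) = 0" by simp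
  then show "(\<Sum>j\<in>UNIV. Re (L2_inner (\<lambda>\<xi>. of_real (gsym l2 j \<xi>) * F \<xi>) F) / fourier_const\<^sup>2) = 0"
    unfolding sum_divide_distrib[symmetric] Re_sum[symmetric] by simp
qed

subsection \<open>The Pohozaev identity\<close>

lemma H1_translate:
  assumes u: "u \<in> H1" shows "(\<lambda>x. u (x + a)) \<in> H1"
proof -
  have uL: "u \<in> L2" by (rule H1_L2[OF u])
  have N: "(\<lambda>\<xi>. of_real (norm \<xi>) * FT u \<xi>) \<in> L2" using H1_fourier(1)[OF has_FT[OF uL]] u by simp
  have "(\<lambda>\<xi>. cis (a \<bullet> \<xi>) * (of_real (norm \<xi>) * FT u \<xi>)) \<in> L2"
    by (rule L2_bounded_mult(1)[where C=1, OF _ _ N]) auto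
  then show ?thesis using H1_fourier(1)[OF has_L2_fourier_translate[OF has_FT[OF uL], of a]] by (simp add: mult_ac)
qed

text \<open>What a single derivative yields: rate s for the difference in L^2, from chord against
  arc, but only convergence without a rate for its gradient, by dominated convergence.\<close>

lemma translate_diff:
  fixes j :: 3 and u :: "real^3 \<Rightarrow> complex" and s :: real
  assumes u: "u \<in> H1" and s: "s > 0"
  defines "w \<equiv> \<lambda>t x. u (x + t *\<^sub>R axis j 1) - u x"
  shows "L2_norm (w s) \<le> s * sqrt (A_fun u)"
    and "\<And>t. t \<longlonglongrightarrow> 0 \<Longrightarrow> (\<lambda>n. A_fun (w (t n))) \<longlonglongrightarrow> 0"
proof -
  have uL: "u \<in> L2" by (rule H1_L2[OF u])
  define F where "F = FT u"
  note hF = has_FT[OF uL, folded F_def] and FL = FT_L2(1)[OF uL, folded F_def]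
  note [measurable] = FT_L2(2)[OF uL, folded F_def]
  define g where "g \<xi> = of_real (norm \<xi>) * F \<xi>" for \<xi>
  have N: "g \<in> L2" using H1_fourier(1)[OF hF] u by (simp add: g_def[abs_def])
  have W: "has_L2_fourier (w t) (\<lambda>\<xi>. (cis (t * \<xi>$j) - 1) * F \<xi>)" for t
    using has_L2_fourier_diff[OF has_L2_fourier_translate[OF hF] hF, of "t *\<^sub>R axis j 1", unfolded inner_scale_axis]
    by (simp add: w_def left_diff_distrib)
  have "norm ((cis (s * \<xi>$j) - 1) * F \<xi>) \<le> norm (of_real s * g \<xi>)" for \<xi>
  proof -
    have "norm (cis (s * \<xi>$j) - 1) \<le> s * norm \<xi>"
      using norm_cis_diff_le[of "s * \<xi>$j" 0] component_le_norm_cart[of \<xi> j] s by (simp add: abs_mult) (smt (verit) mult_left_mono)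
    then have "norm (cis (s * \<xi>$j) - 1) * norm (F \<xi>) \<le> s * norm \<xi> * norm (F \<xi>)" by (intro mult_right_mono) auto
    then show ?thesis using s by (simp add: g_def norm_mult)
  qed
  then have "mass (\<lambda>\<xi>. (cis (s * \<xi>$j) - 1) * F \<xi>) \<le> mass (\<lambda>\<xi>. of_real s * g \<xi>)"
    unfolding mass_def using has_L2_fourierD(2)[OF W, of s] L2_cmult[OF N, of "of_real s"]
    by (intro integral_mono power_mono) (auto simp: L2_def)
  then have "fourier_const\<^sup>2 * mass (w s) \<le> s\<^sup>2 * mass g"
    using has_L2_fourier_mass[OF W, of s] by (simp add: mass_cmult)
  then have "mass (w s) \<le> s\<^sup>2 * A_fun u"
  proof -
    have "mass g = fourier_const\<^sup>2 * A_fun u" using H1_fourier(2)[OF hF u] by (simp add: g_def[abs_def])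
    with \<open>fourier_const\<^sup>2 * mass (w s) \<le> s\<^sup>2 * mass g\<close> have "fourier_const\<^sup>2 * mass (w s) \<le> fourier_const\<^sup>2 * (s\<^sup>2 * A_fun u)"
      by (simp only: mult.left_commute)
    then show ?thesis by (rule mult_left_le_imp_le) (simp add: fourier_const_pos)
  qed
  then have "sqrt (mass (w s)) \<le> sqrt (s\<^sup>2 * A_fun u)" by (rule real_sqrt_le_mono)
  then show "L2_norm (w s) \<le> s * sqrt (A_fun u)" using s by (simp add: L2_norm_def real_sqrt_mult)
  show "(\<lambda>n. A_fun (w (t n))) \<longlonglongrightarrow> 0" if t: "t \<longlonglongrightarrow> 0" for t
  proof -
    have wH: "w (t n) \<in> H1" for n unfolding w_def by (intro H1_diff H1_translate u)
    have "(\<lambda>n. L2_norm (\<lambda>\<xi>. (cis (t n * \<xi>$j) - 1) * g \<xi> - 0 * g \<xi>)) \<longlonglongrightarrow> 0"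
    proof (rule mult_tendsto_L2(3)[OF N, where C=2])
      show "AE \<xi> in lborel. norm (cis (t n * \<xi>$j) - 1) \<le> 2" for n
        by (rule AE_I2) (rule order_trans[OF norm_triangle_ineq4], simp)
      show "AE \<xi> in lborel. (\<lambda>n. cis (t n * \<xi>$j) - 1) \<longlonglongrightarrow> 0"
      proof (rule AE_I2)
        fix \<xi> :: "real^3"
        have "(\<lambda>n. cis (t n * \<xi>$j) - 1) \<longlonglongrightarrow> cis (0 * \<xi>$j) - 1"
          unfolding cis_conv_exp by (intro tendsto_intros t)
        then show "(\<lambda>n. cis (t n * \<xi>$j) - 1) \<longlonglongrightarrow> 0" by simp
      qed
    qed measurable
    then have "(\<lambda>n. (L2_norm (\<lambda>\<xi>. (cis (t n * \<xi>$j) - 1) * g \<xi>))\<^sup>2 / fourier_const\<^sup>2) \<longlonglongrightarrow> 0\<^sup>2 / fourier_const\<^sup>2"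
      by (intro tendsto_intros) auto
    moreover have "A_fun (w (t n)) = (L2_norm (\<lambda>\<xi>. (cis (t n * \<xi>$j) - 1) * g \<xi>))\<^sup>2 / fourier_const\<^sup>2" for n
      unfolding H1_fourier(2)[OF W wH] L2_norm_sq g_def by (simp add: mult_ac)
    ultimately show ?thesis by simp
  qed
qed

text \<open>With w = u(x + a) - u(x) and S = |u(x)| + |u(x + a)|, the squared difference is at most
  |w|^2 S^2. One factor |w| is given up against S, so that |w| S^3 pairs L^2 with L^6. The constant
  128 is 64 for each of the two terms bounding S^6.\<close>

lemma density_translate_diff:
  assumes u: "u \<in> H1"
  obtains C where "C \<ge> 0" "\<And>a. mass (\<lambda>x. Defs.density u x - Defs.density u (x + a)) \<le> L2_norm (\<lambda>x. u (x + a) - u x) * C"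
proof -
  note [measurable] = L2_measurable[OF H1_L2[OF u]]
  define I where "I = (\<integral>x. norm (u x) ^ 6 \<partial>lborel)"
  have i6: "integrable lborel (\<lambda>x. norm (u x) ^ 6)" by (rule sobolev_const(2)[OF u])
  show ?thesis
  proof (rule that[of "sqrt (128 * I)"])
    fix a
    define w where "w = (\<lambda>x. u (x + a) - u x)"
    have wL: "w \<in> L2" unfolding w_def by (intro L2_diff L2_translate H1_L2[OF u])
    note [measurable] = L2_measurable[OF wL]
    define S where "S x = norm (u x) + norm (u (x + a))" for x
    have [measurable]: "S \<in> borel_measurable borel" unfolding S_def[abs_def] by measurable
    have S0: "S x \<ge> 0" for x by (simp add: S_def)
    have wS: "norm (w x) \<le> S x" for x using norm_triangle_ineq4[of "u (x + a)" "u x"] by (simp add: w_def S_def)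
    have i6': "integrable lborel (\<lambda>x. norm (u (x + a)) ^ 6)"
      using integral_translate(2)[of "\<lambda>x. norm (u x) ^ 6" a] i6 by simp
    have I': "(\<integral>x. norm (u (x + a)) ^ 6 \<partial>lborel) = I"
      using integral_translate(1)[of "\<lambda>x. norm (u x) ^ 6" a] by (simp add: I_def)
    have S6: "S x ^ 6 \<le> 64 * norm (u x) ^ 6 + 64 * norm (u (x + a)) ^ 6" for x
    proof -
      let ?m = "max (norm (u x)) (norm (u (x + a)))"
      have "S x ^ 6 \<le> (2 * ?m) ^ 6" unfolding S_def by (intro power_mono) auto
      also have "\<dots> = 64 * ?m ^ 6" by (simp add: power_mult_distrib)
      also have "\<dots> \<le> 64 * norm (u x) ^ 6 + 64 * norm (u (x + a)) ^ 6" by (simp add: max_def)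
      finally show ?thesis .
    qed
    have S6i: "integrable lborel (\<lambda>x. (S x ^ 3)\<^sup>2)"
    proof (rule Bochner_Integration.integrable_bound)
      show "integrable lborel (\<lambda>x. 64 * norm (u x) ^ 6 + 64 * norm (u (x + a)) ^ 6)" using i6 i6' by simp
      show "AE x in lborel. norm ((S x ^ 3)\<^sup>2) \<le> norm (64 * norm (u x) ^ 6 + 64 * norm (u (x + a)) ^ 6)"
        using S6 by (intro AE_I2) (simp flip: power_mult)
    qed measurable
    have S6I: "(\<integral>x. (S x ^ 3)\<^sup>2 \<partial>lborel) \<le> 128 * I"
    proof -
      have "(\<integral>x. (S x ^ 3)\<^sup>2 \<partial>lborel) \<le> (\<integral>x. 64 * norm (u x) ^ 6 + 64 * norm (u (x + a)) ^ 6 \<partial>lborel)"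
        using S6 S6i i6 i6' by (intro integral_mono) (auto simp flip: power_mult)
      also have "\<dots> = 128 * I" using i6 i6' I' by (simp add: I_def)
      finally show ?thesis .
    qed
    have w2: "integrable lborel (\<lambda>x. (norm (w x))\<^sup>2)" using wL by (simp add: L2_def)
    have m: "(\<lambda>x. norm (w x)) \<in> borel_measurable lborel" "(\<lambda>x. S x ^ 3) \<in> borel_measurable lborel" by measurable
    have pw: "(norm (Defs.density u x - Defs.density u (x + a)))\<^sup>2 \<le> norm (w x) * S x ^ 3" for x
    proof -
      have "norm (Defs.density u x - Defs.density u (x + a)) = \<bar>norm (u x) - norm (u (x + a))\<bar> * S x"
      proof -
        have "Defs.density u x - Defs.density u (x + a) = of_real ((norm (u x) - norm (u (x + a))) * S x)"
          unfolding Defs.density_def of_real_diff[symmetric] of_real_eq_iff S_def by (simp add: power2_eq_square algebra_simps)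
        then show ?thesis using S0[of x] by (simp only: norm_of_real abs_mult abs_of_nonneg)
      qed
      also have "\<dots> \<le> norm (w x) * S x"
        using norm_triangle_ineq3[of "u x" "u (x + a)"] S0 by (intro mult_right_mono) (auto simp: w_def norm_minus_commute)
      finally have "(norm (Defs.density u x - Defs.density u (x + a)))\<^sup>2 \<le> (norm (w x) * S x)\<^sup>2" by (rule power_mono) simp
      also have "\<dots> = norm (w x) * (norm (w x) * (S x)\<^sup>2)" by (simp add: power2_eq_square mult_ac)
      also have "\<dots> \<le> norm (w x) * (S x * (S x)\<^sup>2)" using wS S0 by (intro mult_left_mono mult_right_mono) auto
      finally show ?thesis by (simp add: power3_eq_cube power2_eq_square)
    qed
    have dL: "(\<lambda>x. Defs.density u x - Defs.density u (x + a)) \<in> L2"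
      by (intro L2_diff L2_translate density_L2(1)[OF u])
    have "mass (\<lambda>x. Defs.density u x - Defs.density u (x + a)) \<le> (\<integral>x. \<bar>norm (w x) * S x ^ 3\<bar> \<partial>lborel)"
      unfolding mass_def using dL pw S0 integral_CS(1)[OF m w2 S6i]
      by (intro integral_mono integrable_abs) (auto simp: L2_def)
    also have "\<dots> \<le> sqrt (\<integral>x. (norm (w x))\<^sup>2 \<partial>lborel) * sqrt (\<integral>x. (S x ^ 3)\<^sup>2 \<partial>lborel)"
      by (rule integral_CS(2)[OF m w2 S6i])
    also have "\<dots> \<le> L2_norm w * sqrt (128 * I)"
      unfolding L2_norm_def mass_def using S6I by (intro mult_left_mono real_sqrt_le_mono) auto
    finally show "mass (\<lambda>x. Defs.density u x - Defs.density u (x + a)) \<le> L2_norm (\<lambda>x. u (x + a) - u x) * sqrt (128 * I)"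
      by (simp add: w_def)
  qed (simp add: I_def)
qed

lemma phi_mult_L2: "f \<in> L2 \<Longrightarrow> e > 0 \<Longrightarrow> (\<lambda>x. of_real (phi j e x) * f x) \<in> L2"
  and phi_mult_L2_norm: "f \<in> L2 \<Longrightarrow> e > 0 \<Longrightarrow> L2_norm (\<lambda>x. of_real (phi j e x) * f x) \<le> 1 / e * L2_norm f"
proof -
  assume f: "f \<in> L2" and e: "e > 0"
  have b: "norm (complex_of_real (phi j e x)) \<le> 1 / e" for x using phi_bound[OF e] by simp
  note m = L2_bounded_mult[OF _ b f]
  show "(\<lambda>x. of_real (phi j e x) * f x) \<in> L2" by (rule m) measurable
  have "mass (\<lambda>x. of_real (phi j e x) * f x) \<le> (1 / e)\<^sup>2 * mass f" by (rule m) measurable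
  then have "sqrt (mass (\<lambda>x. of_real (phi j e x) * f x)) \<le> sqrt ((1 / e)\<^sup>2 * mass f)" by (rule real_sqrt_le_mono)
  then show "L2_norm (\<lambda>x. of_real (phi j e x) * f x) \<le> 1 / e * L2_norm f" using e by (simp add: L2_norm_def real_sqrt_mult real_sqrt_divide)
qed

text \<open>This is the error of replacing $\mathrm{Re}\,\bar u\,\tau u$ by the mean of the densities of $u$ and $\tau u$.
  It is $o(s)$ although $u$ has only one derivative, because it contains three differences.\<close>

lemma error_term:
  fixes j :: 3 and u :: "real^3 \<Rightarrow> complex" and s :: "nat \<Rightarrow> real"
  assumes u: "u \<in> H1" and e: "e > 0" and s: "s \<longlonglongrightarrow> 0" "\<And>n. s n > 0"
  defines "a \<equiv> \<lambda>n. s n *\<^sub>R axis j (1::real) :: real^3"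
  shows "(\<lambda>n. bform l1 l2 (\<lambda>x. Defs.density u x - Defs.density u (x + a n))
     (\<lambda>x. of_real (phi j e x) * Defs.density (\<lambda>x. u (x + a n) - u x) x) / s n) \<longlonglongrightarrow> 0"
proof -
  define w where "w n = (\<lambda>x. u (x + a n) - u x)" for n
  define D where "D n = (\<lambda>x. Defs.density u x - Defs.density u (x + a n))" for n
  have wH: "w n \<in> H1" for n unfolding w_def by (intro H1_diff H1_translate u)
  have wn: "L2_norm (w n) \<le> s n * sqrt (A_fun u)" for n
    using translate_diff(1)[OF u s(2)] by (simp add: w_def a_def)
  have wA: "(\<lambda>n. A_fun (w n)) \<longlonglongrightarrow> 0"
    using translate_diff(2)[OF u s(2) s(1)] by (simp add: w_def a_def)
  obtain C where C: "C \<ge> 0" "\<And>a. mass (\<lambda>x. Defs.density u x - Defs.density u (x + a)) \<le> L2_norm (\<lambda>x. u (x + a) - u x) * C"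
    using density_translate_diff[OF u] by blast
  have DL: "D n \<in> L2" for n unfolding D_def by (intro L2_diff L2_translate density_L2(1)[OF u])
  have dL: "Defs.density (w n) \<in> L2" for n by (rule density_L2(1)[OF wH])
  let ?q = "\<lambda>n. sqrt (sobolev_const * A_fun (w n) ^ 3)"
  have q0: "?q n \<ge> 0" for n using sobolev_const(1) A_fun_nonneg[OF wH] by simp
  \<comment> \<open>Each of the two masses carries one factor \<open>L2_norm (w n)\<close> of order
    s n; the product of the norms is therefore s n times a quantity vanishing with
    \<open>A_fun (w n)\<close>.\<close>
  have prod: "L2_norm (D n) * L2_norm (Defs.density (w n)) \<le> s n * (sqrt (A_fun u) * sqrt (C * ?q n))" for n
  proof -
    have "(L2_norm (D n) * L2_norm (Defs.density (w n)))\<^sup>2 = mass (D n) * mass (Defs.density (w n))"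
      by (simp add: power_mult_distrib L2_norm_sq)
    also have "\<dots> \<le> (L2_norm (w n) * C) * (L2_norm (w n) * ?q n)"
      using C(2)[of "a n"] density_L2(2)[OF wH] C(1) by (intro mult_mono) (auto simp: D_def w_def)
    also have "\<dots> = (L2_norm (w n))\<^sup>2 * (C * ?q n)" by (simp add: power2_eq_square mult_ac)
    also have "\<dots> \<le> (s n * sqrt (A_fun u))\<^sup>2 * (C * ?q n)"
      using wn C(1) q0 by (intro mult_right_mono power_mono) auto
    also have "\<dots> = (s n * (sqrt (A_fun u) * sqrt (C * ?q n)))\<^sup>2"
      using C(1) q0[of n] by (simp add: power_mult_distrib)
    finally show ?thesis
      by (rule power2_le_imp_le)
        (intro mult_nonneg_nonneg real_sqrt_ge_zero less_imp_le[OF s(2)] A_fun_nonneg[OF u] A_fun_nonneg[OF wH] C(1) sobolev_const(1) zero_le_power)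
  qed
  let ?b = "\<lambda>n. bform l1 l2 (D n) (\<lambda>x. of_real (phi j e x) * Defs.density (w n) x) / s n"
  have "\<bar>?b n\<bar> \<le> msym_const l1 l2 / e * (sqrt (A_fun u) * sqrt (C * ?q n))" for n
  proof -
    have "\<bar>bform l1 l2 (D n) (\<lambda>x. of_real (phi j e x) * Defs.density (w n) x)\<bar> \<le> msym_const l1 l2 * L2_norm (D n) * L2_norm (\<lambda>x. of_real (phi j e x) * Defs.density (w n) x)"
      by (intro bform_bound DL phi_mult_L2 dL e)
    also have "\<dots> \<le> msym_const l1 l2 * L2_norm (D n) * (1 / e * L2_norm (Defs.density (w n)))"
      by (intro mult_left_mono phi_mult_L2_norm dL e) (auto simp: msym_const_nonneg)
    also have "\<dots> = msym_const l1 l2 / e * (L2_norm (D n) * L2_norm (Defs.density (w n)))" by simp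
    also have "\<dots> \<le> msym_const l1 l2 / e * (s n * (sqrt (A_fun u) * sqrt (C * ?q n)))"
      using e msym_const_nonneg by (intro mult_left_mono prod) auto
    finally show ?thesis using s(2)[of n] by (simp add: pos_divide_le_eq mult_ac)
  qed
  moreover have "(\<lambda>n. msym_const l1 l2 / e * (sqrt (A_fun u) * sqrt (C * ?q n))) \<longlonglongrightarrow> msym_const l1 l2 / e * (sqrt (A_fun u) * sqrt (C * sqrt (sobolev_const * 0 ^ 3)))"
    by (intro tendsto_intros wA)
  ultimately have "(\<lambda>n. \<bar>?b n\<bar>) \<longlonglongrightarrow> 0"
    by (intro tendsto_0_le[of "\<lambda>n. \<bar>?b n\<bar>" "\<lambda>n. msym_const l1 l2 / e * (sqrt (A_fun u) * sqrt (C * ?q n))"]) simp_all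
  then have "?b \<longlonglongrightarrow> 0" by (rule tendsto_rabs_zero_cancel)
  then show ?thesis by (simp add: D_def w_def)
qed

text \<open>A product rule for the discrete operator. Translation invariance moves the translation
  onto the first argument. Then Re(conj u(x) u(x + a)) is the mean of the densities at x and x + a
  minus half of |u(x + a) - u(x)|^2. The means regroup into the divergence of the field and the
  operator applied to \<rho>; the square is the error.\<close>

lemma bform_dil:
  fixes j :: 3 and u :: "real^3 \<Rightarrow> complex" and s :: real
  assumes u: "u \<in> H1" and e: "e > 0"
  defines "\<rho> \<equiv> Defs.density u" and "a \<equiv> s *\<^sub>R axis j (1::real) :: real^3"
  shows "bform l1 l2 \<rho> (reprod u (dil j e s u)) =
    (bform l1 l2 \<rho> (\<lambda>x. of_real (phi j e x - phi j e (x - a)) * \<rho> x) + bform l1 l2 \<rho> (dil j e s \<rho>)) / 2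
    - bform l1 l2 (\<lambda>x. \<rho> x - \<rho> (x + a)) (\<lambda>x. of_real (phi j e x) * Defs.density (\<lambda>x. u (x + a) - u x) x) / 2"
proof -
  let ?p = "\<lambda>x. complex_of_real (phi j e x)" and ?b = "bform l1 l2"
  define q where "q = reprod u (\<lambda>x. u (x + a))"
  define d where "d = Defs.density (\<lambda>x. u (x + a) - u x)"
  have r: "\<rho> \<in> L2" unfolding \<rho>_def by (rule density_L2[OF u])
  have tr: "(\<lambda>x. \<rho> (x + a)) \<in> L2" by (rule L2_translate[OF r])
  have qL: "q \<in> L2" unfolding q_def by (intro reprod_L2 u H1_translate)
  have dL: "d \<in> L2" unfolding d_def by (intro density_L2 H1_diff H1_translate u)
  note pL = phi_mult_L2[OF _ e, of _ j]
  have sh: "(\<lambda>x. f (x - a)) \<in> L2" if "f \<in> L2" for f :: "real^3 \<Rightarrow> complex" using L2_shift[OF that] .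
  \<comment> \<open>The adjoint of a translation, from invariance of the form under translating both
    arguments.\<close>
  have bt: "?b \<rho> (\<lambda>x. f (x - a)) = ?b (\<lambda>x. \<rho> (x + a)) f" if f: "f \<in> L2" for f
    using bform_translate[OF r sh[OF f], of l1 l2 a] by simp
  have "reprod u (dil j e s u) = (\<lambda>x. ?p x * q x - ?p (x - a) * q (x - a))"
    by (auto simp: reprod_def dil_def q_def a_def fun_eq_iff algebra_simps simp flip: of_real_mult of_real_diff of_real_add)
  then have "?b \<rho> (reprod u (dil j e s u)) = ?b \<rho> (\<lambda>x. ?p x * q x) - ?b \<rho> (\<lambda>x. ?p (x - a) * q (x - a))"
    by (simp only: bform_diff_right[OF pL[OF qL] sh[OF pL[OF qL]] r])
  also have "\<dots> = ?b (\<lambda>x. \<rho> x - \<rho> (x + a)) (\<lambda>x. ?p x * q x)"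
    by (simp only: bt[OF pL[OF qL]] bform_diff_left[OF r tr pL[OF qL]])
  also have "(\<lambda>x. ?p x * q x) = (\<lambda>x. of_real (1/2) * ((?p x * \<rho> x + ?p x * \<rho> (x + a)) - ?p x * d x))"
  proof
    fix x
    have "q x = of_real (1/2) * (\<rho> x + \<rho> (x + a) - d x)"
      unfolding q_def \<rho>_def d_def density_reprod reprod_def of_real_add[symmetric] of_real_diff[symmetric] of_real_mult[symmetric] of_real_eq_iff
      by (simp add: algebra_simps)
    then show "?p x * q x = of_real (1/2) * ((?p x * \<rho> x + ?p x * \<rho> (x + a)) - ?p x * d x)"
      by (simp only:) (simp add: algebra_simps)
  qed
  also have "?b (\<lambda>x. \<rho> x - \<rho> (x + a)) \<dots> = (1/2) * ((?b (\<lambda>x. \<rho> x - \<rho> (x + a)) (\<lambda>x. ?p x * \<rho> x) + ?b (\<lambda>x. \<rho> x - \<rho> (x + a)) (\<lambda>x. ?p x * \<rho> (x + a)))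
     - ?b (\<lambda>x. \<rho> x - \<rho> (x + a)) (\<lambda>x. ?p x * d x))"
    by (simp only: bform_scale_right[OF L2_diff[OF L2_add[OF pL[OF r] pL[OF tr]] pL[OF dL]] L2_diff[OF r tr]]
        bform_diff_right[OF L2_add[OF pL[OF r] pL[OF tr]] pL[OF dL] L2_diff[OF r tr]] bform_add_right[OF pL[OF r] pL[OF tr] L2_diff[OF r tr]])
  also have "?b (\<lambda>x. \<rho> x - \<rho> (x + a)) (\<lambda>x. ?p x * \<rho> x) = ?b \<rho> (\<lambda>x. ?p x * \<rho> x) - ?b \<rho> (\<lambda>x. ?p (x - a) * \<rho> (x - a))"
    by (simp only: bt[OF pL[OF r]] bform_diff_left[OF r tr pL[OF r]])
  also have "?b (\<lambda>x. \<rho> x - \<rho> (x + a)) (\<lambda>x. ?p x * \<rho> (x + a)) = ?b \<rho> (\<lambda>x. ?p x * \<rho> (x + a)) - ?b \<rho> (\<lambda>x. ?p (x - a) * \<rho> (x - a + a))"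
    by (simp only: bt[OF pL[OF tr]] bform_diff_left[OF r tr pL[OF tr]])
  also have "(\<lambda>x. ?p (x - a) * \<rho> (x - a + a)) = (\<lambda>x. ?p (x - a) * \<rho> x)" by simp
  finally have 1: "?b \<rho> (reprod u (dil j e s u)) = (1/2) * ((?b \<rho> (\<lambda>x. ?p x * \<rho> x) - ?b \<rho> (\<lambda>x. ?p (x - a) * \<rho> (x - a)) +
      (?b \<rho> (\<lambda>x. ?p x * \<rho> (x + a)) - ?b \<rho> (\<lambda>x. ?p (x - a) * \<rho> x))) - ?b (\<lambda>x. \<rho> x - \<rho> (x + a)) (\<lambda>x. ?p x * d x))" .
  have p': "(\<lambda>x. ?p (x - a) * \<rho> x) \<in> L2" using sh[OF pL[OF tr]] by simp
  have 2: "?b \<rho> (\<lambda>x. of_real (phi j e x - phi j e (x - a)) * \<rho> x) = ?b \<rho> (\<lambda>x. ?p x * \<rho> x) - ?b \<rho> (\<lambda>x. ?p (x - a) * \<rho> x)"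
    unfolding of_real_diff left_diff_distrib by (rule bform_diff_right[OF pL[OF r] p' r])
  have 3: "?b \<rho> (dil j e s \<rho>) = ?b \<rho> (\<lambda>x. ?p x * \<rho> (x + a)) - ?b \<rho> (\<lambda>x. ?p (x - a) * \<rho> (x - a))"
    unfolding dil_def[abs_def] a_def[symmetric] by (rule bform_diff_right[OF pL[OF tr] sh[OF pL[OF r]] r])
  show ?thesis unfolding 1 2 3 d_def[symmetric] by simp
qed

lemma bform_tendsto:
  assumes f: "f \<in> L2" and g: "\<And>n. g n \<in> L2" "g' \<in> L2" "(\<lambda>n. L2_norm (\<lambda>x. g n x - g' x)) \<longlonglongrightarrow> 0"
  shows "(\<lambda>n. bform l1 l2 f (g n)) \<longlonglongrightarrow> bform l1 l2 f g'"
proof -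
  have "\<bar>bform l1 l2 f (g n) - bform l1 l2 f g'\<bar> \<le> msym_const l1 l2 * L2_norm f * L2_norm (\<lambda>x. g n x - g' x)" for n
    using bform_bound[OF f L2_diff[OF g(1,2)], of l1 l2 n] by (simp only: bform_diff_right[OF g(1,2) f])
  moreover have "(\<lambda>n. msym_const l1 l2 * L2_norm f * L2_norm (\<lambda>x. g n x - g' x)) \<longlonglongrightarrow> msym_const l1 l2 * L2_norm f * 0"
    by (intro tendsto_intros g)
  ultimately have "(\<lambda>n. \<bar>bform l1 l2 f (g n) - bform l1 l2 f g'\<bar>) \<longlonglongrightarrow> 0"
    by (intro tendsto_0_le[of "\<lambda>n. \<bar>bform l1 l2 f (g n) - bform l1 l2 f g'\<bar>"]) auto
  then have "(\<lambda>n. bform l1 l2 f (g n) - bform l1 l2 f g') \<longlonglongrightarrow> 0" by (rule tendsto_rabs_zero_cancel)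
  then show ?thesis by (rule LIM_zero_cancel)
qed

text \<open>The derivative of sin(e t) / e is cos(e t), the divergence of the truncated field at t =
  x_j, and it tends boundedly to 1.\<close>

lemma divergence_limits:
  assumes r: "\<rho> \<in> L2"
  shows "\<And>e s. e > 0 \<Longrightarrow> s \<longlonglongrightarrow> 0 \<Longrightarrow> (\<And>n. s n > 0) \<Longrightarrow>
      (\<lambda>n. bform l1 l2 \<rho> (\<lambda>x. of_real (phi j e x - phi j e (x - s n *\<^sub>R axis j 1)) * \<rho> x) / s n) \<longlonglongrightarrow> bform l1 l2 \<rho> (\<lambda>x. of_real (cos (e * x$j)) * \<rho> x)"
    and "\<And>e. e \<longlonglongrightarrow> 0 \<Longrightarrow> (\<lambda>n. bform l1 l2 \<rho> (\<lambda>x. of_real (cos (e n * x$j)) * \<rho> x)) \<longlonglongrightarrow> bform l1 l2 \<rho> \<rho>"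
proof -
  show "(\<lambda>n. bform l1 l2 \<rho> (\<lambda>x. of_real (phi j e x - phi j e (x - s n *\<^sub>R axis j 1)) * \<rho> x) / s n) \<longlonglongrightarrow> bform l1 l2 \<rho> (\<lambda>x. of_real (cos (e * x$j)) * \<rho> x)"
    if e: "e > 0" and s: "s \<longlonglongrightarrow> 0" "\<And>n. s n > 0" for e s
  proof -
    define k where "k n x = complex_of_real (1 / s n * (phi j e x - phi j e (x - s n *\<^sub>R axis j 1)))" for n x
    have [measurable]: "k n \<in> borel_measurable borel" for n unfolding k_def[abs_def] by measurable
    \<comment> \<open>The Lipschitz bound of the sine, with constant e, exactly compensates the
      division by e and s n.\<close>
    have kb: "norm (k n x) \<le> 1" for n x
    proof -
      have "\<bar>sin (e * x$j) - sin (e * (x$j - s n))\<bar> \<le> e * s n"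
      proof -
        have "\<bar>sin (e * x$j) - sin (e * (x$j - s n))\<bar> = \<bar>Im (cis (e * x$j) - cis (e * (x$j - s n)))\<bar>" by simp
        also have "\<dots> \<le> norm (cis (e * x$j) - cis (e * (x$j - s n)))" by (rule abs_Im_le_cmod)
        also have "\<dots> \<le> \<bar>e * x$j - e * (x$j - s n)\<bar>" by (rule norm_cis_diff_le)
        also have "e * x$j - e * (x$j - s n) = e * s n" by (simp add: algebra_simps)
        finally show ?thesis using e s(2)[of n] by (simp add: abs_mult)
      qed
      then have "\<bar>sin (e * x$j) - sin (e * (x$j - s n))\<bar> / (e * s n) \<le> 1"
        using e s(2)[of n] by (simp add: pos_divide_le_eq)
      moreover have "norm (k n x) = \<bar>sin (e * x$j) - sin (e * (x$j - s n))\<bar> / (e * s n)"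
        unfolding k_def phi_def axis_component norm_of_real using e s(2)[of n] by (simp add: abs_mult flip: diff_divide_distrib)
      ultimately show ?thesis by simp
    qed
    have kl: "(\<lambda>n. k n x) \<longlonglongrightarrow> complex_of_real (cos (e * x$j))" for x
    proof -
      have "((\<lambda>t. sin (e * t) / e) has_real_derivative cos (e * x$j)) (at (x$j))"
        using e by (auto intro!: derivative_eq_intros)
      then have d: "((\<lambda>h. (sin (e * (x$j + h)) / e - sin (e * x$j) / e) / h) \<longlongrightarrow> cos (e * x$j)) (at 0)"
        by (simp add: DERIV_def)
      have "filterlim (\<lambda>n. - s n) (at 0) sequentially"
        unfolding filterlim_at using tendsto_minus[OF s(1)] s(2) by (auto simp: less_imp_neq[symmetric])
      from filterlim_compose[OF d this]
      have "(\<lambda>n. (sin (e * (x$j + - s n)) / e - sin (e * x$j) / e) / - s n) \<longlonglongrightarrow> cos (e * x$j)" .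
      moreover have "(sin (e * (x$j + - s n)) / e - sin (e * x$j) / e) / - s n = 1 / s n * (phi j e x - phi j e (x - s n *\<^sub>R axis j 1))" for n
        using s(2)[of n] by (simp add: phi_def axis_component field_simps)
      ultimately show ?thesis unfolding k_def by (intro tendsto_of_real) (simp only:)
    qed
    have m: "(\<lambda>x. k n x * \<rho> x) \<in> L2" "(\<lambda>x. of_real (cos (e * x$j)) * \<rho> x) \<in> L2"
      "(\<lambda>n. L2_norm (\<lambda>x. k n x * \<rho> x - of_real (cos (e * x$j)) * \<rho> x)) \<longlonglongrightarrow> 0" for n
      by (rule mult_tendsto_L2[OF r _ _ AE_I2[OF kb] AE_I2[OF kl]]; measurable)+
    have "bform l1 l2 \<rho> (\<lambda>x. k n x * \<rho> x) = bform l1 l2 \<rho> (\<lambda>x. of_real (phi j e x - phi j e (x - s n *\<^sub>R axis j 1)) * \<rho> x) / s n" for n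
    proof -
      have "(\<lambda>x. of_real (phi j e x - phi j e (x - s n *\<^sub>R axis j 1)) * \<rho> x) = (\<lambda>x. of_real (s n) * (k n x * \<rho> x))"
        using s(2)[of n] by (simp add: k_def)
      then show ?thesis using bform_scale_right[OF m(1) r, of l1 l2 "s n" n] s(2)[of n] by simp
    qed
    with bform_tendsto[OF r m, of l1 l2] show ?thesis by simp
  qed
  show "(\<lambda>n. bform l1 l2 \<rho> (\<lambda>x. of_real (cos (e n * x$j)) * \<rho> x)) \<longlonglongrightarrow> bform l1 l2 \<rho> \<rho>"
    if e: "e \<longlonglongrightarrow> 0" for e
  proof -
    have l: "(\<lambda>n. complex_of_real (cos (e n * x$j))) \<longlonglongrightarrow> 1" for x :: "real^3"
    proof -
      have "(\<lambda>n. complex_of_real (cos (e n * x$j))) \<longlonglongrightarrow> of_real (cos (0 * x$j))" by (intro tendsto_intros e)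
      then show ?thesis by simp
    qed
    have b: "norm (complex_of_real (cos (e n * x$j))) \<le> 1" for n and x :: "real^3" by simp
    have m: "(\<lambda>x. of_real (cos (e n * x$j)) * \<rho> x) \<in> L2" "(\<lambda>x. 1 * \<rho> x) \<in> L2"
      "(\<lambda>n. L2_norm (\<lambda>x. of_real (cos (e n * x$j)) * \<rho> x - 1 * \<rho> x)) \<longlonglongrightarrow> 0" for n
      by (rule mult_tendsto_L2[OF r _ _ AE_I2[OF b] AE_I2[OF l]]; measurable)+
    from bform_tendsto[OF r m, of l1 l2] show ?thesis by simp
  qed
qed

text \<open>Criticality is tested in the three coordinate directions separately. Each gives an
  identity containing the anisotropic term \<open>g j\<close>, and only their sum eliminates
  it.\<close>

lemma pohozaev:
  assumes u: "u \<in> H1"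
    and crit: "\<And>h. h \<in> H1 \<Longrightarrow> L2_orthogonal u h \<Longrightarrow> \<alpha> * aform u h + \<beta> * bform l1 l2 (Defs.density u) (reprod u h) = 0"
  shows "4 * \<alpha> * A_fun u + 3 * \<beta> * B_fun l1 l2 u = 0"
proof -
  define \<rho> where "\<rho> = Defs.density u"
  have r: "\<rho> \<in> L2" unfolding \<rho>_def by (rule density_L2[OF u])
  have uL: "u \<in> L2" by (rule H1_L2[OF u])
  define t where "t n = inverse (real (Suc n))" for n
  have t: "t \<longlonglongrightarrow> 0" "\<And>n. t n > 0" unfolding t_def using LIMSEQ_inverse_real_of_nat by auto
  define N where "N = (\<lambda>\<xi>::real^3. (norm \<xi>)\<^sup>2)"
  define m where "m j = mass (\<lambda>\<xi>. of_real (\<xi>$j) * FT u \<xi>)" for j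
  define g where "g j = Re (L2_inner (\<lambda>\<xi>. of_real (gsym l2 j \<xi>) * FT \<rho> \<xi>) (FT \<rho>)) / fourier_const\<^sup>2" for j
  \<comment> \<open>The limit s to 0 at fixed e; this is where the error of \<open>bform_dil\<close>
    disappears.\<close>
  have step: "\<alpha> * dform N j e (FT u) + \<beta> * ((bform l1 l2 \<rho> (\<lambda>x. of_real (cos (e * x$j)) * \<rho> x) + dform (msym l1 l2) j e (FT \<rho>)) / 2) = 0"
    if e: "e > 0" for j e
  proof -
    let ?err = "\<lambda>n. bform l1 l2 (\<lambda>x. \<rho> x - \<rho> (x + t n *\<^sub>R axis j 1)) (\<lambda>x. of_real (phi j e x) * Defs.density (\<lambda>x. u (x + t n *\<^sub>R axis j 1) - u x) x)"
    let ?div = "\<lambda>n. bform l1 l2 \<rho> (\<lambda>x. of_real (phi j e x - phi j e (x - t n *\<^sub>R axis j 1)) * \<rho> x)"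
    have "(\<lambda>n. \<alpha> * (aform u (dil j e (t n) u) / t n) + \<beta> * ((?div n / t n + bform l1 l2 \<rho> (dil j e (t n) \<rho>) / t n) / 2 - ?err n / t n / 2))
      \<longlonglongrightarrow> \<alpha> * dform N j e (FT u) + \<beta> * ((bform l1 l2 \<rho> (\<lambda>x. of_real (cos (e * x$j)) * \<rho> x) + dform (msym l1 l2) j e (FT \<rho>)) / 2 - 0 / 2)"
      unfolding N_def
      by (intro tendsto_add tendsto_mult tendsto_diff tendsto_divide tendsto_const dirichlet_limits(1)[OF u e t] interaction_limits(1)[OF r e t]
          divergence_limits(1)[OF r e t] error_term[OF u e t, folded \<rho>_def]) simp_all
    moreover have "\<alpha> * (aform u (dil j e (t n) u) / t n) + \<beta> * ((?div n / t n + bform l1 l2 \<rho> (dil j e (t n) \<rho>) / t n) / 2 - ?err n / t n / 2) = 0" for n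
    proof -
      have "\<alpha> * aform u (dil j e (t n) u) + \<beta> * ((?div n + bform l1 l2 \<rho> (dil j e (t n) \<rho>)) / 2 - ?err n / 2) = 0"
        using crit[OF dil_H1[OF u e] dil_orthogonal[OF uL e], of j "t n", unfolded bform_dil[OF u e], folded \<rho>_def]
        by simp
      then have "(\<alpha> * aform u (dil j e (t n) u) + \<beta> * ((?div n + bform l1 l2 \<rho> (dil j e (t n) \<rho>)) / 2 - ?err n / 2)) / t n = 0" by simp
      moreover have "\<alpha> * (X / r) + \<beta> * ((Y / r + Z / r) / 2 - W / r / 2) = (\<alpha> * X + \<beta> * ((Y + Z) / 2 - W / 2)) / r" for X Y Z W r :: real
        by (simp add: add_divide_distrib diff_divide_distrib distrib_left right_diff_distrib)
      ultimately show ?thesis by (simp only:)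
    qed
    ultimately show ?thesis using LIMSEQ_unique[OF _ tendsto_const[of 0]] by simp
  qed
  have each: "\<alpha> * (2 * m j / fourier_const\<^sup>2) + \<beta> * ((B_fun l1 l2 u + g j) / 2) = 0" for j
  proof -
    have "(\<lambda>n. \<alpha> * dform N j (t n) (FT u) + \<beta> * ((bform l1 l2 \<rho> (\<lambda>x. of_real (cos (t n * x$j)) * \<rho> x) + dform (msym l1 l2) j (t n) (FT \<rho>)) / 2))
       \<longlonglongrightarrow> \<alpha> * (2 * m j / fourier_const\<^sup>2) + \<beta> * ((bform l1 l2 \<rho> \<rho> + g j) / 2)"
      unfolding N_def m_def g_def
      by (intro tendsto_add tendsto_mult tendsto_divide tendsto_const dirichlet_limits(2)[OF u t] interaction_limits(2)[OF r t] divergence_limits(2)[OF r t(1)]) simp_all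
    then have "\<alpha> * (2 * m j / fourier_const\<^sup>2) + \<beta> * ((bform l1 l2 \<rho> \<rho> + g j) / 2) = 0"
      unfolding step[OF t(2)] using LIMSEQ_unique[OF _ tendsto_const[of 0]] by simp
    then show ?thesis unfolding B_fun_bform[OF u] \<rho>_def .
  qed
  have "(\<Sum>j\<in>UNIV. m j) = mass (grad u)"
  proof -
    have gL: "grad u \<in> L2" using u by (simp add: H1_iff)
    note [measurable] = FT_L2(2)[OF uL]
    have L: "(\<lambda>\<xi>. of_real (\<xi>$j) * FT u \<xi>) \<in> L2" for j
      by (rule L2_of_bound[OF gL]) (auto simp: grad_def norm_mult intro!: mult_right_mono component_le_norm_cart)
    have "(norm (grad u \<xi>))\<^sup>2 = (\<Sum>j\<in>UNIV. (norm (of_real (\<xi>$j) * FT u \<xi>))\<^sup>2)" for \<xi>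
      using norm_xi_components[of \<xi> "FT u \<xi>"] by (simp add: grad_def norm_mult)
    then show ?thesis unfolding m_def mass_def using L
      by (simp only:) (intro Bochner_Integration.integral_sum[symmetric], simp add: L2_def)
  qed
  then have mA: "(\<Sum>j\<in>UNIV. m j / fourier_const\<^sup>2) = A_fun u" by (simp add: A_fun_grad[OF u] flip: sum_divide_distrib)
  have g0: "(\<Sum>j\<in>UNIV. g j) = 0" unfolding g_def by (rule interaction_limits(3)[OF r])
  have "0 = (\<Sum>j\<in>(UNIV::3 set). \<alpha> * (2 * m j / fourier_const\<^sup>2) + \<beta> * ((B_fun l1 l2 u + g j) / 2))" by (simp only: each sum.neutral_const)
  also have "\<dots> = 2 * \<alpha> * (\<Sum>j\<in>UNIV. m j / fourier_const\<^sup>2) + \<beta> / 2 * (3 * B_fun l1 l2 u + (\<Sum>j\<in>UNIV. g j))"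
    unfolding sum_3 by (simp add: algebra_simps add_divide_distrib)
  finally show ?thesis unfolding mA g0 by simp
qed

section \<open>The Lagrange multiplier and its vanishing\<close>

text \<open>Vanishing energy would confine the transform to the origin, a null set, and contradict
  positive mass.\<close>

lemma A_fun_pos:
  assumes u: "u \<in> H1" and m: "mass u > 0"
  shows "A_fun u > 0"
proof (rule ccontr)
  assume "\<not> A_fun u > 0"
  then have A: "mass (grad u) = 0" 
    using fourier_const_pos mass_nonneg[of "grad u"] by (auto simp: A_fun_grad[OF u] zero_less_divide_iff not_less)
  have L: "u \<in> L2" "grad u \<in> L2" using u by (auto simp: H1_iff)
  have "AE \<xi> in lborel. grad u \<xi> = 0" using A mass_eq_0_iff[OF L(2)] by simp
  with AE_lborel_singleton[of 0] have "AE \<xi> in lborel. FT u \<xi> = 0" by eventually_elim (simp add: grad_def)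
  then have "mass (FT u) = 0" using mass_eq_0_iff[OF FT_L2(1)[OF L(1)]] by simp
  then show False using has_L2_fourier_mass[OF has_FT[OF L(1)]] m by simp
qed

lemma L2_orthogonal_iff: "L2_orthogonal u h \<longleftrightarrow> Re (L2_inner u h) = 0"
  by (simp add: L2_orthogonal_def L2_inner_def)

theorem lemma1p1:
  fixes l1 l2 c :: real
  assumes "unstable_regime l1 l2"
    and "c > 0"
  shows "\<forall>u. critical_point_on_V l1 l2 c u \<longrightarrow> critical_point_on_S l1 l2 c u"
proof (intro allI impI)
  fix u assume V: "critical_point_on_V l1 l2 c u"
  then have u: "u \<in> H1" and m: "mass u = c" and Q: "Q_fun l1 l2 u = 0"
    by (auto simp: critical_point_on_V_def V_set_def S_set_def)
  define b where "b h = bform l1 l2 (Defs.density u) (reprod u h)" for h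
  have r: "Defs.density u \<in> L2" by (rule density_L2[OF u])
  have dE: "H1_derivative (E_fun l1 l2) u h = aform u h + 2 * b h" 
    and dQ: "H1_derivative (Q_fun l1 l2) u h = 2 * aform u h + 6 * b h" if "h \<in> H1" for h
    using E_derivative[OF u that] Q_derivative[OF u that] by (auto simp: b_def)
  have crit: "aform u h + 2 * b h = 0" if "h \<in> H1" "L2_orthogonal u h" "2 * aform u h + 6 * b h = 0" for h
    using V that dE dQ unfolding critical_point_on_V_def by auto
  have "aform u h + 2 * b h = 0" if h: "h \<in> H1" "L2_orthogonal u h" for h
  \<comment> \<open>Either the derivative of Q vanishes on all directions orthogonal to u, and then
    each of them is tangent to V(c), or some k is transversal and defines a multiplier.\<close>
  proof (cases "\<forall>k\<in>H1. L2_orthogonal u k \<longrightarrow> 2 * aform u k + 6 * b k = 0")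
    case True
    then show ?thesis using crit h by blast
  next
    case False
    then obtain k where k: "k \<in> H1" "L2_orthogonal u k" "2 * aform u k + 6 * b k \<noteq> 0" by blast
    define \<mu> where "\<mu> = (aform u k + 2 * b k) / (2 * aform u k + 6 * b k)"
    have lin: "aform u h + 2 * b h = \<mu> * (2 * aform u h + 6 * b h)" if h: "h \<in> H1" "L2_orthogonal u h" for h
    proof -
      \<comment> \<open>Subtracting t k from h annihilates the derivative of Q and preserves
        orthogonality, so the corrected direction is tangent to V(c).\<close>
      define t where "t = (2 * aform u h + 6 * b h) / (2 * aform u k + 6 * b k)"
      let ?v = "\<lambda>x. h x + (- t) *\<^sub>R k x"
      have kt: "(\<lambda>x. (- t) *\<^sub>R k x) \<in> H1" by (rule H1_scaleR[OF k(1)])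
      have v: "?v \<in> H1" by (rule H1_add[OF h(1) kt])
      have av: "aform u ?v = aform u h - t * aform u k"
        unfolding aform_commute[of u] aform_add_left[OF h(1) kt u] aform_scaleR_left[OF k(1) u] by simp
      have bv: "b ?v = b h - t * b k"
        unfolding b_def reprod_add reprod_scaleR
          bform_add_right[OF reprod_L2(1)[OF u h(1)] L2_cmult[OF reprod_L2(1)[OF u k(1)]] r] bform_scale_right[OF reprod_L2(1)[OF u k(1)] r] by simp
      have "L2_inner u ?v = L2_inner u h + L2_inner u (\<lambda>x. (- t) *\<^sub>R k x)"
        by (rule L2_inner_add_right[OF H1_L2[OF h(1)] H1_L2[OF kt] H1_L2[OF u]])
      also have "L2_inner u (\<lambda>x. (- t) *\<^sub>R k x) = of_real (- t) * L2_inner u k"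
        unfolding scaleR_conv_of_real L2_inner_cmult_right by simp
      finally have ov: "L2_orthogonal u ?v" using h(2) k(2) by (simp add: L2_orthogonal_iff)
      have tk: "t * (2 * aform u k + 6 * b k) = 2 * aform u h + 6 * b h" using k(3) by (simp add: t_def)
      have "2 * aform u ?v + 6 * b ?v = 0" unfolding av bv using tk by (simp add: algebra_simps)
      from crit[OF v ov this] have "aform u h + 2 * b h = t * (aform u k + 2 * b k)" unfolding av bv by (simp add: algebra_simps)
      then show ?thesis by (simp add: \<mu>_def t_def)
    qed
    have "(1 - 2 * \<mu>) * aform u h + (2 - 6 * \<mu>) * bform l1 l2 (Defs.density u) (reprod u h) = 0" if "h \<in> H1" "L2_orthogonal u h" for h
      using lin[OF that] unfolding b_def by (simp add: algebra_simps)
    from pohozaev[OF u this] have "4 * (1 - 2 * \<mu>) * A_fun u + 3 * (2 - 6 * \<mu>) * B_fun l1 l2 u = 0" .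
    moreover have "B_fun l1 l2 u = - (2 / 3) * A_fun u" using Q by (simp add: Q_fun_def)
    \<comment> \<open>With 3 B = -2 A the identity reads (4 - 8 \<mu> - 4 + 12 \<mu>) A = 0, that is
      4 \<mu> A = 0.\<close>
    ultimately have "\<mu> * A_fun u = 0" by (simp only:) (simp add: algebra_simps)
    then have "\<mu> = 0" using A_fun_pos[OF u] m assms(2) by simp
    then show ?thesis using lin[OF h] by simp
  qed
  then show "critical_point_on_S l1 l2 c u"
    using V dE by (auto simp: critical_point_on_S_def critical_point_on_V_def V_set_def)
qed

end
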